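(* Let $(E_7)^{\lambda\gamma}=\{\alpha\in E_7\mid(\lambda\gamma)\alpha(\lambda\gamma)^{-1}=\alpha\}$ and $(E_7)^{\lambda\gamma\sigma}=\{\alpha\in E_7\mid(\lambda\gamma\sigma)\alpha(\lambda\gamma\sigma)^{-1}=\alpha\}$. Then $$(E_7)^{\lambda\gamma}\cap (E_7)^{\lambda\gamma\sigma}\;\cong\;\big((U(1)\times SU(4)\times SU(4))/(\mathbf{Z}_2\times\mathbf{Z}_4)\big)\rtimes\mathcal{Z}_2,$$ where $\mathbf{Z}_2=\{(1,E,E),(1,-E,-E)\}$, $\mathbf{Z}_4=\{(1,E,E),(-1,-E,-E),(e_1,-e_1E,e_1E),(-e_1,e_1E,-e_1E)\}$, and $\mathcal{Z}_2=\{1,\varepsilon\}$ is a group of order $2$ acting through $\varepsilon(a,A,B)=(a^{-1},B,A)$.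
   Context: Let $\mathbf{H}$ be the quaternions, $\mathbf{C}=\mathbf{R}\oplus\mathbf{R}e_1\subset\mathbf{H}$, and $\mathfrak{C}=\mathbf{H}\oplus\mathbf{H}e_4$ the division Cayley algebra with product $(m+ae_4)(n+be_4)=(mn-\overline{b}a)+(a\overline{n}+bm)e_4$. Let $\mathfrak{J}=\{X\in M(3,\mathfrak{C})\mid X^*=X\}$, with elements $X=\begin{pmatrix}\xi_1&x_3&\overline{x}_2\\ \overline{x}_3&\xi_2&x_1\\ x_2&\overline{x}_1&\xi_3\end{pmatrix}$, $\mathfrak{J}^C=\mathfrak{J}\oplus i\mathfrak{J}$ its complexification ($C=\mathbf{R}\oplus\mathbf{R}i$), $\tau$ the complex conjugation, $X\circ Y=\frac12(XY+YX)$, $(X,Y)=\mathrm{tr}(X\circ Y)$, $X\times Y=\frac12\big(2X\circ Y-\mathrm{tr}(X)Y-\mathrm{tr}(Y)X+(\mathrm{tr}(X)\mathrm{tr}(Y)-(X,Y))E\big)$, $\langle X,Y\rangle=(\tau X,Y)$. Let ${\mathfrak{e}_6}^C=\{\phi\in\mathrm{Hom}_C(\mathfrak{J}^C,\mathfrak{J}^C)\mid(\phi X,X\times X)=0\}$, and ${}^t\phi$ the transpose with respect to $(X,Y)$. For $X,W\in\mathfrak{J}^C$ define $X\vee W\in{\mathfrak{e}_6}^C$ by $(X\vee W)U=\frac12(W,U)X+\frac16(X,W)U-2W\times(X\times U)$. Let $\mathfrak{P}^C=\mathfrak{J}^C\oplus\mathfrak{J}^C\oplus C\oplus C$ with $\langle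 P,Q\rangle=\langle X,Z\rangle+\langle Y,W\rangle+(\tau\xi)\zeta+(\tau\eta)\omega$ for $P=(X,Y,\xi,\eta)$, $Q=(Z,W,\zeta,\omega)$. For $\phi\in{\mathfrak{e}_6}^C$, $A,B\in\mathfrak{J}^C$, $\nu\in C$ define $\varPhi(\phi,A,B,\nu):\mathfrak{P}^C\to\mathfrak{P}^C$ by $(X,Y,\xi,\eta)\mapsto(\phi X-\frac13\nu X+2B\times Y+\eta A,\ 2A\times X-{}^t\phi Y+\frac13\nu Y+\xi B,\ (A,Y)+\nu\xi,\ (B,X)-\nu\eta)$. Define $P\times Q=\varPhi(\phi,A,B,\nu)$ with $\phi=-\frac12(X\vee W+Z\vee Y)$, $A=-\frac14(2Y\times W-\xi Z-\zeta X)$, $B=\frac14(2X\times Z-\eta W-\omega Y)$, $\nu=\frac18((X,W)+(Z,Y)-3(\xi\omega+\zeta\eta))$. Then $E_7=\{\alpha\in\mathrm{Iso}_C(\mathfrak{P}^C)\mid\alpha(P\times Q)\alpha^{-1}=\alpha P\times\alpha Q,\ \langle\alpha P,\alpha Q\rangle=\langle P,Q\rangle\}$. Elements of $E_7$: $\gamma(X,Y,\xi,\eta)=(\gamma X,\gamma Y,\xi,\eta)$ with $\gamma$ acting on $\mathfrak{J}^C$ entrywise ($C$-linearly) by $\gamma(x+ye_4)=x-ye_4$ ($x,y\in\mathbf{H}$); $\sigma(X,Y,\xi,\eta)=(\sigma X,\sigma Y,\xi,\eta)$ with $\sigma$ on $\mathfrak{J}^C$ keeping $\xi_1,\xi_2,\xi_3,x_1$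 and replacing $x_2,x_3$ by $-x_2,-x_3$; $\lambda(X,Y,\xi,\eta)=(Y,-X,\eta,-\xi)$. $U(1)$ and $SU(4)$ are the usual unitary groups over $\mathbf{C}$ (imaginary unit $e_1$). The action of $\mathcal{Z}_2$ on $U(1)\times SU(4)\times SU(4)$ induces the action on the quotient. *)

theory Defs
  imports "HOL-Analysis.Analysis" "HOL-Algebra.Coset"
begin

section \<open>Complex vector spaces with a complex conjugation\<close>

text \<open>A complex vector space that is the complexification of a real form: \<open>\<tau>\<close> is the
  conjugation whose fixed points are the real form. The complex unit \<open>\<i>\<close> below is the unit \<open>i\<close>
  of the complexification; it is unrelated to the octonion unit \<open>e\<^sub>1\<close>.\<close>

class complexified = ab_group_add +
  fixes scaleC :: "complex \<Rightarrow> 'a \<Rightarrow> 'a"  (infixr \<open>*\<^sub>C\<close> 75)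
    and conjC :: "'a \<Rightarrow> 'a"  (\<open>\<tau>\<close>)
  assumes scaleC_add_right: "a *\<^sub>C (x + y) = a *\<^sub>C x + a *\<^sub>C y"
    and scaleC_add_left: "(a + b) *\<^sub>C x = a *\<^sub>C x + b *\<^sub>C x"
    and scaleC_scaleC: "a *\<^sub>C (b *\<^sub>C x) = (a * b) *\<^sub>C x"
    and scaleC_one: "1 *\<^sub>C x = x"
    and conjC_add: "\<tau> (x + y) = \<tau> x + \<tau> y"
    and conjC_scaleC: "\<tau> (a *\<^sub>C x) = cnj a *\<^sub>C \<tau> x"
    and conjC_conjC: "\<tau> (\<tau> x) = x"

instantiation complex :: complexified
begin
definition "a *\<^sub>C (x::complex) = a * x"
definition "\<tau> (x::complex) = cnj x"
instance
  by standard (simp_all add: scaleC_complex_def conjC_complex_def algebra_simps)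
end

instantiation prod :: (complexified, complexified) complexified
begin
definition "a *\<^sub>C p = (a *\<^sub>C fst p, a *\<^sub>C snd p)"
definition "\<tau> p = (\<tau> (fst p), \<tau> (snd p))"
instance
  by standard (simp_all add: scaleC_prod_def conjC_prod_def scaleC_add_right scaleC_add_left
      scaleC_scaleC scaleC_one conjC_add conjC_scaleC conjC_conjC)
end

lemma vector_space_scaleC: "vector_space (scaleC :: complex \<Rightarrow> 'a::complexified \<Rightarrow> 'a)"
  by unfold_locales (simp_all add: scaleC_add_right scaleC_add_left scaleC_scaleC scaleC_one)

abbreviation clinear :: "('a::complexified \<Rightarrow> 'b::complexified) \<Rightarrow> bool"
  where "clinear \<equiv> Vector_Spaces.linear (*\<^sub>C) (*\<^sub>C)"


section \<open>Quaternions and Cayley numbers over a commutative ring\<close>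

text \<open>For \<open>'a = real\<close> these are the quaternions \<open>H\<close> and the division Cayley algebra; for
  \<open>'a = complex\<close> they are the complexifications, with product and conjugation extended
  \<open>C\<close>-bilinearly and \<open>C\<close>-linearly. The tuple \<open>(a, b, c, d)\<close> stands for
  \<open>a + b e\<^sub>1 + c e\<^sub>2 + d e\<^sub>3\<close>, and \<open>(m, a)\<close> for \<open>m + a e\<^sub>4\<close>.\<close>

type_synonym 'a quat = "'a \<times> 'a \<times> 'a \<times> 'a"
type_synonym 'a cayley = "'a quat \<times> 'a quat"

fun quat_mult :: "'a::comm_ring_1 quat \<Rightarrow> 'a quat \<Rightarrow> 'a quat" where
  "quat_mult (a0, a1, a2, a3) (b0, b1, b2, b3) =
    (a0 * b0 - a1 * b1 - a2 * b2 - a3 * b3,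
     a0 * b1 + a1 * b0 + a2 * b3 - a3 * b2,
     a0 * b2 - a1 * b3 + a2 * b0 + a3 * b1,
     a0 * b3 + a1 * b2 - a2 * b1 + a3 * b0)"

fun quat_cnj :: "'a::comm_ring_1 quat \<Rightarrow> 'a quat" where
  "quat_cnj (a0, a1, a2, a3) = (a0, - a1, - a2, - a3)"

fun cay_mult :: "'a::comm_ring_1 cayley \<Rightarrow> 'a cayley \<Rightarrow> 'a cayley" where
  "cay_mult (m, a) (n, b) =
    (quat_mult m n - quat_mult (quat_cnj b) a, quat_mult a (quat_cnj n) + quat_mult b m)"

fun cay_cnj :: "'a::comm_ring_1 cayley \<Rightarrow> 'a cayley" where
  "cay_cnj (m, a) = (quat_cnj m, - a)"

fun cay_gamma :: "'a::comm_ring_1 cayley \<Rightarrow> 'a cayley" where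
  "cay_gamma (x, y) = (x, - y)"

definition cay_scalar :: "'a::comm_ring_1 \<Rightarrow> 'a cayley" where
  "cay_scalar r = ((r, 0, 0, 0), 0)"

definition cay_re :: "'a::comm_ring_1 cayley \<Rightarrow> 'a" where
  "cay_re x = fst (fst x)"


section \<open>The complex exceptional Jordan algebra\<close>

definition mat_mult :: "'a::comm_ring_1 cayley^3^3 \<Rightarrow> 'a cayley^3^3 \<Rightarrow> 'a cayley^3^3" where
  "mat_mult M N = (\<chi> i j. \<Sum>k\<in>UNIV. cay_mult (M $ i $ k) (N $ k $ j))"

definition mat_star :: "'a::comm_ring_1 cayley^3^3 \<Rightarrow> 'a cayley^3^3" where
  "mat_star M = (\<chi> i j. cay_cnj (M $ j $ i))"

text \<open>An element of \<open>J\<^sup>C = {X \<in> M(3, complexified Cayley algebra). X\<^sup>* = X}\<close> is given by its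
  coordinates \<open>(\<xi>\<^sub>1, \<xi>\<^sub>2, \<xi>\<^sub>3, x\<^sub>1, x\<^sub>2, x\<^sub>3)\<close>; that \<open>jmat\<close> is a bijection onto the Hermitian matrices is
  lemma \<open>bij_betw_jmat\<close> below.\<close>

type_synonym jordan =
  "complex \<times> complex \<times> complex \<times> complex cayley \<times> complex cayley \<times> complex cayley"

fun jmat :: "jordan \<Rightarrow> complex cayley^3^3" where
  "jmat (\<xi>1, \<xi>2, \<xi>3, x1, x2, x3) = vector
    [vector [cay_scalar \<xi>1, x3, cay_cnj x2],
     vector [cay_cnj x3, cay_scalar \<xi>2, x1],
     vector [x2, cay_cnj x1, cay_scalar \<xi>3]]"

definition jcoord :: "complex cayley^3^3 \<Rightarrow> jordan" where
  "jcoord M = (cay_re (M $ 1 $ 1), cay_re (M $ 2 $ 2), cay_re (M $ 3 $ 3),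
               M $ 2 $ 3, M $ 3 $ 1, M $ 1 $ 2)"

definition jtimes :: "jordan \<Rightarrow> jordan \<Rightarrow> jordan"  (infixl \<open>\<circ>\<^sub>J\<close> 70) where
  "X \<circ>\<^sub>J Y = (1/2) *\<^sub>C jcoord (mat_mult (jmat X) (jmat Y) + mat_mult (jmat Y) (jmat X))"

definition jtr :: "jordan \<Rightarrow> complex" where
  "jtr X = cay_re (\<Sum>i\<in>UNIV. jmat X $ i $ i)"

definition jform :: "jordan \<Rightarrow> jordan \<Rightarrow> complex" where
  "jform X Y = jtr (X \<circ>\<^sub>J Y)"

definition jherm :: "jordan \<Rightarrow> jordan \<Rightarrow> complex" where
  "jherm X Y = jform (\<tau> X) Y"

definition jone :: jordan where
  "jone = (1, 1, 1, 0, 0, 0)"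

definition jcross :: "jordan \<Rightarrow> jordan \<Rightarrow> jordan"  (infixl \<open>\<times>\<^sub>J\<close> 70) where
  "X \<times>\<^sub>J Y = (1/2) *\<^sub>C
    (2 *\<^sub>C (X \<circ>\<^sub>J Y) - jtr X *\<^sub>C Y - jtr Y *\<^sub>C X + (jtr X * jtr Y - jform X Y) *\<^sub>C jone)"

definition jtranspose :: "(jordan \<Rightarrow> jordan) \<Rightarrow> jordan \<Rightarrow> jordan" where
  "jtranspose \<phi> = (THE \<psi>. \<forall>X Y. jform (\<phi> X) Y = jform X (\<psi> Y))"

definition jvee :: "jordan \<Rightarrow> jordan \<Rightarrow> jordan \<Rightarrow> jordan" where
  "jvee X W U = (1/2 * jform W U) *\<^sub>C X + (1/6 * jform X W) *\<^sub>C U - 2 *\<^sub>C (W \<times>\<^sub>J (X \<times>\<^sub>J U))"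


section \<open>The Freudenthal space and the compact group of type E7\<close>

type_synonym freud = "jordan \<times> jordan \<times> complex \<times> complex"

fun fherm :: "freud \<Rightarrow> freud \<Rightarrow> complex" where
  "fherm (X, Y, \<xi>, \<eta>) (Z, W, \<zeta>, \<omega>) = jherm X Z + jherm Y W + \<tau> \<xi> * \<zeta> + \<tau> \<eta> * \<omega>"

fun Phi :: "(jordan \<Rightarrow> jordan) \<Rightarrow> jordan \<Rightarrow> jordan \<Rightarrow> complex \<Rightarrow> freud \<Rightarrow> freud" where
  "Phi \<phi> A B \<nu> (X, Y, \<xi>, \<eta>) =
    (\<phi> X - (1/3 * \<nu>) *\<^sub>C X + 2 *\<^sub>C (B \<times>\<^sub>J Y) + \<eta> *\<^sub>C A,
     2 *\<^sub>C (A \<times>\<^sub>J X) - jtranspose \<phi> Y + (1/3 * \<nu>) *\<^sub>C Y + \<xi> *\<^sub>C B,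
     jform A Y + \<nu> * \<xi>,
     jform B X - \<nu> * \<eta>)"

fun fcross :: "freud \<Rightarrow> freud \<Rightarrow> freud \<Rightarrow> freud" where
  "fcross (X, Y, \<xi>, \<eta>) (Z, W, \<zeta>, \<omega>) =
    Phi (\<lambda>U. (- (1/2)) *\<^sub>C (jvee X W U + jvee Z Y U))
        ((- (1/4)) *\<^sub>C (2 *\<^sub>C (Y \<times>\<^sub>J W) - \<xi> *\<^sub>C Z - \<zeta> *\<^sub>C X))
        ((1/4) *\<^sub>C (2 *\<^sub>C (X \<times>\<^sub>J Z) - \<eta> *\<^sub>C W - \<omega> *\<^sub>C Y))
        (1/8 * (jform X W + jform Z Y - 3 * (\<xi> * \<omega> + \<zeta> * \<eta>)))"

definition E7 :: "(freud \<Rightarrow> freud) set" where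
  "E7 = {\<alpha>. clinear \<alpha> \<and> bij \<alpha> \<and>
         (\<forall>P Q. \<alpha> \<circ> fcross P Q \<circ> inv_into UNIV \<alpha> = fcross (\<alpha> P) (\<alpha> Q)) \<and>
         (\<forall>P Q. fherm (\<alpha> P) (\<alpha> Q) = fherm P Q)}"

definition jgamma :: "jordan \<Rightarrow> jordan" where
  "jgamma X = jcoord (map_matrix cay_gamma (jmat X))"

fun jsigma :: "jordan \<Rightarrow> jordan" where
  "jsigma (\<xi>1, \<xi>2, \<xi>3, x1, x2, x3) = (\<xi>1, \<xi>2, \<xi>3, x1, - x2, - x3)"

fun gamma7 :: "freud \<Rightarrow> freud" where
  "gamma7 (X, Y, \<xi>, \<eta>) = (jgamma X, jgamma Y, \<xi>, \<eta>)"

fun sigma7 :: "freud \<Rightarrow> freud" where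
  "sigma7 (X, Y, \<xi>, \<eta>) = (jsigma X, jsigma Y, \<xi>, \<eta>)"

fun lambda7 :: "freud \<Rightarrow> freud" where
  "lambda7 (X, Y, \<xi>, \<eta>) = (Y, - X, \<eta>, - \<xi>)"

definition E7_fix :: "(freud \<Rightarrow> freud) \<Rightarrow> (freud \<Rightarrow> freud) set" where
  "E7_fix \<delta> = {\<alpha> \<in> E7. \<delta> \<circ> \<alpha> \<circ> inv_into UNIV \<delta> = \<alpha>}"

definition transformation_group :: "('a \<Rightarrow> 'a) set \<Rightarrow> ('a \<Rightarrow> 'a) monoid" where
  "transformation_group S = \<lparr>carrier = S, mult = (\<circ>), one = id\<rparr>"


section \<open>Unitary groups, the quotient and the semidirect product\<close>

text \<open>Here the library's complex numbers play the role of \<open>R + R e\<^sub>1\<close>, so \<open>\<i>\<close> is \<open>e\<^sub>1\<close>.\<close>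

definition U1 :: "complex monoid" where
  "U1 = \<lparr>carrier = {a. cnj a * a = 1}, mult = (*), one = 1\<rparr>"

definition adjoint_matrix :: "complex^'n^'n \<Rightarrow> complex^'n^'n" where
  "adjoint_matrix A = map_matrix cnj (transpose A)"

definition SU :: "(complex^'n^'n) monoid" where
  "SU = \<lparr>carrier = {A. adjoint_matrix A ** A = mat 1 \<and> det A = 1}, mult = (**), one = mat 1\<rparr>"

type_synonym u1su4su4 = "complex \<times> (complex^4^4) \<times> (complex^4^4)"

definition U1_SU4_SU4 :: "u1su4su4 monoid" where
  "U1_SU4_SU4 = U1 \<times>\<times> SU \<times>\<times> SU"

definition Z2 :: "u1su4su4 set" where
  "Z2 = {(1, mat 1, mat 1), (1, - mat 1, - mat 1)}"

definition Z4 :: "u1su4su4 set" where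
  "Z4 = {(1, mat 1, mat 1), (- 1, - mat 1, - mat 1),
         (\<i>, - mat \<i>, mat \<i>), (- \<i>, mat \<i>, - mat \<i>)}"

text \<open>The internal direct product of the two subgroups.\<close>

definition Z2_Z4 :: "u1su4su4 set" where
  "Z2_Z4 = Z2 <#>\<^bsub>U1_SU4_SU4\<^esub> Z4"

fun eps :: "u1su4su4 \<Rightarrow> u1su4su4" where
  "eps (a, A, B) = (inverse a, B, A)"

definition semidirect_product ::
  "('a, 'c) monoid_scheme \<Rightarrow> ('b, 'd) monoid_scheme \<Rightarrow> ('b \<Rightarrow> 'a \<Rightarrow> 'a) \<Rightarrow> ('a \<times> 'b) monoid" where
  "semidirect_product N H act =
    \<lparr>carrier = carrier N \<times> carrier H,
     mult = (\<lambda>(n, h) (n', h'). (n \<otimes>\<^bsub>N\<^esub> act h n', h \<otimes>\<^bsub>H\<^esub> h')),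
     one = (\<one>\<^bsub>N\<^esub>, \<one>\<^bsub>H\<^esub>)\<rparr>"

text \<open>The group of order two is \<open>{id, eps}\<close> under composition; an automorphism preserving the
  subgroup acts on a coset, which is a set of group elements, by taking images.\<close>

definition quotient_semidirect :: "(u1su4su4 set \<times> (u1su4su4 \<Rightarrow> u1su4su4)) monoid" where
  "quotient_semidirect =
    semidirect_product (U1_SU4_SU4 Mod Z2_Z4) (transformation_group {id, eps}) (\<lambda>e K. e ` K)"


section \<open>Topologies\<close>

text \<open>The type \<open>freud \<Rightarrow> freud\<close> carries the topology of pointwise convergence, which on linear maps
  of this finite-dimensional space is the usual one.\<close>

definition quotient_topology :: "'a topology \<Rightarrow> ('a \<Rightarrow> 'b) \<Rightarrow> 'b topology" where
  "quotient_topology T q =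
    topology (\<lambda>V. V \<subseteq> q ` topspace T \<and> openin T {x \<in> topspace T. q x \<in> V})"

definition quotient_semidirect_topology :: "(u1su4su4 set \<times> (u1su4su4 \<Rightarrow> u1su4su4)) topology" where
  "quotient_semidirect_topology = prod_topology
    (quotient_topology (top_of_set (carrier U1_SU4_SU4)) (\<lambda>x. Z2_Z4 #>\<^bsub>U1_SU4_SU4\<^esub> x))
    (discrete_topology {id, eps})"


section \<open>Consistency of the encodings\<close>

lemma vector_3_nth [simp]:
  "(vector [a, b, c] :: 'a::zero^3) $ 1 = a"
  "(vector [a, b, c] :: 'a::zero^3) $ 2 = b"
  "(vector [a, b, c] :: 'a::zero^3) $ 3 = c"
  by (rule vector_3)+

lemma cay_cnj_cay_cnj: "cay_cnj (cay_cnj x) = x"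
proof -
  obtain a b c d e f g h where x: "x = ((a, b, c, d), (e, f, g, h))"
    by (metis prod.exhaust)
  show ?thesis
    by (simp add: x)
qed

lemma cay_cnj_scalar: "cay_cnj (cay_scalar r) = cay_scalar r"
  by (simp add: cay_scalar_def)

lemma cay_scalar_re:
  assumes "cay_cnj (x :: complex cayley) = x"
  shows "cay_scalar (cay_re x) = x"
proof -
  obtain a b c d e f g h where x: "x = ((a, b, c, d), (e, f, g, h))"
    by (metis prod.exhaust)
  show ?thesis
    using assms by (simp add: x cay_scalar_def cay_re_def zero_prod_def equation_minus_iff)
qed

lemma cay_cnj_mult: "cay_cnj (cay_mult x y) = cay_mult (cay_cnj y) (cay_cnj x)"
proof -
  obtain a b c d e f g h where x: "x = ((a, b, c, d), (e, f, g, h))"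
    by (metis prod.exhaust)
  obtain a' b' c' d' e' f' g' h' where y: "y = ((a', b', c', d'), (e', f', g', h'))"
    by (metis prod.exhaust)
  show ?thesis
    unfolding x y by (simp add: algebra_simps)
qed

lemma cay_cnj_add: "cay_cnj (x + y) = cay_cnj x + cay_cnj y"
proof -
  obtain a b c d e f g h where x: "x = ((a, b, c, d), (e, f, g, h))"
    by (metis prod.exhaust)
  obtain a' b' c' d' e' f' g' h' where y: "y = ((a', b', c', d'), (e', f', g', h'))"
    by (metis prod.exhaust)
  show ?thesis
    unfolding x y by simp
qed

lemma jcoord_jmat: "jcoord (jmat X) = X"
  by (cases X) (simp add: jcoord_def cay_re_def cay_scalar_def)

lemma mat_star_jmat: "mat_star (jmat X) = jmat X"
proof -
  obtain a b c x y z where X: "X = (a, b, c, x, y, z)"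
    by (metis prod.exhaust)
  show ?thesis
    by (simp add: X mat_star_def vec_eq_iff forall_3 cay_cnj_cay_cnj cay_cnj_scalar)
qed

lemma jmat_jcoord:
  assumes "mat_star M = M"
  shows "jmat (jcoord M) = M"
proof -
  have M: "cay_cnj (M $ j $ i) = M $ i $ j" for i j
  proof -
    have "mat_star M $ i $ j = cay_cnj (M $ j $ i)"
      by (simp add: mat_star_def)
    with assms show ?thesis
      by simp
  qed
  have diag: "cay_scalar (cay_re (M $ i $ i)) = M $ i $ i" for i
    by (rule cay_scalar_re) (rule M)
  have "jmat (jcoord M) =
      vector [vector [M $ 1 $ 1, M $ 1 $ 2, M $ 1 $ 3],
              vector [M $ 2 $ 1, M $ 2 $ 2, M $ 2 $ 3],
              vector [M $ 3 $ 1, M $ 3 $ 2, M $ 3 $ 3]]"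
    by (simp only: jcoord_def jmat.simps diag M)
  also have "\<dots> = M"
    by (simp only: vec_eq_iff forall_3 vector_3)
  finally show ?thesis .
qed

lemma bij_betw_jmat: "bij_betw jmat UNIV {M. mat_star M = M}"
proof (rule bij_betw_byWitness[where f' = jcoord])
  show "jmat ` UNIV \<subseteq> {M. mat_star M = M}"
    by (simp add: image_subset_iff mat_star_jmat del: jmat.simps)
qed (simp_all add: jcoord_jmat jmat_jcoord)

lemma cay_cnj_scaleC: "cay_cnj (r *\<^sub>C x) = r *\<^sub>C cay_cnj (x :: complex cayley)"
proof -
  obtain a b c d e f g h where x: "x = ((a, b, c, d), (e, f, g, h))"
    by (metis prod.exhaust)
  show ?thesis
    by (simp add: x scaleC_prod_def scaleC_complex_def)
qed

lemma jmat_scaleC: "jmat (r *\<^sub>C X) = map_matrix ((*\<^sub>C) r) (jmat X)"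
proof -
  obtain a b c x y z where X: "X = (a, b, c, x, y, z)"
    by (metis prod.exhaust)
  have rX: "r *\<^sub>C X = (r * a, r * b, r * c, r *\<^sub>C x, r *\<^sub>C y, r *\<^sub>C z)"
    by (simp only: X scaleC_prod_def scaleC_complex_def fst_conv snd_conv)
  have scalar: "cay_scalar (r * d) = r *\<^sub>C cay_scalar d" for d
    by (simp add: cay_scalar_def scaleC_prod_def scaleC_complex_def zero_prod_def)
  show ?thesis
    unfolding rX by (simp add: X vec_eq_iff forall_3 cay_cnj_scaleC scalar)
qed

lemma jmat_jtimes:
  "jmat (X \<circ>\<^sub>J Y) =
    map_matrix ((*\<^sub>C) (1/2)) (mat_mult (jmat X) (jmat Y) + mat_mult (jmat Y) (jmat X))"
proof -
  have star_mult: "mat_star (mat_mult M N) = mat_mult (mat_star N) (mat_star M)"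
    for M N :: "complex cayley^3^3"
    by (simp add: mat_star_def mat_mult_def vec_eq_iff sum_3 cay_cnj_add cay_cnj_mult)
  have star_add: "mat_star (M + N) = mat_star M + mat_star N" for M N :: "complex cayley^3^3"
    by (simp add: mat_star_def vec_eq_iff cay_cnj_add)
  show ?thesis
    by (simp add: jtimes_def jmat_scaleC jmat_jcoord star_add star_mult mat_star_jmat add.commute)
qed

lemma openin_quotient_topology:
  "openin (quotient_topology T q) V \<longleftrightarrow>
    V \<subseteq> q ` topspace T \<and> openin T {x \<in> topspace T. q x \<in> V}"
proof -
  have "istopology (\<lambda>V. V \<subseteq> q ` topspace T \<and> openin T {x \<in> topspace T. q x \<in> V})"
    unfolding istopology_def
  proof (intro conjI allI impI)
    fix V W
    assume "V \<subseteq> q ` topspace T \<and> openin T {x \<in> topspace T. q x \<in> V}"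
      and "W \<subseteq> q ` topspace T \<and> openin T {x \<in> topspace T. q x \<in> W}"
    moreover have "{x \<in> topspace T. q x \<in> V \<inter> W} =
        {x \<in> topspace T. q x \<in> V} \<inter> {x \<in> topspace T. q x \<in> W}"
      by auto
    ultimately show "V \<inter> W \<subseteq> q ` topspace T" "openin T {x \<in> topspace T. q x \<in> V \<inter> W}"
      by auto
  next
    fix K
    assume K: "\<forall>V\<in>K. V \<subseteq> q ` topspace T \<and> openin T {x \<in> topspace T. q x \<in> V}"
    have "{x \<in> topspace T. q x \<in> \<Union>K} = (\<Union>V\<in>K. {x \<in> topspace T. q x \<in> V})"
      by auto
    with K show "\<Union>K \<subseteq> q ` topspace T" "openin T {x \<in> topspace T. q x \<in> \<Union>K}"
      by auto
  qed
  then show ?thesis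
    by (simp add: quotient_topology_def topology_inverse')
qed

lemma quotient_map_quotient_topology: "quotient_map T (quotient_topology T q) q"
proof -
  have "openin (quotient_topology T q) (q ` topspace T)"
    by (auto simp: openin_quotient_topology intro: openin_subopen[THEN iffD2])
  then have "topspace (quotient_topology T q) = q ` topspace T"
    by (metis openin_quotient_topology openin_subset openin_topspace subset_antisym)
  then show ?thesis
    by (simp add: quotient_map_def openin_quotient_topology)
qed

lemma group_U1: "group U1"
proof (rule groupI)
  fix x assume "x \<in> carrier U1"
  then show "\<exists>y\<in>carrier U1. y \<otimes>\<^bsub>U1\<^esub> x = \<one>\<^bsub>U1\<^esub>"
    by (intro bexI[of _ "cnj x"]) (auto simp: U1_def mult.commute)
next
  fix x y assume "x \<in> carrier U1" "y \<in> carrier U1"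
  then have "cnj x * x = 1" "cnj y * y = 1"
    by (simp_all add: U1_def)
  moreover have "cnj (x * y) * (x * y) = (cnj x * x) * (cnj y * y)"
    by simp
  ultimately show "x \<otimes>\<^bsub>U1\<^esub> y \<in> carrier U1"
    by (simp add: U1_def)
qed (simp_all add: U1_def mult.assoc)

lemma adjoint_matrix_mult: "adjoint_matrix (A ** B) = adjoint_matrix B ** adjoint_matrix A"
  by (simp add: adjoint_matrix_def matrix_matrix_mult_def transpose_def vec_eq_iff mult.commute)

lemma adjoint_matrix_adjoint_matrix: "adjoint_matrix (adjoint_matrix A) = A"
  by (simp add: adjoint_matrix_def transpose_def vec_eq_iff)

lemma det_adjoint_matrix: "det (adjoint_matrix A) = cnj (det (A :: complex^'n^'n))"
proof -
  have "det (map_matrix cnj B) = cnj (det B)" for B :: "complex^'n^'n"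
    by (simp add: det_def)
  then show ?thesis
    by (simp add: adjoint_matrix_def)
qed

lemma adjoint_matrix_one: "adjoint_matrix (mat 1) = mat 1"
  by (auto simp: adjoint_matrix_def transpose_def mat_def vec_eq_iff)

lemma group_SU: "group (SU :: (complex^'n^'n) monoid)"
proof (rule groupI)
  fix A B :: "complex^'n^'n"
  assume A: "A \<in> carrier SU" and B: "B \<in> carrier SU"
  have "adjoint_matrix B ** adjoint_matrix A ** (A ** B)
      = adjoint_matrix B ** (adjoint_matrix A ** A) ** B"
    by (simp add: matrix_mul_assoc)
  with A B show "A \<otimes>\<^bsub>SU\<^esub> B \<in> carrier SU"
    by (simp add: SU_def adjoint_matrix_mult det_mul)
next
  fix A :: "complex^'n^'n"
  assume "A \<in> carrier SU"
  then show "\<exists>B\<in>carrier SU. B \<otimes>\<^bsub>SU\<^esub> A = \<one>\<^bsub>SU\<^esub>"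
    by (intro bexI[of _ "adjoint_matrix A"])
       (auto simp: SU_def adjoint_matrix_adjoint_matrix det_adjoint_matrix
          matrix_left_right_inverse)
qed (simp_all add: SU_def matrix_mul_assoc adjoint_matrix_one)

lemma group_U1_SU4_SU4: "group U1_SU4_SU4"
  by (simp add: U1_SU4_SU4_def DirProd_group group_U1 group_SU)


lemma mat_mult_nth: "(mat a ** A) $ i $ j = a * (A :: complex^'n^'n) $ i $ j"
proof -
  have "(mat a ** A) $ i $ j = (\<Sum>k\<in>UNIV. if i = k then a * A $ k $ j else 0)"
    unfolding matrix_matrix_mult_def mat_def vec_lambda_beta by (rule sum.cong) auto
  then show ?thesis
    by simp
qed

lemma mult_mat_nth: "(A ** mat a) $ i $ j = (A :: complex^'n^'n) $ i $ j * a"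
proof -
  have "(A ** mat a) $ i $ j = (\<Sum>k\<in>UNIV. if k = j then A $ i $ k * a else 0)"
    unfolding matrix_matrix_mult_def mat_def vec_lambda_beta by (rule sum.cong) auto
  then show ?thesis
    by simp
qed

lemma mat_mult_mat: "mat a ** mat b = (mat (a * b) :: complex^'n^'n)"
  by (simp add: vec_eq_iff mat_mult_nth) (simp add: mat_def)

lemma uminus_mat: "- mat a = (mat (- a) :: complex^'n^'n)"
  by (auto simp: mat_def vec_eq_iff)

lemma mat_commute: "mat a ** A = (A :: complex^'n^'n) ** mat a"
  by (simp add: vec_eq_iff mat_mult_nth mult_mat_nth mult.commute)

lemma mat_in_SU4:
  assumes "a \<in> {1, - 1, \<i>, - \<i>}"
  shows "(mat a :: complex^4^4) \<in> carrier SU"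
proof -
  have "adjoint_matrix (mat a) = (mat (cnj a) :: complex^4^4)"
    by (auto simp: adjoint_matrix_def transpose_def mat_def vec_eq_iff)
  moreover have "det (mat a :: complex^4^4) = (\<Prod>i\<in>(UNIV :: 4 set). (mat a :: complex^4^4) $ i $ i)"
    by (rule det_diagonal) (simp add: mat_def)
  then have "det (mat a :: complex^4^4) = a ^ 4"
    by (simp add: mat_def)
  moreover have "cnj a * a = 1" "a ^ 4 = 1"
    using assms by (auto simp: power4_eq_xxxx)
  ultimately show ?thesis
    by (simp add: SU_def mat_mult_mat)
qed

lemma Z2_Z4_eq:
  "Z2_Z4 = (\<lambda>(a, s). (a, mat (s / a), mat (s * a))) ` ({1, - 1, \<i>, - \<i>} \<times> {1, - 1})"
  unfolding Z2_Z4_def set_mult_def Z2_def Z4_def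
  by (simp add: U1_SU4_SU4_def U1_def SU_def uminus_mat mat_mult_mat)
     (auto simp: insert_commute)

lemma Z2_Z4E:
  assumes "x \<in> Z2_Z4"
  obtains a s where "x = (a, mat (s / a), mat (s * a))" "a \<in> {1, - 1, \<i>, - \<i>}" "s \<in> {1, - 1}"
proof -
  have "\<exists>a\<in>A. \<exists>s\<in>B. x = g a s" if "x \<in> (\<lambda>(a, s). g a s) ` (A \<times> B)"
    for A B :: "complex set" and g
    using that by auto
  from this[OF assms[unfolded Z2_Z4_eq]] that show thesis
    by blast
qed

lemma Z2_Z4I:
  assumes "a \<in> {1, - 1, \<i>, - \<i>}" "s \<in> {1, - 1}" "x = (a, mat (s / a), mat (s * a))"
  shows "x \<in> Z2_Z4"
  unfolding Z2_Z4_eq by (rule image_eqI[of _ _ "(a, s)"], simp add: assms(3), intro SigmaI assms)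

lemma normal_Z2_Z4: "Z2_Z4 \<lhd> U1_SU4_SU4"
proof -
  interpret group U1_SU4_SU4
    by (rule group_U1_SU4_SU4)
  have carrier: "Z2_Z4 \<subseteq> carrier U1_SU4_SU4"
    unfolding Z2_Z4_eq using mat_in_SU4
    by (auto simp: U1_SU4_SU4_def U1_def)
  have "subgroup Z2_Z4 U1_SU4_SU4"
  proof (rule subgroupI)
    show "Z2_Z4 \<noteq> {}"
      by (simp add: Z2_Z4_eq)
    show "inv\<^bsub>U1_SU4_SU4\<^esub> x \<in> Z2_Z4" if x: "x \<in> Z2_Z4" for x
    proof -
      from x obtain a s where
        as: "x = (a, mat (s / a), mat (s * a))" "a \<in> {1, - 1, \<i>, - \<i>}" "s \<in> {1, - 1}"
        by (rule Z2_Z4E)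
      define y :: u1su4su4 where "y = (1 / a, mat (s / (1 / a)), mat (s * (1 / a)))"
      have y: "y \<in> Z2_Z4"
        unfolding y_def using as(2,3) by (intro Z2_Z4I[of "1 / a" s]) auto
      have "a \<noteq> 0" "s * s = 1"
        using as(2,3) by auto
      then have "y \<otimes>\<^bsub>U1_SU4_SU4\<^esub> x = \<one>\<^bsub>U1_SU4_SU4\<^esub>"
        by (simp add: as(1) y_def U1_SU4_SU4_def U1_def SU_def mat_mult_mat)
      with x y carrier have "inv\<^bsub>U1_SU4_SU4\<^esub> x = y"
        by (intro inv_equality) auto
      with y show ?thesis
        by simp
    qed
    show "x \<otimes>\<^bsub>U1_SU4_SU4\<^esub> y \<in> Z2_Z4" if "x \<in> Z2_Z4" "y \<in> Z2_Z4" for x y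
    proof -
      from that(1) obtain a s where
        x: "x = (a, mat (s / a), mat (s * a))" "a \<in> {1, - 1, \<i>, - \<i>}" "s \<in> {1, - 1}"
        by (rule Z2_Z4E)
      from that(2) obtain b t where
        y: "y = (b, mat (t / b), mat (t * b))" "b \<in> {1, - 1, \<i>, - \<i>}" "t \<in> {1, - 1}"
        by (rule Z2_Z4E)
      have "x \<otimes>\<^bsub>U1_SU4_SU4\<^esub> y = (a * b, mat (s * t / (a * b)), mat (s * t * (a * b)))"
        by (simp add: x y U1_SU4_SU4_def U1_def SU_def mat_mult_mat mult_ac)
      moreover have "a * b \<in> {1, - 1, \<i>, - \<i>}" "s * t \<in> {1, - 1}"
        using x(2,3) y(2,3) by auto
      ultimately show ?thesis
        by (intro Z2_Z4I[of "a * b" "s * t"])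
    qed
  qed (rule carrier)
  moreover have "x \<otimes>\<^bsub>U1_SU4_SU4\<^esub> h \<otimes>\<^bsub>U1_SU4_SU4\<^esub> inv\<^bsub>U1_SU4_SU4\<^esub> x \<in> Z2_Z4"
    if "x \<in> carrier U1_SU4_SU4" "h \<in> Z2_Z4" for x h
  proof -
    have "x \<otimes>\<^bsub>U1_SU4_SU4\<^esub> h = h \<otimes>\<^bsub>U1_SU4_SU4\<^esub> x"
    proof -
      from that(2) obtain a s where h: "h = (a, mat (s / a), mat (s * a))"
        by (rule Z2_Z4E)
      obtain b A B where x: "x = (b, A, B)"
        by (metis prod.exhaust)
      show ?thesis
        by (simp add: h x U1_SU4_SU4_def U1_def SU_def mat_commute[of _ A] mat_commute[of _ B]
            mult.commute[of a b])
    qed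
    moreover have "h \<in> carrier U1_SU4_SU4"
      using that(2) carrier by auto
    ultimately show ?thesis
      using that by (simp add: m_assoc)
  qed
  ultimately show ?thesis
    by (simp add: normal_inv_iff)
qed

end

theory Submission
  imports Defs
begin

text \<open>The eigenspaces of \<open>\<lambda>\<gamma>\<close> on the Freudenthal space are identified, through Yokota's embedding of the
  Jordan algebra into the quaternionic Hermitian \<open>4 \<times> 4\<close> matrices, with two copies of the space of
  skew-symmetric complex \<open>8 \<times> 8\<close> matrices. Preserving the product \<open>P \<times> Q\<close> amounts to preserving a
  symplectic form, which pairs the two copies, and a quartic form, which restricts to the Pfaffian on
  each of them. The involution \<open>\<sigma>\<close> splits a skew-symmetric matrix into blocks \<open>(X, M, Y)\<close> by changing
  the sign of the off-diagonal block \<open>M\<close>, on which the Pfaffian is \<open>det M\<close>. So an element of the fixed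
  group induces a unitary map of \<open>M(4, C)\<close> that preserves the determinant, hence matrices of rank one,
  and by the argument of Frobenius and Dieudonne it is \<open>A M B\<^sup>T\<close> or \<open>A M\<^sup>T B\<^sup>T\<close>, the transposition
  being the contribution of \<open>\<epsilon>\<close>. If it acts trivially on \<open>M\<close>, then the part of the Pfaffian that is
  quadratic in \<open>M\<close> shows that it only rescales \<open>X\<close> and \<open>Y\<close> by reciprocal scalars of modulus one, which
  is the action of \<open>U(1)\<close>. The resulting continuous bijection from a compact space onto a Hausdorff
  space is a homeomorphism.\<close>

section \<open>Coordinates of the Jordan algebra\<close>

text \<open>Apart from the exchange of the two halves of C^8, the fixed group is S(U(4) x U(4))
  modulo -1, where (P, Q) acts on skew-symmetric matrices by congruence with diag(P, Q). The triple
  (a, A, B) is sent to (aA, B/a). A fourth root of det P shows that every pair arises; the kernel of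
  this map is the cyclic group of order four, and the group of order two appears because -1 acts
  trivially on skew-symmetric matrices. Only one eigenspace of \<lambda>\<gamma> has to be analysed:
  each of the two is isotropic for the symplectic form, so they are dual to each other and the
  action on one determines the action on the other. That the congruences do lie in E7 follows once
  the quartic form is written in Cartan's way, by two Pfaffians and traces of alternating products.
  This translation from Cayley numbers to complex matrices is the main obstacle. It rests on
  identities for traces of words, on Newton's identities, and on the quadratic equation satisfied by
  a product of two skew-symmetric 4 x 4 matrices.\<close>

fun cay_dot :: "complex cayley \<Rightarrow> complex cayley \<Rightarrow> complex" where
  "cay_dot ((a0, a1, a2, a3), (a4, a5, a6, a7)) ((b0, b1, b2, b3), (b4, b5, b6, b7)) =
    a0 * b0 + a1 * b1 + a2 * b2 + a3 * b3 + a4 * b4 + a5 * b5 + a6 * b6 + a7 * b7"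

lemma cayley_cases:
  obtains a b c d e f g h where "x = ((a, b, c, d), (e, f, g, h))"
  by (metis prod.exhaust)

lemmas scaleC_simps = scaleC_prod_def scaleC_complex_def

lemma cay_dot_commute: "cay_dot x y = cay_dot y x"
  by (cases x rule: cayley_cases, cases y rule: cayley_cases) (simp add: mult.commute)

lemma cay_dot_add: "cay_dot (x + x') y = cay_dot x y + cay_dot x' y"
  by (cases x rule: cayley_cases, cases x' rule: cayley_cases, cases y rule: cayley_cases)
    (simp add: algebra_simps)

lemma cay_dot_scaleC: "cay_dot (c *\<^sub>C x) y = c * cay_dot x y"
  by (cases x rule: cayley_cases, cases y rule: cayley_cases)
    (simp add: algebra_simps scaleC_simps)

lemma cay_dot_add_right: "cay_dot y (x + x') = cay_dot y x + cay_dot y x'"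
  by (metis cay_dot_add cay_dot_commute)

lemma cay_dot_scaleC_right: "cay_dot y (c *\<^sub>C x) = c * cay_dot y x"
  by (metis cay_dot_scaleC cay_dot_commute)

lemma cay_dot_diff: "cay_dot (x - x') y = cay_dot x y - cay_dot x' y"
  by (cases x rule: cayley_cases, cases x' rule: cayley_cases, cases y rule: cayley_cases)
    (simp add: algebra_simps)

lemma cay_dot_diff_right: "cay_dot y (x - x') = cay_dot y x - cay_dot y x'"
  by (metis cay_dot_diff cay_dot_commute)

text \<open>Both sides are the real part of the product of x, y and z, which is invariant under
  cyclic rotation although the Cayley product is not associative.\<close>

lemma cay_dot_cnj_mult:
  "cay_dot (cay_cnj (cay_mult x y)) z = cay_dot (cay_cnj (cay_mult y z)) x"
  by (cases x rule: cayley_cases, cases y rule: cayley_cases, cases z rule: cayley_cases)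
    (simp add: algebra_simps)

lemma jtimes_eq:
  "(a, b, c, x, y, z) \<circ>\<^sub>J (a', b', c', x', y', z') =
    (a * a' + cay_dot y y' + cay_dot z z', b * b' + cay_dot x x' + cay_dot z z',
     c * c' + cay_dot x x' + cay_dot y y',
     (1/2) *\<^sub>C ((b + c) *\<^sub>C x' + (b' + c') *\<^sub>C x + cay_cnj (cay_mult y z' + cay_mult y' z)),
     (1/2) *\<^sub>C ((a + c) *\<^sub>C y' + (a' + c') *\<^sub>C y + cay_cnj (cay_mult z x' + cay_mult z' x)),
     (1/2) *\<^sub>C ((a + b) *\<^sub>C z' + (a' + b') *\<^sub>C z + cay_cnj (cay_mult x y' + cay_mult x' y)))"
  by (cases x rule: cayley_cases, cases y rule: cayley_cases, cases z rule: cayley_cases,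
      cases x' rule: cayley_cases, cases y' rule: cayley_cases, cases z' rule: cayley_cases)
    (simp add: jtimes_def jcoord_def mat_mult_def sum_3 cay_scalar_def cay_re_def scaleC_simps
      zero_prod_def algebra_simps)

lemma jtr_eq: "jtr (a, b, c, x, y, z) = a + b + c"
  by (simp add: jtr_def sum_3 cay_re_def cay_scalar_def)

lemma jform_eq:
  "jform (a, b, c, x, y, z) (a', b', c', x', y', z') =
    a * a' + b * b' + c * c' + 2 * (cay_dot x x' + cay_dot y y' + cay_dot z z')"
  by (simp add: jform_def jtimes_eq jtr_eq)

lemma jcross_eq:
  "(a, b, c, x, y, z) \<times>\<^sub>J (a', b', c', x', y', z') =
    ((1/2) * (b * c' + c * b') - cay_dot x x', (1/2) * (a * c' + c * a') - cay_dot y y',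
     (1/2) * (a * b' + b * a') - cay_dot z z',
     (1/2) *\<^sub>C (cay_cnj (cay_mult y z' + cay_mult y' z) - (a *\<^sub>C x' + a' *\<^sub>C x)),
     (1/2) *\<^sub>C (cay_cnj (cay_mult z x' + cay_mult z' x) - (b *\<^sub>C y' + b' *\<^sub>C y)),
     (1/2) *\<^sub>C (cay_cnj (cay_mult x y' + cay_mult x' y) - (c *\<^sub>C z' + c' *\<^sub>C z)))"
  unfolding jcross_def jtimes_eq jform_eq jtr_eq jone_def
  by (cases x rule: cayley_cases, cases y rule: cayley_cases, cases z rule: cayley_cases,
      cases x' rule: cayley_cases, cases y' rule: cayley_cases, cases z' rule: cayley_cases)
    (simp add: scaleC_simps zero_prod_def field_simps)


section \<open>Symmetry and bilinearity of the trace form and the cross product\<close>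

lemma jordan_cases:
  obtains a b c x y z where "X = ((a, b, c, x, y, z) :: jordan)"
  by (metis prod.exhaust)

lemma scaleC_jordan:
  "r *\<^sub>C ((a, b, c, x, y, z) :: jordan) =
    (r * a, r * b, r * c, r *\<^sub>C x, r *\<^sub>C y, r *\<^sub>C z)"
  by (simp add: scaleC_simps)

lemma jform_commute: "jform X Y = jform Y X"
  by (cases X rule: jordan_cases, cases Y rule: jordan_cases)
    (simp add: jform_eq cay_dot_commute mult.commute)

lemma jform_add: "jform (X + X') Y = jform X Y + jform X' Y"
  by (cases X rule: jordan_cases, cases X' rule: jordan_cases, cases Y rule: jordan_cases)
    (simp add: jform_eq cay_dot_add algebra_simps)

lemma jform_scaleC: "jform (c *\<^sub>C X) Y = c * jform X Y"
  by (cases X rule: jordan_cases, cases Y rule: jordan_cases)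
    (simp add: jform_eq cay_dot_scaleC scaleC_jordan algebra_simps)

lemma jform_add_right: "jform Y (X + X') = jform Y X + jform Y X'"
  by (metis jform_add jform_commute)

lemma jform_scaleC_right: "jform Y (c *\<^sub>C X) = c * jform Y X"
  by (metis jform_scaleC jform_commute)

lemma scaleC_zero: "0 *\<^sub>C (x :: 'a :: complexified) = 0" "c *\<^sub>C (0 :: 'a) = 0"
  using scaleC_add_left[of 0 0 x] scaleC_add_right[of c 0 "0 :: 'a"] by simp_all

lemma uminus_eq_scaleC: "- x = (- 1) *\<^sub>C (x :: 'a :: complexified)"
proof -
  have "x + (- 1) *\<^sub>C x = 0"
    using scaleC_add_left[of 1 "- 1" x] by (simp add: scaleC_one scaleC_zero)
  then show ?thesis
    by (rule minus_unique)
qed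

lemma diff_eq_scaleC: "x - y = x + (- 1) *\<^sub>C (y :: 'a :: complexified)"
  by (simp flip: uminus_eq_scaleC)

lemma jform_minus: "jform (- X) Y = - jform X Y" "jform Y (- X) = - jform Y X"
  by (simp_all add: uminus_eq_scaleC[of X] jform_scaleC jform_scaleC_right)

lemma jform_diff: "jform (X - X') Y = jform X Y - jform X' Y"
    "jform Y (X - X') = jform Y X - jform Y X'"
  by (simp_all add: diff_eq_scaleC jform_add jform_scaleC jform_add_right jform_scaleC_right)

lemma jform_zero: "jform 0 Y = 0" "jform Y 0 = 0"
  using jform_diff(1)[of 0 0 Y] jform_diff(2)[of Y 0 0] by simp_all

lemma jcross_commute: "X \<times>\<^sub>J Y = Y \<times>\<^sub>J X"
  by (cases X rule: jordan_cases, cases Y rule: jordan_cases)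
    (simp add: jcross_eq cay_dot_commute add.commute mult.commute)

text \<open>Up to a factor this is the polarized determinant of the Jordan algebra, a symmetric
  trilinear form. The terms with three Cayley entries match by
  \<open>cay_dot_cnj_mult\<close>.\<close>

lemma jform_jcross_cyclic: "jform (X \<times>\<^sub>J Y) Z = jform (Y \<times>\<^sub>J Z) X"
proof (cases X rule: jordan_cases, cases Y rule: jordan_cases, cases Z rule: jordan_cases)
  fix a b c x y z a' b' c' x' y' z' a'' b'' c'' x'' y'' z''
  assume "X = (a, b, c, x, y, z)" "Y = (a', b', c', x', y', z')" "Z = (a'', b'', c'', x'', y'', z'')"
  then show ?thesis
    \<comment> \<open>The instances of the cyclic and commutative rules carry the entries of X out
      of products and into the first argument of \<open>cay_dot\<close>, which gives a normal
      form.\<close>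
    by (simp add: jcross_eq jform_eq cay_dot_scaleC cay_dot_add cay_dot_diff
        cay_dot_scaleC_right cay_dot_add_right cay_dot_diff_right cay_cnj_add
        cay_dot_cnj_mult[of x] cay_dot_cnj_mult[of _ x] cay_dot_cnj_mult[of y]
        cay_dot_cnj_mult[of _ y] cay_dot_cnj_mult[of z] cay_dot_cnj_mult[of _ z]
        cay_dot_commute[of _ x] cay_dot_commute[of _ y] cay_dot_commute[of _ z]
        cay_dot_commute[of x'' x'] cay_dot_commute[of y'' y'] cay_dot_commute[of z'' z'] field_simps)
qed

lemma jform_nondegenerate:
  assumes "\<And>Y. jform X Y = jform X' Y"
  shows "X = X'"
proof -
  obtain a b c x0 x1 x2 x3 x4 x5 x6 x7 y0 y1 y2 y3 y4 y5 y6 y7 z0 z1 z2 z3 z4 z5 z6 z7 where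
    X: "X - X' = (a, b, c, ((x0, x1, x2, x3), (x4, x5, x6, x7)), ((y0, y1, y2, y3), (y4, y5, y6, y7)),
        ((z0, z1, z2, z3), (z4, z5, z6, z7)))"
    by (metis prod.exhaust)
  have *: "jform (X - X') Y = 0" for Y
    using assms by (simp add: jform_diff)
  have "X - X' = 0"
    using *[of "(1,0,0,0,0,0)"] *[of "(0,1,0,0,0,0)"] *[of "(0,0,1,0,0,0)"]
    *[of "(0,0,0,((1,0,0,0),0),0,0)"] *[of "(0,0,0,((0,1,0,0),0),0,0)"] *[of "(0,0,0,((0,0,1,0),0),0,0)"]
    *[of "(0,0,0,((0,0,0,1),0),0,0)"] *[of "(0,0,0,(0,(1,0,0,0)),0,0)"] *[of "(0,0,0,(0,(0,1,0,0)),0,0)"]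
    *[of "(0,0,0,(0,(0,0,1,0)),0,0)"] *[of "(0,0,0,(0,(0,0,0,1)),0,0)"] *[of "(0,0,0,0,((1,0,0,0),0),0)"]
    *[of "(0,0,0,0,((0,1,0,0),0),0)"] *[of "(0,0,0,0,((0,0,1,0),0),0)"] *[of "(0,0,0,0,((0,0,0,1),0),0)"]
    *[of "(0,0,0,0,(0,(1,0,0,0)),0)"] *[of "(0,0,0,0,(0,(0,1,0,0)),0)"] *[of "(0,0,0,0,(0,(0,0,1,0)),0)"]
    *[of "(0,0,0,0,(0,(0,0,0,1)),0)"] *[of "(0,0,0,0,0,((1,0,0,0),0))"] *[of "(0,0,0,0,0,((0,1,0,0),0))"]
    *[of "(0,0,0,0,0,((0,0,1,0),0))"] *[of "(0,0,0,0,0,((0,0,0,1),0))"] *[of "(0,0,0,0,0,(0,(1,0,0,0)))"]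
    *[of "(0,0,0,0,0,(0,(0,1,0,0)))"] *[of "(0,0,0,0,0,(0,(0,0,1,0)))"] *[of "(0,0,0,0,0,(0,(0,0,0,1)))"]
    by (simp add: X jform_eq zero_prod_def)
  then show ?thesis by simp
qed

text \<open>Cyclicity carries the sum from the cross product into a slot of the trace form, where
  additivity is known; nondegeneracy removes the test vector.\<close>

lemma jcross_add: "(X + X') \<times>\<^sub>J Y = X \<times>\<^sub>J Y + X' \<times>\<^sub>J Y"
proof (rule jform_nondegenerate)
  show "jform ((X + X') \<times>\<^sub>J Y) Z = jform (X \<times>\<^sub>J Y + X' \<times>\<^sub>J Y) Z" for Z
    by (simp add: jform_add jform_add_right jform_jcross_cyclic[of _ Y Z])
qed

lemma jcross_scaleC: "(c *\<^sub>C X) \<times>\<^sub>J Y = c *\<^sub>C (X \<times>\<^sub>J Y)"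
proof (rule jform_nondegenerate)
  show "jform ((c *\<^sub>C X) \<times>\<^sub>J Y) Z = jform (c *\<^sub>C (X \<times>\<^sub>J Y)) Z" for Z
    by (simp add: jform_scaleC jform_scaleC_right jform_jcross_cyclic[of _ Y Z])
qed

lemma jcross_add_right: "Y \<times>\<^sub>J (X + X') = Y \<times>\<^sub>J X + Y \<times>\<^sub>J X'"
  by (metis jcross_add jcross_commute)

lemma jcross_scaleC_right: "Y \<times>\<^sub>J (c *\<^sub>C X) = c *\<^sub>C (Y \<times>\<^sub>J X)"
  by (metis jcross_scaleC jcross_commute)

section \<open>The quartic form of the Freudenthal space\<close>

text \<open>Both cross terms pair to
  \<open>jform (X \<times>\<^sub>J U) (W \<times>\<^sub>J V)\<close>. This is what evaluates the
  description operator in \<open>jtranspose\<close> for the operators that occur in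
  \<open>fcross\<close>.\<close>

lemma jvee_adjoint: "jform (jvee X W U) V = jform U (jvee W X V)"
proof -
  have "jform (W \<times>\<^sub>J (X \<times>\<^sub>J U)) V = jform U (X \<times>\<^sub>J (W \<times>\<^sub>J V))"
    by (metis jform_jcross_cyclic jform_commute jcross_commute)
  then show ?thesis
    by (simp add: jvee_def jform_diff jform_add jform_add_right jform_scaleC jform_scaleC_right
        jform_commute mult.commute)
qed

lemma jtransposeI:
  assumes "\<And>X Y. jform (\<phi> X) Y = jform X (\<psi> Y)"
  shows "jtranspose \<phi> = \<psi>"
  unfolding jtranspose_def
proof (rule the_equality)
  show "\<forall>X Y. jform (\<phi> X) Y = jform X (\<psi> Y)"
    using assms by blast
next
  fix \<theta> assume "\<forall>X Y. jform (\<phi> X) Y = jform X (\<theta> Y)"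
  then have "jform (\<theta> Y) X = jform (\<psi> Y) X" for X Y
    using assms by (metis jform_commute)
  then show "\<theta> = \<psi>"
    by (intro ext jform_nondegenerate)
qed

lemma jtranspose_jvee:
  "jtranspose (\<lambda>U. c *\<^sub>C (jvee X W U + jvee Z Y U)) = (\<lambda>U. c *\<^sub>C (jvee W X U + jvee Y Z U))"
  by (rule jtransposeI)
    (simp add: jform_add jform_add_right jform_scaleC jform_scaleC_right jvee_adjoint)

fun fsymp :: "freud \<Rightarrow> freud \<Rightarrow> complex" where
  "fsymp (X, Y, \<xi>, \<eta>) (Z, W, \<zeta>, \<omega>) = jform X W - jform Z Y + \<xi> * \<omega> - \<zeta> * \<eta>"

lemma freud_cases:
  obtains X Y \<xi> \<eta> where "P = ((X, Y, \<xi>, \<eta>) :: freud)"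
  by (metis prod.exhaust)

lemma scaleC_freud: "r *\<^sub>C ((X, Y, \<xi>, \<eta>) :: freud) = (r *\<^sub>C X, r *\<^sub>C Y, r * \<xi>, r * \<eta>)"
  by (simp add: scaleC_simps)

lemma fsymp_swap: "fsymp P Q = - fsymp Q P"
  by (cases P rule: freud_cases, cases Q rule: freud_cases) (simp add: jform_commute)

lemma fsymp_self: "fsymp P P = 0"
  using fsymp_swap[of P P] by simp

lemma fsymp_add: "fsymp (P + P') Q = fsymp P Q + fsymp P' Q"
  by (cases P rule: freud_cases, cases P' rule: freud_cases, cases Q rule: freud_cases)
    (simp add: jform_add jform_add_right algebra_simps)

lemma fsymp_scaleC: "fsymp (c *\<^sub>C P) Q = c * fsymp P Q"
  by (cases P rule: freud_cases, cases Q rule: freud_cases)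
    (simp add: jform_scaleC jform_scaleC_right scaleC_freud algebra_simps)

lemma fsymp_add_right: "fsymp Q (P + P') = fsymp Q P + fsymp Q P'"
  using fsymp_add[of P P' Q] by (metis fsymp_swap minus_add_distrib)

lemma fsymp_diff: "fsymp (P - P') Q = fsymp P Q - fsymp P' Q"
  using fsymp_add[of "P - P'" P' Q] by simp

lemma fsymp_nondegenerate:
  assumes "\<And>Q. fsymp P Q = fsymp P' Q"
  shows "P = P'"
proof -
  obtain X Y \<xi> \<eta> where P: "P = (X, Y, \<xi>, \<eta>)" by (rule freud_cases)
  obtain X' Y' \<xi>' \<eta>' where P': "P' = (X', Y', \<xi>', \<eta>')" by (rule freud_cases)
  have "X = X'"
    using assms[of "(0, W, 0, 0)" for W] by (intro jform_nondegenerate) (simp add: P P' jform_zero)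
  moreover have "Y = Y'"
    using assms[of "(W, 0, 0, 0)" for W]
    by (intro jform_nondegenerate) (simp add: P P' jform_zero jform_commute)
  moreover have "\<xi> = \<xi>'" "\<eta> = \<eta>'"
    using assms[of "(0, 0, 0, 1)"] assms[of "(0, 0, 1, 0)"] by (simp_all add: P P' jform_zero)
  ultimately show ?thesis
    by (simp add: P P')
qed

text \<open>The names \<open>jtri\<close> and \<open>jquad\<close> hide the inner structure of these
  words, so that their symmetries can serve as ordered rewrite rules.\<close>

definition jtri :: "jordan \<Rightarrow> jordan \<Rightarrow> jordan \<Rightarrow> complex" where
  "jtri X Y Z = jform (X \<times>\<^sub>J Y) Z"

definition jquad :: "jordan \<Rightarrow> jordan \<Rightarrow> jordan \<Rightarrow> jordan \<Rightarrow> complex" where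
  "jquad X Y Z W = jform (X \<times>\<^sub>J Y) (Z \<times>\<^sub>J W)"

lemma jtri_commute: "jtri X Y Z = jtri Y X Z" "jtri X Y Z = jtri X Z Y"
  unfolding jtri_def by (metis jcross_commute) (metis jcross_commute jform_jcross_cyclic)

lemma jquad_commute:
  "jquad X Y Z W = jquad Y X Z W" "jquad X Y Z W = jquad X Y W Z" "jquad X Y Z W = jquad Z W X Y"
  unfolding jquad_def by (metis jcross_commute) (metis jcross_commute, metis jform_commute)

lemma jform_jcross_jcross:
  "jform ((X \<times>\<^sub>J Y) \<times>\<^sub>J Z) W = jquad X Y Z W" "jform (Z \<times>\<^sub>J (X \<times>\<^sub>J Y)) W = jquad X Y Z W"
  "jform W ((X \<times>\<^sub>J Y) \<times>\<^sub>J Z) = jquad X Y Z W" "jform W (Z \<times>\<^sub>J (X \<times>\<^sub>J Y)) = jquad X Y Z W"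
  unfolding jquad_def by (metis jform_jcross_cyclic jform_commute jcross_commute)+

lemma jform_jcross_jtri:
  "jform (X \<times>\<^sub>J Y) (Z \<times>\<^sub>J W) = jquad X Y Z W"
  "jform (X \<times>\<^sub>J Y) Z = jtri X Y Z" "jform Z (X \<times>\<^sub>J Y) = jtri X Y Z"
  by (simp_all add: jtri_def jquad_def jform_commute)

lemma jtri_jcross: "jtri X Y (Z \<times>\<^sub>J W) = jquad X Y Z W"
  by (simp add: jtri_def jquad_def)

lemma jcross_diff: "(X - X') \<times>\<^sub>J Y = X \<times>\<^sub>J Y - X' \<times>\<^sub>J Y"
    "Y \<times>\<^sub>J (X - X') = Y \<times>\<^sub>J X - Y \<times>\<^sub>J X'"
  by (simp_all add: diff_eq_scaleC jcross_add jcross_scaleC jcross_add_right jcross_scaleC_right)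

lemmas jlinear_simps = jform_add jform_add_right jform_scaleC jform_scaleC_right jform_minus
  jform_diff jcross_diff jcross_add jcross_add_right jcross_scaleC jcross_scaleC_right

text \<open>Up to products of the symplectic form, \<open>(P \<times> Q) R\<close> is the polarization of a quartic form; hence
  the maps that preserve the triple product are those that preserve both forms.\<close>

definition fquart :: "freud \<Rightarrow> freud \<Rightarrow> freud \<Rightarrow> freud \<Rightarrow> complex" where
  "fquart P Q R S = fsymp (fcross P Q R) S
    - 1 / 8 * (fsymp P R * fsymp Q S + fsymp Q R * fsymp P S)"

lemmas fquart_simps = fquart_def fcross.simps Phi.simps jtranspose_jvee fsymp.simps

text \<open>The three transpositions generate all permutations. The first and the last hold for the
  triple product and for the correction term separately; the middle one is what fixes the constant
  1/8.\<close>

lemma fquart_commute: "fquart P Q R S = fquart Q P R S" "fquart P Q R S = fquart P R Q S"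
    "fquart P Q R S = fquart P Q S R"
  by (cases P rule: freud_cases; cases Q rule: freud_cases; cases R rule: freud_cases;
      cases S rule: freud_cases; simp only: fquart_simps; simp only: jvee_def jlinear_simps;
      simp only: jform_jcross_jcross; simp only: jform_jcross_jtri;
      simp add: field_simps jtri_jcross jform_commute jtri_commute jquad_commute)+

lemma fquart_add: "fquart P Q R (S + S') = fquart P Q R S + fquart P Q R S'"
  by (simp add: fquart_def fsymp_add_right algebra_simps)

text \<open>Freudenthal's quartic form, in which \<open>jform X (X \<times>\<^sub>J X) / 3\<close>
  is the determinant of X.\<close>

fun fnorm :: "freud \<Rightarrow> complex" where
  "fnorm (X, Y, \<xi>, \<eta>) = jform (X \<times>\<^sub>J X) (Y \<times>\<^sub>J Y) - \<xi> / 3 * jform X (X \<times>\<^sub>J X)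
    - \<eta> / 3 * jform Y (Y \<times>\<^sub>J Y) - 1 / 4 * (jform X Y - \<xi> * \<eta>)\<^sup>2"

lemma fquart_diag: "fquart P P P P = 6 * fnorm P"
  by (cases P rule: freud_cases; simp only: fquart_simps fnorm.simps; simp only: jvee_def jlinear_simps;
      simp only: jform_jcross_jcross; simp only: jform_jcross_jtri;
      simp add: field_simps jtri_jcross jform_commute jtri_commute jquad_commute power2_eq_square)

text \<open>Polarization with additivity alone: the coefficients in the expansion of the fourth
  power of P + Q are separated by replacing Q by -Q and by Q + Q, and symmetry transfers additivity
  from the last argument to all others.\<close>

lemma symmetric_quadrilinear_zero:
  fixes D :: "'a::ab_group_add \<Rightarrow> 'a \<Rightarrow> 'a \<Rightarrow> 'a \<Rightarrow> complex"
  assumes comm: "\<And>P Q R S. D P Q R S = D Q P R S" "\<And>P Q R S. D P Q R S = D P R Q S"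
      "\<And>P Q R S. D P Q R S = D P Q S R"
    and add: "\<And>P Q R S S'. D P Q R (S + S') = D P Q R S + D P Q R S'"
    and diag: "\<And>P. D P P P P = 0"
  shows "D P Q R S = 0"
proof -
  have add3: "D P Q (R + R') S = D P Q R S + D P Q R' S" for P Q R R' S
    using add comm(3) by metis
  have add2: "D P (Q + Q') R S = D P Q R S + D P Q' R S" for P Q Q' R S
    using add3 comm(2) by metis
  have add1: "D (P + P') Q R S = D P Q R S + D P' Q R S" for P P' Q R S
    using add2 comm(1) by metis
  have neg: "D P Q R (- S) = - D P Q R S" for P Q R S
  proof -
    have "D P Q R 0 = 0" using add[of P Q R 0 0] by simp
    then show ?thesis using add[of P Q R S "- S"] by (simp add: eq_neg_iff_add_eq_0 add.commute)
  qed
  have neg3: "D P Q (- R) S = - D P Q R S" for P Q R S using neg comm(3) by metis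
  have neg2: "D P (- Q) R S = - D P Q R S" for P Q R S using neg3 comm(2) by metis
  have neg1: "D (- P) Q R S = - D P Q R S" for P Q R S using neg2 comm(1) by metis
  have c: "D Q P P P = D P P P Q" "D P Q P P = D P P P Q" "D P P Q P = D P P P Q" for P Q
    using comm by metis+
  have d: "D P Q P Q = D P P Q Q" "D P Q Q P = D P P Q Q" "D Q P P Q = D P P Q Q"
     "D Q P Q P = D P P Q Q" "D Q Q P P = D P P Q Q" for P Q
    using comm by metis+
  have expand: "4 * D P P P Q + 6 * D P P Q Q + 4 * D Q Q Q P = 0" for P Q
  proof -
    have "D (P + Q) (P + Q) (P + Q) (P + Q)
        = 4 * D P P P Q + 6 * D P P Q Q + 4 * D Q Q Q P"
      by (simp add: add1 add2 add3 add diag[of P] diag[of Q] c[where P = P and Q = Q]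
          c[where P = Q and Q = P] d[where P = P and Q = Q])
    from trans[OF this[symmetric] diag] show ?thesis .
  qed
  have cube: "D P P P Q = 0" for P Q
  proof -
    have 1: "4 * D P P P Q + 6 * D P P Q Q + 4 * D Q Q Q P = 0"
      by (rule expand)
    have 2: "- 4 * D P P P Q + 6 * D P P Q Q - 4 * D Q Q Q P = 0"
      using expand[of P "- Q"] by (simp add: neg neg1 neg2 neg3)
    have 3: "8 * D P P P Q + 24 * D P P Q Q + 32 * D Q Q Q P = 0"
      using expand[of P "Q + Q"] by (simp add: add1 add2 add3 add)
    \<comment> \<open>Eight times the first relation minus the third eliminates
      \<open>D Q Q Q P\<close>; the sum of the first two is twelve times \<open>D P P Q Q\<close>
      and eliminates that term.\<close>
    have "24 * D P P P Q = 8 * (4 * D P P P Q + 6 * D P P Q Q + 4 * D Q Q Q P)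
        - (8 * D P P P Q + 24 * D P P Q Q + 32 * D Q Q Q P)
        - 2 * ((4 * D P P P Q + 6 * D P P Q Q + 4 * D Q Q Q P)
          + (- 4 * D P P P Q + 6 * D P P Q Q - 4 * D Q Q Q P))"
      by (simp add: algebra_simps)
    then show ?thesis
      unfolding 1 2 3 by simp
  qed
  have e: "D P Q P S = D P P Q S" "D Q P P S = D P P Q S" for P Q S
    using comm by metis+
  have expand3: "D P P Q S + D Q Q P S = 0" for P Q S
  proof -
    have "D (P + Q) (P + Q) (P + Q) S = 3 * (D P P Q S + D Q Q P S)"
      by (simp add: add1 add2 add3 add cube[of P] cube[of Q] e[where P = P and Q = Q] e[where P = Q and Q = P])
    from trans[OF this[symmetric] cube] show ?thesis
      by (metis mult_eq_0_iff zero_neq_numeral)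
  qed
  have square: "D P P Q S = 0" for P Q S
  proof -
    have "D P P Q S - D Q Q P S = 0"
      using expand3[of "- P" Q S] by (simp add: neg neg1 neg2 neg3)
    then show ?thesis
      using expand3[of P Q S] by simp
  qed
  have "D (P + Q) (P + Q) R S = 2 * D P Q R S"
    by (simp add: add1 add2 square[of P] square[of Q] comm(1)[where P = Q and Q = P])
  then show ?thesis
    by (simp add: square)
qed

section \<open>E7 as the common isometry group of a symplectic, a quartic and a Hermitian
  form\<close>

lemma clinear_add: "clinear \<alpha> \<Longrightarrow> \<alpha> (P + Q) = \<alpha> P + \<alpha> Q"
  by (simp add: Vector_Spaces.linear_def module_hom_def module_hom_axioms_def)

lemma clinear_scaleC: "clinear \<alpha> \<Longrightarrow> \<alpha> (c *\<^sub>C P) = c *\<^sub>C \<alpha> P"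
  by (simp add: Vector_Spaces.linear_def module_hom_def module_hom_axioms_def)

lemma clinearI:
  assumes "\<And>P Q. \<alpha> (P + Q) = \<alpha> P + \<alpha> Q" "\<And>c P. \<alpha> (c *\<^sub>C P) = c *\<^sub>C \<alpha> P"
  shows "clinear (\<alpha> :: 'a :: complexified \<Rightarrow> 'b :: complexified)"
  unfolding Vector_Spaces.linear_def module_hom_def module_hom_axioms_def module_iff_vector_space
  by (intro conjI allI vector_space_scaleC assms)

text \<open>Polarizing the quartic form and using the symplectic one, the triple product is
  preserved when tested against vectors \<alpha> S. Since \<alpha> is surjective these are all
  vectors, and nondegeneracy gives the equation itself.\<close>

lemma E7I:
  assumes lin: "clinear \<alpha>" and bij: "bij \<alpha>"
    and symp: "\<And>P Q. fsymp (\<alpha> P) (\<alpha> Q) = fsymp P Q"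
    and norm: "\<And>P. fnorm (\<alpha> P) = fnorm P"
    and herm: "\<And>P Q. fherm (\<alpha> P) (\<alpha> Q) = fherm P Q"
  shows "\<alpha> \<in> E7"
proof -
  have "fquart (\<alpha> P) (\<alpha> Q) (\<alpha> R) (\<alpha> S) - fquart P Q R S = 0" for P Q R S
    by (rule symmetric_quadrilinear_zero[where
          D = "\<lambda>P Q R S. fquart (\<alpha> P) (\<alpha> Q) (\<alpha> R) (\<alpha> S) - fquart P Q R S"])
      (simp_all add: fquart_add clinear_add[OF lin] fquart_diag norm, (metis fquart_commute)+)
  then have "fsymp (fcross (\<alpha> P) (\<alpha> Q) (\<alpha> R)) (\<alpha> S) = fsymp (fcross P Q R) S" for P Q R S
    by (simp add: fquart_def symp)
  then have "fsymp (fcross (\<alpha> P) (\<alpha> Q) (\<alpha> R)) (\<alpha> S) = fsymp (\<alpha> (fcross P Q R)) (\<alpha> S)" for P Q R S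
    by (simp add: symp)
  moreover have surj: "\<alpha> (inv_into UNIV \<alpha> R) = R" for R
    using bij by (simp only: bij_is_surj surj_f_inv_f)
  ultimately have "fsymp (fcross (\<alpha> P) (\<alpha> Q) (\<alpha> R)) S = fsymp (\<alpha> (fcross P Q R)) S" for P Q R S
    by metis
  then have cross: "fcross (\<alpha> P) (\<alpha> Q) (\<alpha> R) = \<alpha> (fcross P Q R)" for P Q R
    by (intro fsymp_nondegenerate)
  have "\<alpha> \<circ> fcross P Q \<circ> inv_into UNIV \<alpha> = fcross (\<alpha> P) (\<alpha> Q)" for P Q
    by (rule ext) (simp only: comp_apply surj flip: cross)
  then show ?thesis
    unfolding E7_def mem_Collect_eq by (intro conjI allI lin bij herm)
qed

text \<open>Because \<open>fquart\<close> is symmetric, only the correction terms survive in the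
  difference. The symplectic form is thereby expressed by the triple product alone.\<close>

lemma fcross_antisymmetrized: "fcross P Q P - fcross P P Q = (- 3 / 8 * fsymp P Q) *\<^sub>C P"
proof (rule fsymp_nondegenerate)
  fix S
  have "fsymp (fcross P Q P) S - fsymp (fcross P P Q) S
      = 1 / 8 * (fsymp Q P * fsymp P S - 2 * (fsymp P Q * fsymp P S))"
    using fquart_commute(2)[of P Q P S] unfolding fquart_def fsymp_self by (simp add: algebra_simps)
  then show "fsymp (fcross P Q P - fcross P P Q) S = fsymp ((- 3 / 8 * fsymp P Q) *\<^sub>C P) S"
    unfolding fsymp_diff fsymp_scaleC fsymp_swap[of Q P] by (simp add: field_simps)
qed

lemma E7D:
  assumes "\<alpha> \<in> E7"
  shows E7_clinear: "clinear \<alpha>" and E7_bij: "bij \<alpha>"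
    and E7_fherm: "fherm (\<alpha> P) (\<alpha> Q) = fherm P Q"
    and E7_fsymp: "fsymp (\<alpha> P) (\<alpha> Q) = fsymp P Q"
    and E7_fnorm: "fnorm (\<alpha> P) = fnorm P"
proof -
  show lin: "clinear \<alpha>" and bij: "bij \<alpha>" and "fherm (\<alpha> P) (\<alpha> Q) = fherm P Q"
    using assms unfolding E7_def by blast+
  have cross: "fcross (\<alpha> P) (\<alpha> Q) (\<alpha> R) = \<alpha> (fcross P Q R)" for P Q R
  proof -
    have "\<alpha> \<circ> fcross P Q \<circ> inv_into UNIV \<alpha> = fcross (\<alpha> P) (\<alpha> Q)"
      using assms unfolding E7_def by blast
    then have "(\<alpha> \<circ> fcross P Q \<circ> inv_into UNIV \<alpha>) (\<alpha> R) = fcross (\<alpha> P) (\<alpha> Q) (\<alpha> R)"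
      by (rule fun_cong)
    then show ?thesis
      by (simp only: comp_apply inv_f_f[OF bij_is_inj[OF bij]])
  qed
  have zero: "\<alpha> 0 = 0"
    using clinear_add[OF lin, of 0 0] by simp
  have symp: "fsymp (\<alpha> P) (\<alpha> Q) = fsymp P Q" for P Q
  proof (cases "P = 0")
    case True
    then show ?thesis
      using fsymp_scaleC[of 0 0 Q] fsymp_scaleC[of 0 0 "\<alpha> Q"] by (simp add: zero scaleC_zero)
  next
    case False
    then have nz: "\<alpha> P \<noteq> 0"
      using zero injD[OF bij_is_inj[OF bij], of P 0] by auto
    have "\<alpha> (fcross P Q P - fcross P P Q) = \<alpha> (fcross P Q P) - \<alpha> (fcross P P Q)"
      using clinear_add[OF lin, of "fcross P Q P - fcross P P Q" "fcross P P Q"] by simp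
    \<comment> \<open>Both sides are multiples of the nonzero vector \<alpha> P, so the two values
      of the symplectic form can be compared as coefficients.\<close>
    then have "(- 3 / 8 * fsymp P Q) *\<^sub>C \<alpha> P = (- 3 / 8 * fsymp (\<alpha> P) (\<alpha> Q)) *\<^sub>C \<alpha> P"
      by (simp add: fcross_antisymmetrized clinear_scaleC[OF lin] flip: cross)
    then have "(- 3 / 8 * fsymp P Q) = (- 3 / 8 * fsymp (\<alpha> P) (\<alpha> Q))"
      using nz vector_space.scale_right_imp_eq[OF vector_space_scaleC] by blast
    then show ?thesis by simp
  qed
  then show "fsymp (\<alpha> P) (\<alpha> Q) = fsymp P Q" .
  have "fquart (\<alpha> P) (\<alpha> P) (\<alpha> P) (\<alpha> P) = fquart P P P P"
    by (simp add: fquart_def cross symp)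
  then show "fnorm (\<alpha> P) = fnorm P"
    by (simp add: fquart_diag)
qed

section \<open>Traces of products of complex matrices\<close>

definition mscale :: "complex \<Rightarrow> complex^'n^'m \<Rightarrow> complex^'n^'m" where
  "mscale c A = (\<chi> i j. c * A $ i $ j)"

lemma mscale_nth [simp]: "mscale c A $ i $ j = c * A $ i $ j"
  by (simp add: mscale_def)

lemma mscale_mult: "mscale c A ** B = mscale c (A ** B)" "A ** mscale c B = mscale c (A ** B)"
  by (simp_all add: vec_eq_iff matrix_matrix_mult_def sum_distrib_left algebra_simps)

lemma mscale_mscale: "mscale c (mscale d A) = mscale (c * d) A"
  by (simp add: vec_eq_iff)

lemma mscale_one [simp]: "mscale 1 A = A"
  by (simp add: vec_eq_iff)

lemma mscale_zero [simp]: "mscale c 0 = 0"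
  by (simp add: vec_eq_iff)

lemma mscale_add: "mscale c (A + B) = mscale c A + mscale c B"
  by (simp add: vec_eq_iff algebra_simps)

lemma uminus_eq_mscale: "- A = mscale (- 1) A"
  by (simp add: vec_eq_iff)

lemma trace_mscale: "trace (mscale c A) = c * trace A"
  by (simp add: trace_def sum_distrib_left)

lemma transpose_mscale: "transpose (mscale c A) = mscale c (transpose A)"
  by (simp add: vec_eq_iff transpose_def)

lemma transpose_add: "transpose (A + B) = transpose A + transpose B"
  by (simp add: vec_eq_iff transpose_def)

lemma transpose_minus: "transpose (- A) = - transpose A"
  by (simp add: vec_eq_iff transpose_def)

lemma matrix_minus_mult: "(- A) ** B = - (A ** B)" "A ** (- B) = - (A ** B)"
  for A B :: "complex^'n^'n"
  by (simp_all add: vec_eq_iff matrix_matrix_mult_def sum_negf)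

lemma matrix_add_rdistrib: "(A + B) ** C = A ** C + B ** C" for A B C :: "complex^'n^'n"
  by (simp add: vec_eq_iff matrix_matrix_mult_def sum.distrib algebra_simps)

abbreviation w2 :: "complex^'n^'n \<Rightarrow> complex^'n^'n \<Rightarrow> complex" where
  "w2 A B \<equiv> trace (A ** B)"

definition w3 :: "complex^'n^'n \<Rightarrow> complex^'n^'n \<Rightarrow> complex^'n^'n \<Rightarrow> complex" where
  "w3 A B C = trace (A ** B ** C)"

definition w4 :: "complex^'n^'n \<Rightarrow> complex^'n^'n \<Rightarrow> complex^'n^'n \<Rightarrow> complex^'n^'n \<Rightarrow> complex" where
  "w4 A B C D = trace (A ** B ** C ** D)"

lemma w2_simps:
  "w2 (A + A') B = w2 A B + w2 A' B" "w2 A (B + B') = w2 A B + w2 A B'"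
  "w2 (mscale c A) B = c * w2 A B" "w2 A (mscale c B) = c * w2 A B"
  "w2 (mat 1) B = trace B" "w2 A (mat 1) = trace A"
  by (simp_all add: matrix_add_ldistrib matrix_add_rdistrib mscale_mult trace_mscale trace_add)

lemma w3_simps:
  "w3 (A + A') B C = w3 A B C + w3 A' B C" "w3 A (B + B') C = w3 A B C + w3 A B' C"
  "w3 A B (C + C') = w3 A B C + w3 A B C'"
  "w3 (mscale c A) B C = c * w3 A B C" "w3 A (mscale c B) C = c * w3 A B C"
  "w3 A B (mscale c C) = c * w3 A B C"
  "w3 (mat 1) B C = w2 B C" "w3 A (mat 1) C = w2 A C" "w3 A B (mat 1) = w2 A B"
  by (simp_all add: w3_def matrix_add_ldistrib matrix_add_rdistrib mscale_mult trace_mscale trace_add)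

lemma w4_simps:
  "w4 (A + A') B C D = w4 A B C D + w4 A' B C D" "w4 A (B + B') C D = w4 A B C D + w4 A B' C D"
  "w4 A B (C + C') D = w4 A B C D + w4 A B C' D" "w4 A B C (D + D') = w4 A B C D + w4 A B C D'"
  "w4 (mscale c A) B C D = c * w4 A B C D" "w4 A (mscale c B) C D = c * w4 A B C D"
  "w4 A B (mscale c C) D = c * w4 A B C D" "w4 A B C (mscale c D) = c * w4 A B C D"
  "w4 (mat 1) B C D = w3 B C D" "w4 A (mat 1) C D = w3 A C D"
  "w4 A B (mat 1) D = w3 A B D" "w4 A B C (mat 1) = w3 A B C"
  by (simp_all add: w3_def w4_def matrix_add_ldistrib matrix_add_rdistrib mscale_mult trace_mscale
      trace_add)

lemma w_cyclic: "w2 A B = w2 B A" "w3 A B C = w3 B C A" "w4 A B C D = w4 B C D A"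
  unfolding w3_def w4_def by (simp_all only: trace_mul_sym[of A] flip: matrix_mul_assoc)

text \<open>For the matrix of a quaternionic Hermitian operator, every eigenvalue is doubled; this is the
  fourth elementary symmetric function of half of the spectrum, by Newton's identities.\<close>

definition newton4 :: "complex^'n^'n \<Rightarrow> complex" where
  "newton4 A = (let p1 = trace A / 2; p2 = w2 A A / 2; p3 = w3 A A A / 2; p4 = w4 A A A A / 2
    in (p1 ^ 4 - 6 * p1\<^sup>2 * p2 + 3 * p2\<^sup>2 + 8 * p1 * p3 - 6 * p4) / 24)"

text \<open>The right side becomes 8 times \<open>fnorm\<close> once the traces are evaluated on the
  Jordan algebra. Among the words of length four, those with an odd number of K cancel between x and
  y, while GGGG, GKGK and KKKK cancel between the alternating word and the power sums; only GGKK
  remains.\<close>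

lemma newton4_identity:
  fixes G K :: "complex^'n^'n" and \<xi> \<eta> :: complex
  assumes G: "trace G = 0" and K: "trace K = 0" and n: "trace (mat 1 :: complex^'n^'n) = 8"
  defines "x \<equiv> G + mscale \<i> K + mscale ((\<xi> + \<i> * \<eta>) / 2) (mat 1)"
    and "y \<equiv> G + mscale (- \<i>) K + mscale ((\<xi> - \<i> * \<eta>) / 2) (mat 1)"
  shows "w4 x y x y / 2 - (w2 x y / 2)\<^sup>2 / 2 + 2 * newton4 x + 2 * newton4 y =
    8 * (w4 G G K K / 2 - w2 G G * w2 K K / 16 + \<xi> * w3 G G G / 6 + \<eta> * w3 K K K / 6
      - 1 / 4 * (w2 G K / 2 - \<xi> * \<eta>)\<^sup>2)"
proof -
  \<comment> \<open>One representative of each cyclic class of words, as a normal form.\<close>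
  have cyc: "w2 K G = w2 G K" "w3 K G G = w3 G G K" "w3 G K G = w3 G G K"
    "w3 K G K = w3 G K K" "w3 K K G = w3 G K K"
    "w4 K G G G = w4 G G G K" "w4 G K G G = w4 G G G K" "w4 G G K G = w4 G G G K"
    "w4 G K K G = w4 G G K K" "w4 K K G G = w4 G G K K" "w4 K G G K = w4 G G K K"
    "w4 K G K G = w4 G K G K"
    "w4 K G K K = w4 G K K K" "w4 K K G K = w4 G K K K" "w4 K K K G = w4 G K K K"
    by (metis w_cyclic)+
  have ii: "\<i> ^ 3 = - \<i>" "\<i> ^ 4 = 1" "\<i> * (\<i> * u) = - u" for u
    by (simp_all add: power3_eq_cube power4_eq_xxxx)
  define t2gg t2gk t2kk t3ggg t3ggk t3gkk t3kkk
    where "t2gg = w2 G G" and "t2gk = w2 G K" and "t2kk = w2 K K" and "t3ggg = w3 G G G"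
     and "t3ggk = w3 G G K" and "t3gkk = w3 G K K" and "t3kkk = w3 K K K"
  \<comment> \<open>With these variables the scalar parts of x and y are z and w, and their traces
    are 8 z and 8 w; the claim becomes a polynomial identity in z, w and the words.\<close>
  define z w where "z = (\<xi> + \<i> * \<eta>) / 2" and "w = (\<xi> - \<i> * \<eta>) / 2"
  have xe: "\<xi> = z + w" and et: "\<eta> = - \<i> * (z - w)"
    by (simp_all add: z_def w_def field_simps)
  have p: "trace x = 8 * z" "trace y = 8 * w"
    unfolding x_def y_def trace_add trace_mscale G K n z_def w_def by simp_all
  note expand = w2_simps w3_simps w4_simps cyc trace_add trace_mscale G K n algebra_simps ii
    power2_eq_square power3_eq_cube power4_eq_xxxx
  note words = t2gg_def t2gk_def t2kk_def t3ggg_def t3ggk_def t3gkk_def t3kkk_def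
  have x2: "w2 x x = t2gg - t2kk + 2 * \<i> * t2gk + 8 * z\<^sup>2"
    unfolding x_def z_def[symmetric]
    by (simp add: expand flip: words)
  have y2: "w2 y y = t2gg - t2kk - 2 * \<i> * t2gk + 8 * w\<^sup>2"
    unfolding y_def w_def[symmetric]
    by (simp add: expand flip: words)
  have xy2: "w2 x y = t2gg + t2kk + 8 * z * w"
    unfolding x_def y_def w_def[symmetric] z_def[symmetric]
    by (simp add: expand flip: words)
  have x3: "w3 x x x = t3ggg + 3 * \<i> * t3ggk - 3 * t3gkk - \<i> * t3kkk
      + 3 * z * (t2gg - t2kk + 2 * \<i> * t2gk) + 8 * z ^ 3"
    unfolding x_def z_def[symmetric]
    by (simp add: expand flip: words)
  have y3: "w3 y y y = t3ggg - 3 * \<i> * t3ggk - 3 * t3gkk + \<i> * t3kkk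
      + 3 * w * (t2gg - t2kk - 2 * \<i> * t2gk) + 8 * w ^ 3"
    unfolding y_def w_def[symmetric]
    by (simp add: expand flip: words)
  have x4: "w4 x x x x = w4 G G G G + 4 * \<i> * w4 G G G K - 4 * w4 G G K K - 2 * w4 G K G K
      - 4 * \<i> * w4 G K K K + w4 K K K K
      + 4 * z * (t3ggg + 3 * \<i> * t3ggk - 3 * t3gkk - \<i> * t3kkk)
      + 6 * z\<^sup>2 * (t2gg - t2kk + 2 * \<i> * t2gk) + 8 * z ^ 4"
    unfolding x_def z_def[symmetric]
    by (simp add: expand flip: words)
  have y4: "w4 y y y y = w4 G G G G - 4 * \<i> * w4 G G G K - 4 * w4 G G K K - 2 * w4 G K G K
      + 4 * \<i> * w4 G K K K + w4 K K K K
      + 4 * w * (t3ggg - 3 * \<i> * t3ggk - 3 * t3gkk + \<i> * t3kkk)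
      + 6 * w\<^sup>2 * (t2gg - t2kk - 2 * \<i> * t2gk) + 8 * w ^ 4"
    unfolding y_def w_def[symmetric]
    by (simp add: expand flip: words)
  have xy4: "w4 x y x y = w4 G G G G + 4 * w4 G G K K - 2 * w4 G K G K + w4 K K K K
      + 2 * w * (t3ggg + \<i> * t3ggk + t3gkk + \<i> * t3kkk)
      + 2 * z * (t3ggg - \<i> * t3ggk + t3gkk - \<i> * t3kkk)
      + 4 * z * w * (t2gg + t2kk) + w\<^sup>2 * (t2gg - t2kk + 2 * \<i> * t2gk)
      + z\<^sup>2 * (t2gg - t2kk - 2 * \<i> * t2gk) + 8 * (z * w)\<^sup>2"
    unfolding x_def y_def w_def[symmetric] z_def[symmetric]
    by (simp add: expand flip: words)
  show ?thesis
    unfolding newton4_def Let_def p x2 y2 xy2 x3 y3 x4 y4 xy4 xe et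
      t2gg_def[symmetric] t2gk_def[symmetric] t2kk_def[symmetric] t3ggg_def[symmetric] t3kkk_def[symmetric]
    by (simp add: field_simps ii power2_eq_square power3_eq_cube power4_eq_xxxx)
qed

section \<open>Skew-symmetric matrices and Pfaffians\<close>

lemma vector_4_nth [simp]:
  "(vector [a, b, c, d] :: 'a::zero^4) $ 1 = a" "(vector [a, b, c, d] :: 'a::zero^4) $ 2 = b"
  "(vector [a, b, c, d] :: 'a::zero^4) $ 3 = c" "(vector [a, b, c, d] :: 'a::zero^4) $ 4 = d"
  unfolding vector_def by simp_all

lemma mat_eq_iff4: "A = B \<longleftrightarrow> (\<forall>i j. (A :: 'a^4^4) $ i $ j = B $ i $ j)"
  by (simp add: vec_eq_iff)

lemma det_4:
  "det (A :: 'a::comm_ring_1^4^4) =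
    A$1$1 * (A$2$2 * (A$3$3 * A$4$4 - A$3$4 * A$4$3) - A$2$3 * (A$3$2 * A$4$4 - A$3$4 * A$4$2)
      + A$2$4 * (A$3$2 * A$4$3 - A$3$3 * A$4$2))
    - A$1$2 * (A$2$1 * (A$3$3 * A$4$4 - A$3$4 * A$4$3) - A$2$3 * (A$3$1 * A$4$4 - A$3$4 * A$4$1)
      + A$2$4 * (A$3$1 * A$4$3 - A$3$3 * A$4$1))
    + A$1$3 * (A$2$1 * (A$3$2 * A$4$4 - A$3$4 * A$4$2) - A$2$2 * (A$3$1 * A$4$4 - A$3$4 * A$4$1)
      + A$2$4 * (A$3$1 * A$4$2 - A$3$2 * A$4$1))
    - A$1$4 * (A$2$1 * (A$3$2 * A$4$3 - A$3$3 * A$4$2) - A$2$2 * (A$3$1 * A$4$3 - A$3$3 * A$4$1)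
      + A$2$3 * (A$3$1 * A$4$2 - A$3$2 * A$4$1))"
proof -
  have f1234: "finite {2::4, 3, 4}" "1 \<notin> {2::4, 3, 4}" by auto
  have f234: "finite {3::4, 4}" "2 \<notin> {3::4, 4}" by auto
  have f34: "finite {4::4}" "3 \<notin> {4::4}" by auto
  show ?thesis
    unfolding det_def UNIV_4
    unfolding sum_over_permutations_insert[OF f1234]
    unfolding sum_over_permutations_insert[OF f234]
    unfolding sum_over_permutations_insert[OF f34]
    unfolding permutes_sing
    by (simp add: sign_swap_id permutation_swap_id permutation_compose sign_compose sign_id swap_id_eq algebra_simps)
qed

definition skew4 :: "complex \<Rightarrow> complex \<Rightarrow> complex \<Rightarrow> complex \<Rightarrow> complex \<Rightarrow> complex \<Rightarrow> complex^4^4" where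
  "skew4 a b c d e f = vector [vector [0, a, b, c], vector [- a, 0, d, e],
    vector [- b, - d, 0, f], vector [- c, - e, - f, 0]]"

definition pf4 :: "complex^4^4 \<Rightarrow> complex" where
  "pf4 X = X$1$2 * X$3$4 - X$1$3 * X$2$4 + X$1$4 * X$2$3"

text \<open>The Hodge dual of a two-form on C^4, which is also the Pfaffian adjugate: its product
  with X is a scalar matrix.\<close>

definition star4 :: "complex^4^4 \<Rightarrow> complex^4^4" where
  "star4 X = skew4 (X$3$4) (- X$2$4) (X$2$3) (X$1$4) (- X$1$3) (X$1$2)"

definition J4 :: "complex^4^4" where
  "J4 = skew4 1 0 0 0 0 1"

abbreviation skew :: "complex^'n^'n \<Rightarrow> bool" where
  "skew X \<equiv> transpose X = - X"

lemma skew_cases: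
  assumes "skew (X :: complex^4^4)"
  obtains a b c d e f where "X = skew4 a b c d e f"
proof -
  have *: "X $ j $ i = - X $ i $ j" for i j
    using arg_cong[OF assms, of "\<lambda>Y. Y $ i $ j"] by (simp add: transpose_def)
  have "X $ i $ i = 0" for i
    using *[of i i] by simp
  then have "X = skew4 (X$1$2) (X$1$3) (X$1$4) (X$2$3) (X$2$4) (X$3$4)"
    using *[of 1 2] *[of 1 3] *[of 1 4] *[of 2 3] *[of 2 4] *[of 3 4]
    by (simp add: skew4_def mat_eq_iff4 forall_4)
  then show thesis by (rule that)
qed

lemma skew_skew4: "skew (skew4 a b c d e f)"
  by (simp add: skew4_def mat_eq_iff4 forall_4 transpose_def)

lemmas mat4_simps = mat_eq_iff4 forall_4 matrix_matrix_mult_def sum_4 transpose_def trace_def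
  skew4_def mat_def

lemma star4_mult: "skew X \<Longrightarrow> X ** star4 X = mat (- pf4 X)"
  by (erule skew_cases) (simp add: mat4_simps star4_def pf4_def algebra_simps)

lemma skew_J4: "skew J4"
  by (simp add: J4_def skew_skew4)

lemma J4_J4: "J4 ** J4 = - mat 1"
  by (simp add: J4_def mat4_simps)

lemma det_J4: "det J4 = 1"
  by (simp add: J4_def skew4_def det_4)

lemma J4_star4: "skew X \<Longrightarrow> J4 ** star4 X = mat (trace (X ** J4) / 2) + mscale (- 1) (X ** J4)"
  by (erule skew_cases) (simp add: mat4_simps star4_def J4_def field_simps)

text \<open>A product of two skew-symmetric 4 x 4 matrices has doubled eigenvalues, so it satisfies
  a quadratic equation. Its constant term is the product of the two Pfaffians, and \<open>J4\<close>
  has Pfaffian one.\<close>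

lemma skew_J4_square:
  "skew X \<Longrightarrow> (X ** J4) ** (X ** J4) =
    mscale (trace (X ** J4) / 2) (X ** J4) + mscale (- pf4 X) (mat 1)"
  by (erule skew_cases) (simp add: mat4_simps pf4_def J4_def field_simps)

lemma pf4_congruence_J4: "pf4 (M ** J4 ** transpose M) = det M"
  by (simp add: mat4_simps pf4_def J4_def det_4 algebra_simps)

text \<open>The Hodge dual turns a congruence into the contragredient one, up to the determinant.
  Stated without an inverse, this is a polynomial identity in the entries of P.\<close>

lemma star4_congruence:
  assumes "skew X"
  shows "transpose P ** star4 (P ** X ** transpose P) ** P = mscale (det P) (star4 X)"
  using assms
  by (rule skew_cases)
    (simp add: mat4_simps star4_def J4_def algebra_simps, simp add: det_4 algebra_simps)

section \<open>Matrices of size eight in blocks of size four\<close>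

definition blk :: "complex^'n^'n \<Rightarrow> complex^'n^'n \<Rightarrow> complex^'n^'n \<Rightarrow> complex^'n^'n \<Rightarrow>
    complex^('n + 'n)^('n + 'n)" where
  "blk A B C D = (\<chi> i j. case i of
     Inl i' \<Rightarrow> (case j of Inl j' \<Rightarrow> A $ i' $ j' | Inr j' \<Rightarrow> B $ i' $ j')
   | Inr i' \<Rightarrow> (case j of Inl j' \<Rightarrow> C $ i' $ j' | Inr j' \<Rightarrow> D $ i' $ j'))"

lemma sum_UNIV_Plus: "(\<Sum>k\<in>(UNIV :: ('n::finite + 'n) set). f k) = (\<Sum>k\<in>UNIV. f (Inl k)) + (\<Sum>k\<in>UNIV. f (Inr k))"
  by (simp add: UNIV_Plus_UNIV[symmetric] sum.Plus del: UNIV_Plus_UNIV)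

lemma blk_cong: "A = A' \<Longrightarrow> B = B' \<Longrightarrow> C = C' \<Longrightarrow> D = D' \<Longrightarrow> blk A B C D = blk A' B' C' D'"
  by simp

lemma blk_mult: "blk A B C D ** blk A' B' C' D' =
    blk (A ** A' + B ** C') (A ** B' + B ** D') (C ** A' + D ** C') (C ** B' + D ** D')"
  by (simp add: vec_eq_iff blk_def matrix_matrix_mult_def sum_UNIV_Plus split: sum.splits)

lemma blk_add: "blk A B C D + blk A' B' C' D' = blk (A + A') (B + B') (C + C') (D + D')"
  by (simp add: vec_eq_iff blk_def split: sum.splits)

lemma mscale_blk: "mscale c (blk A B C D) = blk (mscale c A) (mscale c B) (mscale c C) (mscale c D)"
  by (simp add: vec_eq_iff blk_def split: sum.splits)

lemma mat_blk: "mat c = blk (mat c) 0 0 (mat c)"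
  by (simp add: vec_eq_iff blk_def mat_def split: sum.splits)

lemma trace_blk: "trace (blk A B C D) = trace A + trace D"
  by (simp add: trace_def blk_def sum_UNIV_Plus)

lemma trace_mat: "trace (mat c :: complex^'n^'n) = of_nat CARD('n) * c"
  by (simp add: trace_def mat_def)

text \<open>The determinant of a skew-symmetric matrix times \<open>blk J4 0 0 J4\<close> is the
  square of a Pfaffian, so half of the spectrum multiplies to the Pfaffian. The proof stays with
  traces: the quadratic equations of \<alpha>, \<delta> and \<kappa> reduce all words to u, v, b,
  c1, c2, c4, the Pfaffians of X and Y, and \<open>det M\<close>.\<close>

lemma newton4_blk:
  assumes X: "skew X" and Y: "skew Y"
  shows "newton4 (blk X M (- transpose M) Y ** blk J4 0 0 J4) =
    pf4 X * pf4 Y + trace (star4 X ** M ** star4 Y ** transpose M) / 2 + det M"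
proof -
  define \<alpha> \<beta> \<gamma> \<delta> where "\<alpha> = X ** J4" and "\<beta> = M ** J4" and "\<gamma> = - transpose M ** J4" and "\<delta> = Y ** J4"
  define u v where "u = trace \<alpha> / 2" and "v = trace \<delta> / 2"
  have A: "blk X M (- transpose M) Y ** blk J4 0 0 J4 = blk \<alpha> \<beta> \<gamma> \<delta>"
    by (simp add: blk_mult \<alpha>_def \<beta>_def \<gamma>_def \<delta>_def)
  have AA: "\<alpha> ** \<alpha> = mscale u \<alpha> + mscale (- pf4 X) (mat 1)"
      "\<delta> ** \<delta> = mscale v \<delta> + mscale (- pf4 Y) (mat 1)"
    using skew_J4_square[OF X] skew_J4_square[OF Y] by (simp_all add: \<alpha>_def \<delta>_def u_def v_def)
  define \<kappa> where "\<kappa> = \<beta> ** \<gamma>"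
  define b where "b = trace \<kappa>"
  \<comment> \<open>Again \<kappa> is a skew-symmetric matrix times \<open>J4\<close>, and the
    Pfaffian of that matrix is \<open>det M\<close>; this is how the determinant enters.\<close>
  have KK: "\<kappa> ** \<kappa> = mscale (b / 2) \<kappa> + mscale (- det M) (mat 1)"
  proof -
    define Z where "Z = - (M ** J4 ** transpose M)"
    have \<kappa>: "\<kappa> = Z ** J4"
      by (simp add: \<kappa>_def \<beta>_def \<gamma>_def Z_def matrix_mul_assoc matrix_minus_mult)
    have "skew Z"
      by (simp add: Z_def matrix_transpose_mul transpose_minus skew_J4 matrix_mul_assoc matrix_minus_mult)
    moreover have "pf4 Z = det M"
      using pf4_congruence_J4[of M] by (simp add: Z_def pf4_def)
    ultimately show ?thesis
      using skew_J4_square[of Z] by (simp add: \<kappa> b_def)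
  qed
  have n: "trace (mat 1 :: complex^4^4) = 4"
    by (simp add: trace_mat)
  define c1 c2 c4 where "c1 = w3 \<alpha> \<beta> \<gamma>" and "c2 = w3 \<delta> \<gamma> \<beta>" and "c4 = w4 \<alpha> \<beta> \<delta> \<gamma>"
  have bb: "w2 \<beta> \<gamma> = b" "w2 \<gamma> \<beta> = b"
    unfolding b_def \<kappa>_def by (rule refl, rule trace_mul_sym)
  have p1: "trace \<alpha> = 2 * u" "trace \<delta> = 2 * v"
    by (simp_all add: u_def v_def)
  have p2: "w2 \<alpha> \<alpha> = 2 * u\<^sup>2 - 4 * pf4 X" "w2 \<delta> \<delta> = 2 * v\<^sup>2 - 4 * pf4 Y"
    by (simp_all add: AA trace_add trace_mscale n p1 power2_eq_square)
  have p3: "w3 \<alpha> \<alpha> \<alpha> = u * w2 \<alpha> \<alpha> - pf4 X * (2 * u)" "w3 \<delta> \<delta> \<delta> = v * w2 \<delta> \<delta> - pf4 Y * (2 * v)"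
    unfolding w3_def AA by (simp_all add: w2_simps p1 AA trace_add trace_mscale n)
  have p4: "w4 \<alpha> \<alpha> \<alpha> \<alpha> = u * w3 \<alpha> \<alpha> \<alpha> - pf4 X * w2 \<alpha> \<alpha>"
      "w4 \<delta> \<delta> \<delta> \<delta> = v * w3 \<delta> \<delta> \<delta> - pf4 Y * w2 \<delta> \<delta>"
      "w4 \<alpha> \<alpha> \<beta> \<gamma> = u * c1 - pf4 X * b" "w4 \<delta> \<delta> \<gamma> \<beta> = v * c2 - pf4 Y * b"
    unfolding w4_def w3_def AA c1_def c2_def
    by (simp_all add: w2_simps mscale_mult trace_add trace_mscale matrix_add_rdistrib bb AA n p1)
  have k4: "w4 \<beta> \<gamma> \<beta> \<gamma> = b\<^sup>2 / 2 - 4 * det M"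
  proof -
    have "w4 \<beta> \<gamma> \<beta> \<gamma> = trace (\<kappa> ** \<kappa>)"
      by (simp add: w4_def \<kappa>_def matrix_mul_assoc)
    then show ?thesis
      by (simp add: KK trace_add trace_mscale n b_def power2_eq_square)
  qed
  have cyc: "w3 \<beta> \<gamma> \<alpha> = w3 \<alpha> \<beta> \<gamma>" "w3 \<gamma> \<alpha> \<beta> = w3 \<alpha> \<beta> \<gamma>" "w3 \<gamma> \<beta> \<delta> = w3 \<delta> \<gamma> \<beta>"
    "w3 \<beta> \<delta> \<gamma> = w3 \<delta> \<gamma> \<beta>" "w4 \<beta> \<gamma> \<alpha> \<alpha> = w4 \<alpha> \<alpha> \<beta> \<gamma>" "w4 \<alpha> \<beta> \<gamma> \<alpha> = w4 \<alpha> \<alpha> \<beta> \<gamma>"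
    "w4 \<gamma> \<alpha> \<alpha> \<beta> = w4 \<alpha> \<alpha> \<beta> \<gamma>" "w4 \<gamma> \<beta> \<delta> \<delta> = w4 \<delta> \<delta> \<gamma> \<beta>" "w4 \<beta> \<delta> \<delta> \<gamma> = w4 \<delta> \<delta> \<gamma> \<beta>"
    "w4 \<delta> \<gamma> \<beta> \<delta> = w4 \<delta> \<delta> \<gamma> \<beta>" "w4 \<beta> \<delta> \<gamma> \<alpha> = w4 \<alpha> \<beta> \<delta> \<gamma>" "w4 \<delta> \<gamma> \<alpha> \<beta> = w4 \<alpha> \<beta> \<delta> \<gamma>"
    "w4 \<gamma> \<alpha> \<beta> \<delta> = w4 \<alpha> \<beta> \<delta> \<gamma>" "w4 \<gamma> \<beta> \<gamma> \<beta> = w4 \<beta> \<gamma> \<beta> \<gamma>"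
    by (metis w_cyclic)+
  have q1: "trace (blk \<alpha> \<beta> \<gamma> \<delta>) = trace \<alpha> + trace \<delta>"
    by (rule trace_blk)
  have q2: "w2 (blk \<alpha> \<beta> \<gamma> \<delta>) (blk \<alpha> \<beta> \<gamma> \<delta>) = w2 \<alpha> \<alpha> + 2 * b + w2 \<delta> \<delta>"
    by (simp add: blk_mult trace_blk trace_add bb)
  have q3: "w3 (blk \<alpha> \<beta> \<gamma> \<delta>) (blk \<alpha> \<beta> \<gamma> \<delta>) (blk \<alpha> \<beta> \<gamma> \<delta>) = w3 \<alpha> \<alpha> \<alpha> + 3 * c1 + 3 * c2 + w3 \<delta> \<delta> \<delta>"
    unfolding w3_def[of "blk \<alpha> \<beta> \<gamma> \<delta>"]
    by (simp add: blk_mult trace_blk trace_add matrix_add_ldistrib matrix_add_rdistrib c1_def c2_def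
        flip: w3_def) (simp add: cyc)
  have q4: "w4 (blk \<alpha> \<beta> \<gamma> \<delta>) (blk \<alpha> \<beta> \<gamma> \<delta>) (blk \<alpha> \<beta> \<gamma> \<delta>) (blk \<alpha> \<beta> \<gamma> \<delta>) = w4 \<alpha> \<alpha> \<alpha> \<alpha>
      + 4 * w4 \<alpha> \<alpha> \<beta> \<gamma> + 4 * w4 \<delta> \<delta> \<gamma> \<beta> + 4 * c4 + 2 * w4 \<beta> \<gamma> \<beta> \<gamma> + w4 \<delta> \<delta> \<delta> \<delta>"
    unfolding w4_def[of "blk \<alpha> \<beta> \<gamma> \<delta>"]
    by (simp add: blk_mult trace_blk trace_add matrix_add_ldistrib matrix_add_rdistrib c4_def
        flip: w4_def) (simp add: cyc)
  \<comment> \<open>As \<open>J4\<close> squares to -1, \<open>star4 X\<close> is up to sign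
    \<open>J4\<close> times u - \<alpha>, and likewise for Y; so the mixed term expands into the
    words already named.\<close>
  have mix: "trace (star4 X ** M ** star4 Y ** transpose M) = - (u * v * b - v * c1 - u * c2 + c4)"
  proof -
    have s: "star4 Z = - (J4 ** (mat (trace (Z ** J4) / 2) + mscale (- 1) (Z ** J4)))" if "skew Z" for Z
    proof -
      have "J4 ** (J4 ** star4 Z) = - star4 Z"
        by (simp add: matrix_mul_assoc J4_J4 matrix_minus_mult)
      then show ?thesis
        by (simp add: J4_star4[OF that])
    qed
    define a d where "a = mscale u (mat 1) + mscale (- 1) \<alpha>" and "d = mscale v (mat 1) + mscale (- 1) \<delta>"
    have m: "mscale c (mat 1) = mat c" for c
      by (simp add: vec_eq_iff mat_def)
    have "star4 X ** M ** star4 Y ** transpose M = (J4 ** a) ** M ** (J4 ** d) ** transpose M"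
      unfolding s[OF X] s[OF Y] a_def d_def m u_def v_def \<alpha>_def \<delta>_def by (simp add: matrix_minus_mult)
    also have "\<dots> = J4 ** (a ** (M ** J4) ** d ** transpose M)"
      by (simp add: matrix_mul_assoc)
    also have "trace \<dots> = - w4 a \<beta> d \<gamma>"
      unfolding trace_mul_sym[of J4] w4_def \<beta>_def \<gamma>_def by (simp add: matrix_mul_assoc matrix_minus_mult trace_def sum_negf)
    also have "\<dots> = - (u * v * b - v * c1 - u * c2 + c4)"
      by (simp add: a_def d_def w4_simps w3_simps w2_simps bb cyc c1_def c2_def c4_def algebra_simps)
    finally show ?thesis .
  qed
  show ?thesis
    unfolding A newton4_def Let_def q1 q2 q3 q4 k4 p4 p3 p2 p1 mix
    by (simp add: field_simps power2_eq_square power3_eq_cube power4_eq_xxxx)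
qed

section \<open>The Jordan algebra as skew-symmetric matrices\<close>

type_synonym blocks = "(complex^4^4) \<times> (complex^4^4) \<times> (complex^4^4)"

fun emb :: "blocks \<Rightarrow> complex^(4+4)^(4+4)" where
  "emb (X, M, Y) = blk X M (- transpose M) Y"

definition Om :: "complex^(4+4)^(4+4)" where
  "Om = blk J4 0 0 J4"

text \<open>The entries of the product of [[q0 + i q1, q2 + i q3], [-q2 + i q3, q0 - i q1]], the
  usual 2 x 2 matrix of a quaternion, with [[0, 1], [-1, 0]].\<close>

fun qa qb qc qd :: "complex quat \<Rightarrow> complex" where
  "qa (q0, q1, q2, q3) = - q2 - \<i> * q3"
| "qb (q0, q1, q2, q3) = q0 + \<i> * q1"
| "qc (q0, q1, q2, q3) = - q0 + \<i> * q1"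
| "qd (q0, q1, q2, q3) = - q2 + \<i> * q3"

text \<open>Yokota's embedding sends \<open>X = M + a\<close>, with \<open>M\<close> a quaternionic Hermitian matrix and \<open>a\<close> the row of
  the \<open>e\<^sub>4\<close>-components, to the quaternionic Hermitian \<open>4 \<times> 4\<close> matrix with rows \<open>(tr M / 2, i a)\<close> and
  \<open>(i a\<^sup>*, M - tr M / 2)\<close>. Below, \<open>\<xi> / 2\<close> is subtracted from its diagonal, each quaternion is
  replaced by a \<open>2 \<times> 2\<close> complex matrix times \<open>J\<close>, which makes the matrix skew-symmetric, and the
  result is recorded by its upper left, upper right and lower right \<open>4 \<times> 4\<close> blocks.\<close>

fun jskew :: "jordan \<Rightarrow> complex \<Rightarrow> blocks" where
  "jskew (a, b, c, (m1, a1), (m2, a2), (m3, a3)) \<xi> =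
    (skew4 ((a + b + c) / 2 - \<xi> / 2) (\<i> * qa a1) (\<i> * qb a1) (\<i> * qc a1) (\<i> * qd a1)
       ((a - b - c) / 2 - \<xi> / 2),
     vector [vector [\<i> * qa a2, \<i> * qb a2, \<i> * qa a3, \<i> * qb a3],
       vector [\<i> * qc a2, \<i> * qd a2, \<i> * qc a3, \<i> * qd a3],
       vector [qa m3, qb m3, qa (quat_cnj m2), qb (quat_cnj m2)],
       vector [qc m3, qd m3, qc (quat_cnj m2), qd (quat_cnj m2)]],
     skew4 ((b - a - c) / 2 - \<xi> / 2) (qa m1) (qb m1) (qc m1) (qd m1)
       ((c - a - b) / 2 - \<xi> / 2))"

lemma jgamma_eq: "jgamma (a, b, c, x, y, z) = (a, b, c, cay_gamma x, cay_gamma y, cay_gamma z)"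
  by (cases x, cases y, cases z) (simp add: jgamma_def jcoord_def map_matrix_def cay_re_def cay_scalar_def)

definition jmat8 :: "jordan \<Rightarrow> complex^(4+4)^(4+4)" where
  "jmat8 U = emb (jskew U 0) ** Om"

lemma jordan_coordinates:
  obtains a b c x0 x1 x2 x3 x4 x5 x6 x7 y0 y1 y2 y3 y4 y5 y6 y7 z0 z1 z2 z3 z4 z5 z6 z7 where
    "U = (a, b, c, ((x0, x1, x2, x3), (x4, x5, x6, x7)), ((y0, y1, y2, y3), (y4, y5, y6, y7)),
        ((z0, z1, z2, z3), (z4, z5, z6, z7)))"
  by (metis prod.exhaust)

lemma emb_jskew: "emb (jskew U \<xi>) ** Om = jmat8 U + mscale (\<xi> / 2) (mat 1)"
proof (cases U rule: jordan_coordinates)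
  case (1 a b c x0 x1 x2 x3 x4 x5 x6 x7 y0 y1 y2 y3 y4 y5 y6 y7 z0 z1 z2 z3 z4 z5 z6 z7)
  show ?thesis
    unfolding jmat8_def 1 jskew.simps emb.simps Om_def mat_blk blk_mult mscale_blk blk_add
    by (rule blk_cong; simp add: mat4_simps J4_def field_simps)
qed

lemma trace_jmat8: "trace (jmat8 U) = 0"
proof (cases U rule: jordan_coordinates)
  case (1 a b c x0 x1 x2 x3 x4 x5 x6 x7 y0 y1 y2 y3 y4 y5 y6 y7 z0 z1 z2 z3 z4 z5 z6 z7)
  show ?thesis
    unfolding jmat8_def 1 jskew.simps emb.simps Om_def blk_mult trace_blk
    by (simp add: mat4_simps J4_def field_simps)
qed

lemma trace_jmat8_mult: "trace (jmat8 U ** jmat8 W) = 2 * jform (jgamma U) W"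
proof (cases U rule: jordan_coordinates; cases W rule: jordan_coordinates)
  fix a b c x0 x1 x2 x3 x4 x5 x6 x7 y0 y1 y2 y3 y4 y5 y6 y7 z0 z1 z2 z3 z4 z5 z6 z7
    a' b' c' x0' x1' x2' x3' x4' x5' x6' x7' y0' y1' y2' y3' y4' y5' y6' y7' z0' z1' z2' z3' z4' z5' z6' z7'
  assume U: "U = (a, b, c, ((x0, x1, x2, x3), (x4, x5, x6, x7)), ((y0, y1, y2, y3), (y4, y5, y6, y7)),
        ((z0, z1, z2, z3), (z4, z5, z6, z7)))"
    and W: "W = (a', b', c', ((x0', x1', x2', x3'), (x4', x5', x6', x7')),
        ((y0', y1', y2', y3'), (y4', y5', y6', y7')), ((z0', z1', z2', z3'), (z4', z5', z6', z7')))"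
  show "trace (jmat8 U ** jmat8 W) = 2 * jform (jgamma U) W"
    unfolding jmat8_def U W jskew.simps emb.simps Om_def blk_mult trace_blk jgamma_eq
    by (simp add: mat4_simps J4_def jform_eq field_simps)
qed


text \<open>Yokota's embedding g satisfies (gX)(gX) = g(\<gamma>(X \<times> X)) + (\<gamma>X, X)/4.
  The minus sign arises because \<open>jmat8\<close> multiplies by J twice and hence is -g.\<close>

lemma jmat8_square:
  "jmat8 U ** jmat8 U =
    mscale (- 1) (jmat8 (jgamma (U \<times>\<^sub>J U))) + mscale (jform (jgamma U) U / 4) (mat 1)"
proof -
  \<comment> \<open>Coordinates of U/2 are used so that the halves in the cross product and on the
    diagonal of \<open>jskew\<close> cancel and all entries become integral polynomials.\<close>
  obtain a b c x0 x1 x2 x3 x4 x5 x6 x7 y0 y1 y2 y3 y4 y5 y6 y7 z0 z1 z2 z3 z4 z5 z6 z7 where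
    V: "(1/2) *\<^sub>C U = (a, b, c, ((x0, x1, x2, x3), (x4, x5, x6, x7)), ((y0, y1, y2, y3), (y4, y5, y6, y7)),
        ((z0, z1, z2, z3), (z4, z5, z6, z7)))"
    by (rule jordan_coordinates)
  have "U = 2 *\<^sub>C ((1/2) *\<^sub>C U)"
    by (simp add: scaleC_scaleC scaleC_one)
  then have U: "U = (2 * a, 2 * b, 2 * c, ((2 * x0, 2 * x1, 2 * x2, 2 * x3), (2 * x4, 2 * x5, 2 * x6, 2 * x7)),
      ((2 * y0, 2 * y1, 2 * y2, 2 * y3), (2 * y4, 2 * y5, 2 * y6, 2 * y7)),
        ((2 * z0, 2 * z1, 2 * z2, 2 * z3), (2 * z4, 2 * z5, 2 * z6, 2 * z7)))"
    unfolding V by (simp add: scaleC_simps)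
  have half: "(2 * p + 2 * q + 2 * r) / 2 = p + q + r" "(2 * p - 2 * q - 2 * r) / 2 = p - q - r"
     "1 / 2 * (2 * p + 2 * q) = p + q" "(1 / 2) * (4 * p) = 2 * p" for p q r :: complex
    by simp_all
  have f: "jform (jgamma U) U / 4 = a * a + b * b + c * c
      + 2 * (x0 * x0 + x1 * x1 + x2 * x2 + x3 * x3 - (x4 * x4 + x5 * x5 + x6 * x6 + x7 * x7)
       + (y0 * y0 + y1 * y1 + y2 * y2 + y3 * y3 - (y4 * y4 + y5 * y5 + y6 * y6 + y7 * y7))
       + (z0 * z0 + z1 * z1 + z2 * z2 + z3 * z3 - (z4 * z4 + z5 * z5 + z6 * z6 + z7 * z7)))"
    unfolding U jgamma_eq jform_eq by simp
  have dot: "cay_dot ((2 * x0, 2 * x1, 2 * x2, 2 * x3), (2 * x4, 2 * x5, 2 * x6, 2 * x7))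
     ((2 * x0, 2 * x1, 2 * x2, 2 * x3), (2 * x4, 2 * x5, 2 * x6, 2 * x7)) =
     4 * (x0 * x0 + x1 * x1 + x2 * x2 + x3 * x3 + x4 * x4 + x5 * x5 + x6 * x6 + x7 * x7)"
    for x0 x1 x2 x3 x4 x5 x6 x7
    by (simp add: algebra_simps)
  have mul: "(1 / 2) *\<^sub>C (cay_cnj (cay_mult (2 *\<^sub>C y) (2 *\<^sub>C z) + cay_mult (2 *\<^sub>C y) (2 *\<^sub>C z))
      - ((2 * a) *\<^sub>C (2 *\<^sub>C x) + (2 * a) *\<^sub>C (2 *\<^sub>C x))) = 4 *\<^sub>C (cay_cnj (cay_mult y z) - a *\<^sub>C x)"
    for a and x y z :: "complex cayley"
    by (cases x rule: cayley_cases, cases y rule: cayley_cases, cases z rule: cayley_cases)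
      (simp add: scaleC_simps algebra_simps)
  have two: "((2 * x0, 2 * x1, 2 * x2, 2 * x3), (2 * x4, 2 * x5, 2 * x6, 2 * x7)) =
      2 *\<^sub>C ((x0, x1, x2, x3), (x4, x5, x6, x7))" for x0 x1 x2 x3 x4 x5 x6 x7 :: complex
    by (simp add: scaleC_simps)
  let ?x = "((x0, x1, x2, x3), (x4, x5, x6, x7))"
  let ?nx = "x0 * x0 + x1 * x1 + x2 * x2 + x3 * x3 + x4 * x4 + x5 * x5 + x6 * x6 + x7 * x7"
  let ?y = "((y0, y1, y2, y3), (y4, y5, y6, y7))"
  let ?ny = "y0 * y0 + y1 * y1 + y2 * y2 + y3 * y3 + y4 * y4 + y5 * y5 + y6 * y6 + y7 * y7"
  let ?z = "((z0, z1, z2, z3), (z4, z5, z6, z7))"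
  let ?nz = "z0 * z0 + z1 * z1 + z2 * z2 + z3 * z3 + z4 * z4 + z5 * z5 + z6 * z6 + z7 * z7"
  have s: "U \<times>\<^sub>J U = (2 * (2 * (b * c - (?nx))),
     2 * (2 * (a * c - (?ny))),
     2 * (2 * (a * b - (?nz))),
     4 *\<^sub>C (cay_cnj (cay_mult ?y ?z) - a *\<^sub>C ?x),
     4 *\<^sub>C (cay_cnj (cay_mult ?z ?x) - b *\<^sub>C ?y),
     4 *\<^sub>C (cay_cnj (cay_mult ?x ?y) - c *\<^sub>C ?z))"
    unfolding U jcross_eq dot unfolding two
    unfolding mul by (simp del: cay_mult.simps cay_cnj.simps add: algebra_simps)
  show ?thesis
    unfolding f s unfolding jmat8_def U jgamma_eq cay_mult.simps quat_mult.simps quat_cnj.simps cay_cnj.simps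
      scaleC_simps fst_conv snd_conv minus_prod_def plus_prod_def uminus_prod_def cay_gamma.simps
      jskew.simps emb.simps Om_def mat_blk blk_mult mscale_blk blk_add half
    by (rule blk_cong; simp add: mat4_simps J4_def algebra_simps)
qed

section \<open>The Freudenthal space as pairs of skew-symmetric matrices\<close>

fun bscale :: "complex \<Rightarrow> blocks \<Rightarrow> blocks" where
  "bscale c (X, M, Y) = (mscale c X, mscale c M, mscale c Y)"

fun bskew :: "blocks \<Rightarrow> bool" where
  "bskew (X, M, Y) \<longleftrightarrow> skew X \<and> skew Y"

text \<open>The Pfaffian of \<open>emb (X, M, Y)\<close>, sorted by its degree 0, 2 and 4 in
  M.\<close>

fun pf8 :: "blocks \<Rightarrow> complex" where
  "pf8 (X, M, Y) = pf4 X * pf4 Y + trace (star4 X ** M ** star4 Y ** transpose M) / 2 + det M"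

lemma bscale_add: "bscale c (x + y) = bscale c x + bscale c y"
  by (cases x; cases y) (simp add: mscale_add)

lemma bscale_bscale: "bscale c (bscale d x) = bscale (c * d) x"
  by (cases x) (simp add: mscale_mscale)

lemma bscale_one [simp]: "bscale 1 x = x"
  by (cases x) simp

lemma emb_add: "emb (x + y) = emb x + emb y"
  by (cases x; cases y) (simp add: blk_add transpose_add)

lemma emb_bscale: "emb (bscale c x) = mscale c (emb x)"
  by (cases x) (simp add: mscale_blk transpose_mscale uminus_eq_mscale mscale_mscale mult.commute)

lemma jgamma_jgamma: "jgamma (jgamma X) = X"
  by (cases X rule: jordan_coordinates) (simp add: jgamma_eq)

lemma jgamma_jcross: "jgamma (X \<times>\<^sub>J Y) = jgamma X \<times>\<^sub>J jgamma Y"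
proof -
  have [simp]: "cay_gamma (cay_mult x y) = cay_mult (cay_gamma x) (cay_gamma y)"
      "cay_gamma (cay_cnj x) = cay_cnj (cay_gamma x)" "cay_dot (cay_gamma x) (cay_gamma y) = cay_dot x y"
      "cay_gamma (x + y) = cay_gamma x + cay_gamma y" "cay_gamma (x - y) = cay_gamma x - cay_gamma y"
      "cay_gamma (r *\<^sub>C x) = r *\<^sub>C cay_gamma x" for x y :: "complex cayley" and r
    by (cases x rule: cayley_cases, cases y rule: cayley_cases, simp add: scaleC_simps algebra_simps)+
  show ?thesis
    by (cases X rule: jordan_cases, cases Y rule: jordan_cases) (simp add: jcross_eq jgamma_eq)
qed

lemma jform_jgamma: "jform (jgamma X) Y = jform X (jgamma Y)"
  by (cases X rule: jordan_coordinates, cases Y rule: jordan_coordinates) (simp add: jform_eq jgamma_eq)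

lemma bskew_jskew: "bskew (jskew U \<xi>)"
  by (cases U rule: jordan_coordinates) (simp add: skew_skew4)

text \<open>Coordinates of the two eigenspaces of \<lambda>\<gamma>: this map sends X to \<gamma>Y
  and \<gamma>Y to -X, so it multiplies X + i \<gamma>Y by -i and X - i \<gamma>Y by i, and
  similarly for the scalars.\<close>

fun chi1 chi2 :: "freud \<Rightarrow> blocks" where
  "chi1 (X, Y, \<xi>, \<eta>) = jskew X \<xi> + bscale \<i> (jskew (jgamma Y) \<eta>)"
| "chi2 (X, Y, \<xi>, \<eta>) = jskew X \<xi> + bscale (- \<i>) (jskew (jgamma Y) \<eta>)"

lemma bskew_add: "bskew x \<Longrightarrow> bskew y \<Longrightarrow> bskew (x + y)"
  by (cases x; cases y) (simp add: transpose_add)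

lemma bskew_bscale: "bskew x \<Longrightarrow> bskew (bscale c x)"
  by (cases x) (simp add: transpose_mscale uminus_eq_mscale mscale_mscale)

lemma bskew_chi: "bskew (chi1 P)" "bskew (chi2 P)"
  by (cases P rule: freud_cases; simp add: bskew_add bskew_bscale bskew_jskew)+

lemma emb_chi:
  "emb (chi1 (X, Y, \<xi>, \<eta>)) ** Om =
    jmat8 X + mscale \<i> (jmat8 (jgamma Y)) + mscale ((\<xi> + \<i> * \<eta>) / 2) (mat 1)"
  "emb (chi2 (X, Y, \<xi>, \<eta>)) ** Om =
    jmat8 X + mscale (- \<i>) (jmat8 (jgamma Y)) + mscale ((\<xi> - \<i> * \<eta>) / 2) (mat 1)"
  unfolding chi1.simps chi2.simps emb_add emb_bscale matrix_add_rdistrib mscale_mult emb_jskew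
  by (simp_all add: vec_eq_iff algebra_simps add_divide_distrib diff_divide_distrib)

lemma newton4_emb: "bskew x \<Longrightarrow> newton4 (emb x ** Om) = pf8 x"
  by (cases x) (simp add: Om_def newton4_blk)

lemma trace_one8: "trace (mat 1 :: complex^(4+4)^(4+4)) = 8"
  by (simp add: trace_mat)

abbreviation xw :: "freud \<Rightarrow> complex^(4+4)^(4+4)" where "xw P \<equiv> emb (chi1 P) ** Om"
abbreviation yw :: "freud \<Rightarrow> complex^(4+4)^(4+4)" where "yw P \<equiv> emb (chi2 P) ** Om"

text \<open>Cartan's expression of the quartic invariant of E7 by two skew-symmetric 8 x 8 matrices.
  The words of length three and four in \<open>newton4_identity\<close> are evaluated by replacing
  \<open>G ** G\<close> and \<open>K ** K\<close> through \<open>jmat8_square\<close>.\<close>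

lemma fnorm_chi:
  "8 * fnorm P = w4 (xw P) (yw P) (xw P) (yw P) / 2 - (w2 (xw P) (yw P) / 2)\<^sup>2 / 2
    + 2 * pf8 (chi1 P) + 2 * pf8 (chi2 P)"
proof -
  obtain X Y \<xi> \<eta> where P: "P = (X, Y, \<xi>, \<eta>)" by (rule freud_cases)
  define G K where "G = jmat8 X" and "K = jmat8 (jgamma Y)"
  have GG: "G ** G = mscale (- 1) (jmat8 (jgamma (X \<times>\<^sub>J X))) + mscale (jform (jgamma X) X / 4) (mat 1)"
    and KK: "K ** K = mscale (- 1) (jmat8 (Y \<times>\<^sub>J Y)) + mscale (jform Y (jgamma Y) / 4) (mat 1)"
    unfolding G_def K_def jmat8_square by (simp_all add: jgamma_jgamma jgamma_jcross)
  have 1: "w2 G K = 2 * jform X Y" "w2 G G = 2 * jform (jgamma X) X" "w2 K K = 2 * jform Y (jgamma Y)"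
    by (simp_all add: G_def K_def trace_jmat8_mult jgamma_jgamma jform_jgamma)
  have 2: "w3 G G G = - 2 * jform X (X \<times>\<^sub>J X)" "w3 K K K = - 2 * jform Y (Y \<times>\<^sub>J Y)"
    unfolding w3_def GG KK
    by (simp_all add: w2_simps G_def K_def trace_jmat8_mult trace_jmat8 jgamma_jgamma jform_commute
        jform_jgamma)
  have 4: "w4 G G K K = 2 * jform (X \<times>\<^sub>J X) (Y \<times>\<^sub>J Y) + jform (jgamma X) X * jform Y (jgamma Y) / 2"
  proof -
    have "w4 G G K K = trace ((G ** G) ** (K ** K))"
      by (simp add: w4_def matrix_mul_assoc)
    then show ?thesis
      unfolding GG KK by (simp add: w2_simps trace_add trace_mscale trace_jmat8_mult trace_jmat8 jgamma_jgamma
         trace_one8)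
  qed
  have "w4 (xw P) (yw P) (xw P) (yw P) / 2 - (w2 (xw P) (yw P) / 2)\<^sup>2 / 2
      + 2 * newton4 (xw P) + 2 * newton4 (yw P) =
    8 * (w4 G G K K / 2 - w2 G G * w2 K K / 16 + \<xi> * w3 G G G / 6 + \<eta> * w3 K K K / 6
      - 1 / 4 * (w2 G K / 2 - \<xi> * \<eta>)\<^sup>2)"
    unfolding P emb_chi G_def K_def
    by (rule newton4_identity) (simp_all only: trace_jmat8 trace_one8)
  also have "\<dots> = 8 * fnorm P"
    unfolding 1 2 4 P by (simp add: jform_commute algebra_simps)
  finally show ?thesis
    by (simp only: newton4_emb bskew_chi)
qed

lemma fsymp_chi: "w2 (xw P) (yw Q) - w2 (yw P) (xw Q) = - 4 * \<i> * fsymp P Q"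
proof -
  obtain X Y \<xi> \<eta> where P: "P = (X, Y, \<xi>, \<eta>)" by (rule freud_cases)
  obtain Z W \<zeta> \<omega> where Q: "Q = (Z, W, \<zeta>, \<omega>)" by (rule freud_cases)
  show ?thesis
    unfolding P Q emb_chi
    by (simp add: w2_simps trace_add trace_mscale trace_jmat8_mult trace_jmat8 jgamma_jgamma trace_one8
        jform_jgamma jform_commute[of Y] field_simps)
qed

section \<open>The Hermitian form, and the inverse of the coordinate change\<close>

definition frob :: "complex^'n^'m \<Rightarrow> complex^'n^'m \<Rightarrow> complex" where
  "frob A B = (\<Sum>i\<in>UNIV. \<Sum>j\<in>UNIV. cnj (A $ i $ j) * B $ i $ j)"

text \<open>The Frobenius product of the 8 x 8 matrices; the block M occurs twice in
  \<open>emb\<close>.\<close>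

fun bherm :: "blocks \<Rightarrow> blocks \<Rightarrow> complex" where
  "bherm (X, M, Y) (X', M', Y') = frob X X' + 2 * frob M M' + frob Y Y'"

lemma frob_simps: "frob (A + A') B = frob A B + frob A' B" "frob A (B + B') = frob A B + frob A B'"
    "frob (mscale c A) B = cnj c * frob A B" "frob A (mscale c B) = c * frob A B"
  by (simp_all add: frob_def sum.distrib sum_distrib_left algebra_simps)

lemma bherm_simps: "bherm (x + x') y = bherm x y + bherm x' y" "bherm x (y + y') = bherm x y + bherm x y'"
    "bherm (bscale c x) y = cnj c * bherm x y" "bherm x (bscale c y) = c * bherm x y"
  by (cases x; cases y; cases x'; cases y'; simp add: frob_simps algebra_simps)+

lemma bherm_jskew: "bherm (jskew U \<xi>) (jskew W \<zeta>) = 2 * (jherm U W + cnj \<xi> * \<zeta>)"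
  by (cases U rule: jordan_coordinates, cases W rule: jordan_coordinates)
    (simp add: frob_def sum_4 skew4_def jherm_def jform_eq conjC_prod_def conjC_complex_def field_simps)

lemma jherm_jgamma: "jherm (jgamma U) (jgamma W) = jherm U W"
  by (cases U rule: jordan_coordinates, cases W rule: jordan_coordinates)
    (simp add: jherm_def jgamma_eq jform_eq conjC_prod_def conjC_complex_def)

lemma fherm_chi: "bherm (chi1 P) (chi1 Q) + bherm (chi2 P) (chi2 Q) = 4 * fherm P Q"
  by (cases P rule: freud_cases, cases Q rule: freud_cases)
    (simp add: bherm_simps bherm_jskew jherm_jgamma conjC_complex_def algebra_simps)

fun unquat :: "complex \<Rightarrow> complex \<Rightarrow> complex \<Rightarrow> complex \<Rightarrow> complex quat" where
  "unquat p r s t = ((r - s) / 2, - \<i> * (r + s) / 2, - (p + t) / 2, \<i> * (p - t) / 2)"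

text \<open>In \<open>jskew U \<xi>\<close> the contributions of a, b and c to these four entries
  cancel, and the entries add up to -2 \<xi>.\<close>

fun bxi :: "blocks \<Rightarrow> complex" where
  "bxi (X, M, Y) = - (X$1$2 + X$3$4 + Y$1$2 + Y$3$4) / 2"

fun junskew :: "blocks \<Rightarrow> jordan" where
  "junskew (X, M, Y) = (let \<xi> = bxi (X, M, Y) + X$1$2 in
    (X$3$4 + \<xi>, Y$1$2 + \<xi>, Y$3$4 + \<xi>,
     (unquat (Y$1$3) (Y$1$4) (Y$2$3) (Y$2$4),
      unquat (- \<i> * X$1$3) (- \<i> * X$1$4) (- \<i> * X$2$3) (- \<i> * X$2$4)),
     (quat_cnj (unquat (M$3$3) (M$3$4) (M$4$3) (M$4$4)),
      unquat (- \<i> * M$1$1) (- \<i> * M$1$2) (- \<i> * M$2$1) (- \<i> * M$2$2)),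
     (unquat (M$3$1) (M$3$2) (M$4$1) (M$4$2),
      unquat (- \<i> * M$1$3) (- \<i> * M$1$4) (- \<i> * M$2$3) (- \<i> * M$2$4))))"

definition chi_inv :: "blocks \<Rightarrow> blocks \<Rightarrow> freud" where
  "chi_inv x y = (let u = bscale (1/2) (x + y); v = bscale (- \<i> / 2) (x + bscale (- 1) y) in
    (junskew u, jgamma (junskew v), bxi u, bxi v))"

lemma jskew_junskew: "bskew x \<Longrightarrow> jskew (junskew x) (bxi x) = x"
proof (cases x)
  case (fields X M Y)
  assume "bskew x"
  with fields obtain a b c d e f a' b' c' d' e' f' where
    "X = skew4 a b c d e f" "Y = skew4 a' b' c' d' e' f'"
    by (metis bskew.simps skew_cases)
  then show ?thesis
    by (simp add: fields skew4_def Let_def mat4_simps field_simps)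
qed

lemma junskew_jskew: "junskew (jskew U \<xi>) = U" and bxi_jskew: "bxi (jskew U \<xi>) = \<xi>"
  by (cases U rule: jordan_coordinates; simp add: skew4_def Let_def field_simps)+

lemma chi_chi_inv:
  assumes "bskew x" "bskew y"
  shows "chi1 (chi_inv x y) = x" "chi2 (chi_inv x y) = y"
proof -
  define u v where "u = bscale (1/2) (x + y)" and "v = bscale (- \<i> / 2) (x + bscale (- 1) y)"
  have "bskew u" "bskew v"
    using assms by (simp_all only: u_def v_def bskew_add bskew_bscale)
  then have "chi1 (chi_inv x y) = u + bscale \<i> v" "chi2 (chi_inv x y) = u + bscale (- \<i>) v"
    unfolding chi_inv_def Let_def u_def[symmetric] v_def[symmetric]
    by (simp_all only: chi1.simps chi2.simps jgamma_jgamma jskew_junskew)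
  moreover have "u + bscale \<i> v = x" "u + bscale (- \<i>) v = y"
    unfolding u_def v_def by (cases x; cases y; simp add: vec_eq_iff field_simps)+
  ultimately show "chi1 (chi_inv x y) = x" "chi2 (chi_inv x y) = y"
    by simp_all
qed

lemma chi_inv_chi: "chi_inv (chi1 P) (chi2 P) = P"
proof (cases P rule: freud_cases)
  case (1 X Y \<xi> \<eta>)
  have "bscale (1/2) (u + bscale \<i> v + (u + bscale (- \<i>) v)) = u"
    "bscale (- \<i> / 2) (u + bscale \<i> v + bscale (- 1) (u + bscale (- \<i>) v)) = v" for u v
    by (cases u; cases v; simp add: vec_eq_iff field_simps)+
  then show ?thesis
    by (simp only: 1 chi1.simps chi2.simps chi_inv_def Let_def junskew_jskew bxi_jskew jgamma_jgamma)
qed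

lemma freud_eqI: "chi1 P = chi1 Q \<Longrightarrow> chi2 P = chi2 Q \<Longrightarrow> P = Q"
  by (metis chi_inv_chi)

lemma jskew_add: "jskew (U + W) (\<xi> + \<zeta>) = jskew U \<xi> + jskew W \<zeta>"
  by (cases U rule: jordan_coordinates, cases W rule: jordan_coordinates)
    (simp add: skew4_def mat4_simps field_simps)

lemma jskew_scaleC: "jskew (c *\<^sub>C U) (c * \<xi>) = bscale c (jskew U \<xi>)"
  by (cases U rule: jordan_coordinates) (simp add: skew4_def mat4_simps scaleC_simps field_simps)

lemma jgamma_add: "jgamma (U + W) = jgamma U + jgamma W"
  by (cases U rule: jordan_coordinates, cases W rule: jordan_coordinates) (simp add: jgamma_eq)

lemma jgamma_scaleC: "jgamma (c *\<^sub>C U) = c *\<^sub>C jgamma U"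
  by (cases U rule: jordan_coordinates) (simp add: jgamma_eq scaleC_simps)

lemma chi_add: "chi1 (P + Q) = chi1 P + chi1 Q" "chi2 (P + Q) = chi2 P + chi2 Q"
  by (cases P rule: freud_cases; cases Q rule: freud_cases;
      simp add: jskew_add jgamma_add bscale_add)+

lemma chi_scaleC: "chi1 (c *\<^sub>C P) = bscale c (chi1 P)" "chi2 (c *\<^sub>C P) = bscale c (chi2 P)"
proof -
  obtain X Y \<xi> \<eta> where P: "P = (X, Y, \<xi>, \<eta>)"
    by (rule freud_cases)
  show "chi1 (c *\<^sub>C P) = bscale c (chi1 P)" "chi2 (c *\<^sub>C P) = bscale c (chi2 P)"
    unfolding P scaleC_freud chi1.simps chi2.simps jgamma_scaleC jskew_scaleC bscale_add bscale_bscale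
      mult.commute[of c \<i>] mult.commute[of c "- \<i>"]
    by (rule refl)+
qed

lemma emb_inject: "emb x = emb y \<longleftrightarrow> x = y"
proof
  have blk_nth: "blk A B C D $ Inl i $ Inl j = A $ i $ j" "blk A B C D $ Inl i $ Inr j = B $ i $ j"
    "blk A B C D $ Inr i $ Inr j = D $ i $ j" for A B C D :: "complex^4^4" and i j
    by (simp_all add: blk_def)
  assume "emb x = emb y"
  then have "emb x $ i $ j = emb y $ i $ j" for i j
    by simp
  from this[of "Inl _" "Inl _"] this[of "Inl _" "Inr _"] this[of "Inr _" "Inr _"]
  show "x = y"
    by (cases x; cases y) (simp add: blk_nth vec_eq_iff)
qed simp

section \<open>Block transformations in $E_7$\<close>

definition block_op :: "(blocks \<Rightarrow> blocks) \<Rightarrow> (blocks \<Rightarrow> blocks) \<Rightarrow> freud \<Rightarrow> freud" where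
  "block_op f g P = chi_inv (f (chi1 P)) (g (chi2 P))"

definition congruence_by :: "(blocks \<Rightarrow> blocks) \<Rightarrow> complex^(4+4)^(4+4) \<Rightarrow> bool" where
  "congruence_by f D \<longleftrightarrow> (\<forall>x. emb (f x) = D ** emb x ** transpose D)"

lemma congruence_byD: "congruence_by f D \<Longrightarrow> emb (f x) = D ** emb x ** transpose D"
  by (simp only: congruence_by_def)

lemma congruence_by_add: "congruence_by f D \<Longrightarrow> f (x + y) = f x + f y"
  by (subst emb_inject[symmetric])
    (simp only: congruence_byD emb_add matrix_add_ldistrib matrix_add_rdistrib)

lemma congruence_by_bscale: "congruence_by f D \<Longrightarrow> f (bscale c x) = bscale c (f x)"
  by (subst emb_inject[symmetric]) (simp only: congruence_byD emb_bscale mscale_mult)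

lemma transpose_Om: "transpose Om = - Om"
  by (simp add: vec_eq_iff transpose_def Om_def blk_def J4_def mat4_simps split: sum.splits)

text \<open>The condition on D and E says that E is the contragredient of D with respect to
  \<open>Om\<close>. In trace words that alternate between the two copies, D then cancels against
  E.\<close>

locale block_pair =
  fixes f g :: "blocks \<Rightarrow> blocks" and D E :: "complex^(4+4)^(4+4)"
  assumes f: "congruence_by f D" and g: "congruence_by g E"
    and DE: "transpose D ** Om ** E = Om"
    and bskew: "\<And>x. bskew x \<Longrightarrow> bskew (f x)" "\<And>x. bskew x \<Longrightarrow> bskew (g x)"
    and pf8: "\<And>x. bskew x \<Longrightarrow> pf8 (f x) = pf8 x" "\<And>x. bskew x \<Longrightarrow> pf8 (g x) = pf8 x"
    and herm: "\<And>x y. bherm (f x) (f y) = bherm x y" "\<And>x y. bherm (g x) (g y) = bherm x y"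
begin

lemma chi_op: "chi1 (block_op f g P) = f (chi1 P)" "chi2 (block_op f g P) = g (chi2 P)"
  by (simp_all add: block_op_def chi_chi_inv bskew bskew_chi)

lemma clinear_op: "clinear (block_op f g)"
  by (intro clinearI freud_eqI)
    (simp_all add: chi_op chi_add chi_scaleC congruence_by_add[OF f] congruence_by_add[OF g]
      congruence_by_bscale[OF f] congruence_by_bscale[OF g])

lemma ED: "transpose E ** Om ** D = Om"
proof -
  have "transpose (transpose D ** Om ** E) = - (transpose E ** Om ** D)"
    by (simp add: matrix_transpose_mul transpose_Om matrix_mul_assoc matrix_minus_mult)
  then show ?thesis
    by (simp add: DE transpose_Om)
qed

lemma w2_op: "w2 (emb (f x) ** Om) (emb (g y) ** Om) = w2 (emb x ** Om) (emb y ** Om)"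
proof -
  have "w2 (emb (f x) ** Om) (emb (g y) ** Om)
      = trace (D ** (emb x ** (transpose D ** Om ** E) ** emb y ** transpose E ** Om))"
    by (simp only: congruence_byD[OF f] congruence_byD[OF g] matrix_mul_assoc)
  also have "\<dots> = trace (emb x ** Om ** emb y ** (transpose E ** Om ** D))"
    unfolding DE trace_mul_sym[of D] by (simp add: matrix_mul_assoc)
  finally show ?thesis
    by (simp add: ED matrix_mul_assoc)
qed

lemma fsymp_op: "fsymp (block_op f g P) (block_op f g Q) = fsymp P Q"
proof -
  have "w2 (emb (g y) ** Om) (emb (f x) ** Om) = w2 (emb y ** Om) (emb x ** Om)" for x y
    using w2_op[of x y] by (metis trace_mul_sym)
  with w2_op have "- 4 * \<i> * fsymp (block_op f g P) (block_op f g Q) = - 4 * \<i> * fsymp P Q"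
    unfolding fsymp_chi[symmetric] chi_op by simp
  then show ?thesis
    by simp
qed

lemma fnorm_op: "fnorm (block_op f g P) = fnorm P"
proof -
  have 4: "w4 (emb (f x) ** Om) (emb (g y) ** Om) (emb (f x) ** Om) (emb (g y) ** Om)
      = w4 (emb x ** Om) (emb y ** Om) (emb x ** Om) (emb y ** Om)" for x y
  proof -
    define U where "U = emb x ** Om ** emb y"
    have U: "emb (f x) ** Om ** emb (g y) = D ** U ** transpose E"
    proof -
      have "emb (f x) ** Om ** emb (g y) = D ** emb x ** (transpose D ** Om ** E) ** emb y ** transpose E"
        by (simp only: congruence_byD[OF f] congruence_byD[OF g] matrix_mul_assoc)
      then show ?thesis
        by (simp add: DE U_def matrix_mul_assoc)
    qed
    have "w4 (emb (f x) ** Om) (emb (g y) ** Om) (emb (f x) ** Om) (emb (g y) ** Om)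
        = trace ((emb (f x) ** Om ** emb (g y)) ** Om ** (emb (f x) ** Om ** emb (g y)) ** Om)"
      by (simp add: w4_def matrix_mul_assoc)
    also have "\<dots> = trace (D ** (U ** (transpose E ** Om ** D) ** U ** transpose E ** Om))"
      unfolding U by (simp add: matrix_mul_assoc)
    also have "\<dots> = trace (U ** Om ** U ** (transpose E ** Om ** D))"
      by (subst ED, subst trace_mul_sym) (simp only: matrix_mul_assoc)
    finally show "w4 (emb (f x) ** Om) (emb (g y) ** Om) (emb (f x) ** Om) (emb (g y) ** Om)
       = w4 (emb x ** Om) (emb y ** Om) (emb x ** Om) (emb y ** Om)"
      by (simp add: ED U_def w4_def matrix_mul_assoc)
  qed
  have "8 * fnorm (block_op f g P) = 8 * fnorm P"
    unfolding fnorm_chi chi_op w2_op 4 by (simp only: pf8 bskew_chi)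
  then show ?thesis
    by simp
qed

lemma fherm_op: "fherm (block_op f g P) (block_op f g Q) = fherm P Q"
proof -
  have "4 * fherm (block_op f g P) (block_op f g Q) = 4 * fherm P Q"
    unfolding fherm_chi[symmetric] chi_op herm ..
  then show ?thesis
    by simp
qed

lemma op_in_E7: "bij (block_op f g) \<Longrightarrow> block_op f g \<in> E7"
  by (rule E7I[OF clinear_op _ fsymp_op fnorm_op fherm_op])

end

section \<open>Unitary matrices and their contragredients\<close>

abbreviation unitary :: "complex^'n^'n \<Rightarrow> bool" where
  "unitary A \<equiv> adjoint_matrix A ** A = mat 1"

lemma unitary_right: "unitary A \<Longrightarrow> A ** adjoint_matrix A = mat 1"
  using matrix_left_right_inverse by blast

lemma unitary_adjoint: "unitary A \<Longrightarrow> unitary (adjoint_matrix A)"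
  by (simp add: adjoint_matrix_adjoint_matrix unitary_right)

lemma unitary_mult: "unitary A \<Longrightarrow> unitary B \<Longrightarrow> unitary (A ** B)"
proof -
  assume A: "unitary A" and B: "unitary B"
  have "adjoint_matrix (A ** B) ** (A ** B) = adjoint_matrix B ** (adjoint_matrix A ** A) ** B"
    by (simp add: adjoint_matrix_mult matrix_mul_assoc)
  then show ?thesis
    by (simp add: A B)
qed

lemma transpose_map_cnj: "transpose (map_matrix cnj A) = map_matrix cnj (transpose A)"
  by (simp add: vec_eq_iff transpose_def)

lemma map_cnj_mult: "map_matrix cnj (A ** B) = map_matrix cnj A ** map_matrix cnj B"
  by (simp add: vec_eq_iff matrix_matrix_mult_def)

lemma unitary_transpose_cnj: "unitary A \<Longrightarrow> transpose A ** map_matrix cnj A = mat 1"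
proof -
  assume "unitary A"
  then have "transpose (adjoint_matrix A ** A) = mat 1"
    by (simp add: transpose_mat)
  then show ?thesis
    by (simp add: matrix_transpose_mul adjoint_matrix_def flip: transpose_map_cnj)
qed

lemma trace_adjoint: "frob A B = trace (adjoint_matrix A ** B)"
  unfolding frob_def trace_def matrix_matrix_mult_def adjoint_matrix_def transpose_def
  by (subst sum.swap) simp

lemma frob_unitary:
  fixes A B X Y :: "complex^'n^'n"
  assumes "unitary A" "unitary B"
  shows "frob (A ** X ** transpose B) (A ** Y ** transpose B) = frob X Y"
proof -
  have B: "transpose B ** adjoint_matrix (transpose B) = mat 1"
    using unitary_transpose_cnj[OF assms(2)] by (simp add: adjoint_matrix_def)
  have "frob (A ** X ** transpose B) (A ** Y ** transpose B)
      = trace (adjoint_matrix (transpose B) ** (adjoint_matrix X ** (adjoint_matrix A ** A) ** Y ** transpose B))"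
    by (simp add: trace_adjoint adjoint_matrix_mult matrix_mul_assoc)
  also have "\<dots> = trace (adjoint_matrix X ** Y ** (transpose B ** adjoint_matrix (transpose B)))"
    by (subst trace_mul_sym) (simp add: assms matrix_mul_assoc)
  finally show ?thesis
    by (simp add: B trace_adjoint)
qed

text \<open>The contragredient of a unitary matrix, conjugated by \<open>J4\<close> because both eigenspaces of \<open>\<lambda>\<gamma>\<close>
  carry the same kind of skew-symmetric matrix.\<close>

definition dual4 :: "complex^4^4 \<Rightarrow> complex^4^4" where
  "dual4 A = - (J4 ** map_matrix cnj A ** J4)"

lemma J4_J4_mult: "A ** J4 ** J4 = - A" "J4 ** (J4 ** A) = - A"
  unfolding matrix_mul_assoc J4_J4 unfolding J4_J4 matrix_mul_assoc[symmetric]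
  by (simp_all add: J4_J4 matrix_minus_mult)

lemma dual4_mult: "dual4 (A ** B) = dual4 A ** dual4 B"
  by (simp add: dual4_def map_cnj_mult matrix_minus_mult matrix_mul_assoc J4_J4_mult)

lemma dual4_one: "dual4 (mat 1) = mat 1"
proof -
  have "map_matrix cnj (mat 1) = (mat 1 :: complex^4^4)"
    by (simp add: vec_eq_iff mat_def)
  then show ?thesis
    by (simp add: dual4_def J4_J4)
qed

lemma adjoint_dual4: "adjoint_matrix (dual4 A) = dual4 (adjoint_matrix A)"
proof -
  have "transpose J4 = - J4" by (rule skew_J4)
  then have "adjoint_matrix J4 = - J4"
    by (simp add: adjoint_matrix_def J4_def mat4_simps)
  moreover have "adjoint_matrix (- B) = - adjoint_matrix B" for B :: "complex^4^4"
    by (simp add: adjoint_matrix_def vec_eq_iff transpose_def)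
  moreover have "adjoint_matrix (map_matrix cnj A) = map_matrix cnj (adjoint_matrix A)"
    by (simp add: adjoint_matrix_def vec_eq_iff transpose_def)
  ultimately show ?thesis
    by (simp add: dual4_def adjoint_matrix_mult matrix_minus_mult matrix_mul_assoc)
qed

lemma unitary_dual4: "unitary A \<Longrightarrow> unitary (dual4 A)"
  by (simp add: adjoint_dual4 dual4_one flip: dual4_mult)

lemma det_minus4: "det (- B) = det (B :: complex^4^4)"
  by (simp add: det_4 algebra_simps)

lemma det_dual4: "det (dual4 A) = cnj (det A)"
proof -
  have "det (map_matrix cnj A) = cnj (det A)"
    by (simp add: det_4)
  then show ?thesis
    by (simp add: dual4_def det_mul det_J4 det_minus4)
qed

lemma dual4_transpose: "unitary A \<Longrightarrow> transpose A ** J4 ** dual4 A = J4"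
proof -
  assume "unitary A"
  have "transpose A ** J4 ** dual4 A = transpose A ** map_matrix cnj A ** J4"
    by (simp add: dual4_def matrix_minus_mult matrix_mul_assoc J4_J4_mult)
  then show ?thesis
    by (simp add: unitary_transpose_cnj[OF \<open>unitary A\<close>])
qed

section \<open>The congruences by block-diagonal matrices and the exchange of the blocks\<close>

fun actb :: "complex^4^4 \<Rightarrow> complex^4^4 \<Rightarrow> blocks \<Rightarrow> blocks" where
  "actb A B (X, M, Y) = (A ** X ** transpose A, A ** M ** transpose B, B ** Y ** transpose B)"

text \<open>Congruence by the permutation that exchanges the two halves of C^8; the sign comes from
  the lower left block -M^T of \<open>emb\<close>.\<close>

fun swapb :: "blocks \<Rightarrow> blocks" where
  "swapb (X, M, Y) = (Y, - transpose M, X)"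

lemma transpose_blk: "transpose (blk A B C D) = blk (transpose A) (transpose C) (transpose B) (transpose D)"
  by (simp add: vec_eq_iff blk_def transpose_def split: sum.splits)

lemma congruence_by_actb: "congruence_by (actb A B) (blk A 0 0 B)"
  unfolding congruence_by_def
proof
  fix x
  show "emb (actb A B x) = blk A 0 0 B ** emb x ** transpose (blk A 0 0 B)"
    by (cases x) (simp add: transpose_blk blk_mult matrix_transpose_mul matrix_mul_assoc matrix_minus_mult
        transpose_mat transpose_def[of 0] flip: zero_vec_def)
qed

lemma congruence_by_swapb: "congruence_by swapb (blk 0 (mat 1) (mat 1) 0)"
  unfolding congruence_by_def
proof
  fix x
  show "emb (swapb x) = blk 0 (mat 1) (mat 1) 0 ** emb x ** transpose (blk 0 (mat 1) (mat 1) 0)"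
    by (cases x) (simp add: transpose_blk blk_mult transpose_mat transpose_minus
        transpose_def[of 0] flip: zero_vec_def)
qed

lemma bskew_actb: "bskew x \<Longrightarrow> bskew (actb A B x)"
  by (cases x) (simp add: matrix_transpose_mul matrix_mul_assoc matrix_minus_mult)

lemma bskew_swapb: "bskew x \<Longrightarrow> bskew (swapb x)"
  by (cases x) simp

text \<open>The trace of \<open>Z ** star4 Z\<close> is -4 times the Pfaffian, so the law for the
  Hodge dual implies the one for the Pfaffian.\<close>

lemma pf4_congruence:
  assumes "skew X"
  shows "pf4 (P ** X ** transpose P) = det P * pf4 X"
proof -
  have pf4: "trace (Z ** star4 Z) = - 4 * pf4 Z" if "skew Z" for Z
    by (simp add: star4_mult[OF that] trace_mat)
  have "skew (P ** X ** transpose P)"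
    using assms by (simp add: matrix_transpose_mul matrix_mul_assoc matrix_minus_mult)
  then have "- 4 * pf4 (P ** X ** transpose P)
      = trace (P ** (X ** transpose P ** star4 (P ** X ** transpose P)))"
    by (simp only: matrix_mul_assoc flip: pf4)
  also have "\<dots> = trace (X ** (transpose P ** star4 (P ** X ** transpose P) ** P))"
    by (subst trace_mul_sym) (simp only: matrix_mul_assoc)
  also have "\<dots> = det P * (- 4 * pf4 X)"
    by (simp add: star4_congruence[OF assms] mscale_mult trace_mscale pf4[OF assms])
  finally show ?thesis
    by simp
qed

text \<open>Each of the three summands of \<open>pf8\<close> is multiplied by
  \<open>det A * det B\<close>.\<close>

lemma pf8_actb:
  assumes "bskew x" "det A * det B = 1"
  shows "pf8 (actb A B x) = pf8 x"
proof (cases x)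
  case (fields X M Y)
  with assms have X: "skew X" and Y: "skew Y"
    by simp_all
  define U V where "U = transpose A ** star4 (A ** X ** transpose A) ** A"
    and "V = transpose B ** star4 (B ** Y ** transpose B) ** B"
  have "star4 (A ** X ** transpose A) ** (A ** M ** transpose B) ** star4 (B ** Y ** transpose B) **
      transpose (A ** M ** transpose B) = (star4 (A ** X ** transpose A) ** A ** M ** V ** transpose M) ** transpose A"
    by (simp add: V_def matrix_transpose_mul matrix_mul_assoc)
  also have "trace \<dots> = trace (U ** M ** V ** transpose M)"
    by (subst trace_mul_sym) (simp add: U_def matrix_mul_assoc)
  also have "\<dots> = det A * det B * trace (star4 X ** M ** star4 Y ** transpose M)"
    unfolding U_def V_def star4_congruence[OF X] star4_congruence[OF Y]
    by (simp add: mscale_mult mscale_mscale trace_mscale mult.commute)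
  finally have "trace (star4 (A ** X ** transpose A) ** (A ** M ** transpose B) ** star4 (B ** Y ** transpose B) **
      transpose (A ** M ** transpose B)) = trace (star4 X ** M ** star4 Y ** transpose M)"
    by (simp add: assms)
  moreover have "pf4 (A ** X ** transpose A) * pf4 (B ** Y ** transpose B) = (det A * det B) * (pf4 X * pf4 Y)"
    by (simp add: pf4_congruence X Y)
  moreover have "det (A ** M ** transpose B) = (det A * det B) * det M"
    by (simp add: det_mul)
  ultimately show ?thesis
    by (simp add: fields assms)
qed

lemma pf8_swapb: "pf8 (swapb x) = pf8 x"
proof (cases x)
  case (fields X M Y)
  have "trace (star4 Y ** - transpose M ** star4 X ** - M) = trace ((star4 Y ** transpose M) ** (star4 X ** M))"
    by (simp add: matrix_minus_mult matrix_mul_assoc)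
  also have "\<dots> = trace (star4 X ** M ** star4 Y ** transpose M)"
    by (subst trace_mul_sym) (simp add: matrix_mul_assoc)
  finally have "trace (star4 Y ** - transpose M ** star4 X ** - M) = trace (star4 X ** M ** star4 Y ** transpose M)" .
  then show ?thesis
    by (simp add: fields transpose_minus mult.commute det_minus4)
qed

lemma bherm_actb: "unitary A \<Longrightarrow> unitary B \<Longrightarrow> bherm (actb A B x) (actb A B y) = bherm x y"
  by (cases x; cases y) (simp add: frob_unitary)

lemma bherm_swapb: "bherm (swapb x) (swapb y) = bherm x y"
proof -
  have "frob (- transpose M) (- transpose N) = frob M N" for M N :: "complex^4^4"
    unfolding frob_def transpose_def by (subst sum.swap) simp
  then show ?thesis
    by (cases x; cases y) simp
qed

text \<open>The group S(U(4) x U(4)).\<close>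

definition admissible :: "complex^4^4 \<Rightarrow> complex^4^4 \<Rightarrow> bool" where
  "admissible A B \<longleftrightarrow> unitary A \<and> unitary B \<and> det A * det B = 1"

lemma block_pair_act:
  assumes "admissible A B"
  shows "block_pair (actb A B) (actb (dual4 A) (dual4 B)) (blk A 0 0 B) (blk (dual4 A) 0 0 (dual4 B))"
proof
  have A: "unitary A" and B: "unitary B" and det: "det A * det B = 1"
    using assms by (simp_all add: admissible_def)
  then show "transpose (blk A 0 0 B) ** Om ** blk (dual4 A) 0 0 (dual4 B) = Om"
    by (simp add: Om_def transpose_blk blk_mult dual4_transpose transpose_def[of 0] flip: zero_vec_def)
  have "det (dual4 A) * det (dual4 B) = 1"
    using det by (metis det_dual4 complex_cnj_mult complex_cnj_one)
  then show "pf8 (actb (dual4 A) (dual4 B) x) = pf8 x" if "bskew x" for x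
    by (rule pf8_actb[OF that])
  show "pf8 (actb A B x) = pf8 x" if "bskew x" for x
    by (rule pf8_actb[OF that det])
  show "bherm (actb A B x) (actb A B y) = bherm x y"
    "bherm (actb (dual4 A) (dual4 B) x) (actb (dual4 A) (dual4 B) y) = bherm x y" for x y
    using A B by (simp_all only: bherm_actb unitary_dual4)
qed (simp_all only: congruence_by_actb bskew_actb)

lemma block_pair_swap:
  "block_pair swapb swapb (blk 0 (mat 1) (mat 1) 0) (blk 0 (mat 1) (mat 1) 0)"
proof
  show "transpose (blk 0 (mat 1) (mat 1) 0) ** Om ** blk 0 (mat 1) (mat 1) 0 = Om"
    by (simp add: Om_def transpose_blk blk_mult transpose_mat transpose_def[of 0] flip: zero_vec_def)
qed (simp_all only: congruence_by_swapb bskew_swapb pf8_swapb bherm_swapb)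

definition uact :: "complex^4^4 \<Rightarrow> complex^4^4 \<Rightarrow> freud \<Rightarrow> freud" where
  "uact A B = block_op (actb A B) (actb (dual4 A) (dual4 B))"

definition uswap :: "freud \<Rightarrow> freud" where
  "uswap = block_op swapb swapb"

lemma chi_uact:
  assumes "admissible A B"
  shows "chi1 (uact A B P) = actb A B (chi1 P)" "chi2 (uact A B P) = actb (dual4 A) (dual4 B) (chi2 P)"
  using block_pair.chi_op[OF block_pair_act[OF assms]] by (simp_all only: uact_def)

lemma chi_uswap: "chi1 (uswap P) = swapb (chi1 P)" "chi2 (uswap P) = swapb (chi2 P)"
  using block_pair.chi_op[OF block_pair_swap] by (simp_all only: uswap_def)

lemma actb_actb: "actb A B (actb A' B' x) = actb (A ** A') (B ** B') x"
  by (cases x) (simp add: matrix_transpose_mul matrix_mul_assoc)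

lemma actb_one: "actb (mat 1) (mat 1) x = x"
  by (cases x) (simp add: transpose_mat)

lemma swapb_swapb: "swapb (swapb x) = x"
  by (cases x) (simp add: transpose_minus)

lemma swapb_actb: "swapb (actb A B x) = actb B A (swapb x)"
  by (cases x) (simp add: matrix_transpose_mul matrix_mul_assoc matrix_minus_mult)

lemma admissible_mult: "admissible A B \<Longrightarrow> admissible A' B' \<Longrightarrow> admissible (A ** A') (B ** B')"
  unfolding admissible_def by (simp add: unitary_mult det_mul) (metis mult.assoc mult.left_commute mult_1)

lemma admissible_one: "admissible (mat 1) (mat 1)"
  by (simp add: admissible_def adjoint_matrix_one)

lemma admissible_swap: "admissible A B \<Longrightarrow> admissible B A"
  by (simp add: admissible_def mult.commute)

lemma admissible_adjoint: "admissible A B \<Longrightarrow> admissible (adjoint_matrix A) (adjoint_matrix B)"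
  unfolding admissible_def by (metis unitary_adjoint det_adjoint_matrix complex_cnj_mult complex_cnj_one)

lemma uact_uact:
  "admissible A B \<Longrightarrow> admissible A' B' \<Longrightarrow> uact A B (uact A' B' P) = uact (A ** A') (B ** B') P"
  by (rule freud_eqI) (simp_all only: chi_uact admissible_mult actb_actb dual4_mult)

lemma uact_one: "uact (mat 1) (mat 1) P = P"
  by (rule freud_eqI) (simp_all only: chi_uact admissible_one dual4_one actb_one)

lemma uswap_uswap: "uswap (uswap P) = P"
  by (rule freud_eqI) (simp_all only: chi_uswap swapb_swapb)

lemma uswap_uact: "admissible A B \<Longrightarrow> uswap (uact A B P) = uact B A (uswap P)"
  by (rule freud_eqI) (simp_all only: chi_uswap chi_uact admissible_swap swapb_actb)

lemma uact_adjoint: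
  assumes "admissible A B"
  shows "uact (adjoint_matrix A) (adjoint_matrix B) (uact A B P) = P"
    "uact A B (uact (adjoint_matrix A) (adjoint_matrix B) P) = P"
proof -
  have A: "unitary A" and B: "unitary B"
    using assms by (simp_all only: admissible_def)
  show "uact (adjoint_matrix A) (adjoint_matrix B) (uact A B P) = P"
    unfolding uact_uact[OF admissible_adjoint[OF assms] assms] A B by (rule uact_one)
  show "uact A B (uact (adjoint_matrix A) (adjoint_matrix B) P) = P"
    unfolding uact_uact[OF assms admissible_adjoint[OF assms]] unitary_right[OF A] unitary_right[OF B]
    by (rule uact_one)
qed

lemma bij_uact: "admissible A B \<Longrightarrow> bij (uact A B)"
  by (rule o_bij[of "uact (adjoint_matrix A) (adjoint_matrix B)"])
    (rule ext, simp only: comp_apply id_apply uact_adjoint)+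

lemma bij_uswap: "bij uswap"
  by (rule o_bij[of uswap]) (rule ext, simp only: comp_apply id_apply uswap_uswap)+

lemma uact_in_E7: "admissible A B \<Longrightarrow> uact A B \<in> E7"
  using block_pair.op_in_E7[OF block_pair_act] bij_uact unfolding uact_def by blast

lemma uswap_in_E7: "uswap \<in> E7"
  using block_pair.op_in_E7[OF block_pair_swap] bij_uswap unfolding uswap_def by blast

section \<open>Unitary maps preserving the determinant\<close>

definition outer :: "complex^4 \<Rightarrow> complex^4 \<Rightarrow> complex^4^4" where
  "outer u v = (\<chi> i j. u $ i * v $ j)"

definition parallel :: "complex^4 \<Rightarrow> complex^4 \<Rightarrow> bool" where
  "parallel u v \<longleftrightarrow> (\<forall>i j. u $ i * v $ j = u $ j * v $ i)"

definition minors_vanish :: "complex^4^4 \<Rightarrow> bool" where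
  "minors_vanish N \<longleftrightarrow> (\<forall>i j k l. N $ i $ k * N $ j $ l = N $ i $ l * N $ j $ k)"

lemma outer_nth [simp]: "outer u v $ i $ j = u $ i * v $ j"
  by (simp add: outer_def)

lemma minors_vanishE:
  assumes "minors_vanish N"
  obtains u v where "N = outer u v"
proof (cases "N = 0")
  case True
  then have "N = outer 0 0"
    by (simp add: vec_eq_iff)
  then show thesis by (rule that)
next
  case False
  then obtain i j where "N $ i $ j \<noteq> 0"
    by (auto simp: vec_eq_iff)
  moreover have "N $ i $ j * N $ k $ l = N $ k $ j * N $ i $ l" for k l
    using assms by (simp add: minors_vanish_def mult.commute)
  ultimately have "N = outer (\<chi> k. N $ k $ j / N $ i $ j) (\<chi> l. N $ i $ l)"
    by (simp add: vec_eq_iff nonzero_eq_divide_eq mult.commute)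
  then show thesis by (rule that)
qed

text \<open>A description of the matrices of rank at most one by the determinant alone.\<close>

definition det_flat :: "complex^4^4 \<Rightarrow> bool" where
  "det_flat N \<longleftrightarrow> (\<forall>M. det (M + N) + det (M - N) = 2 * det M)"

text \<open>Along a direction of rank one the determinant is an affine function.\<close>

lemma det_flat_outer: "det_flat (outer u v)"
  unfolding det_flat_def by (simp add: det_4 algebra_simps)

lemma det_flat_minor:
  assumes "det_flat N"
  shows "N $ 1 $ 1 * N $ 2 $ 2 = N $ 1 $ 2 * N $ 2 $ 1"
proof -
  \<comment> \<open>The part of \<open>det (M + N)\<close> that is quadratic in N is the upper left
    minor of N for this M. The quartic part \<open>det N\<close> is removed by also testing at the
    zero matrix.\<close>
  define M :: "complex^4^4" where "M = vector [0, 0, vector [0, 0, 1, 0], vector [0, 0, 0, 1]]"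
  have "det (M + N) + det (M - N) = 2 * det M" "det (0 + N) + det (0 - N) = 2 * det (0 :: complex^4^4)"
    using assms unfolding det_flat_def by blast+
  moreover have "det (M + N) + det (M - N) - 2 * det M - (det (0 + N) + det (0 - N))
      = 2 * (N $ 1 $ 1 * N $ 2 $ 2 - N $ 1 $ 2 * N $ 2 $ 1)"
    by (simp add: det_4 M_def algebra_simps)
  ultimately have "2 * (N $ 1 $ 1 * N $ 2 $ 2 - N $ 1 $ 2 * N $ 2 $ 1) = 0"
    by (simp add: det_4)
  then show ?thesis
    by simp
qed

text \<open>Permuting rows and columns changes the determinant only by a sign; so every minor can be
  moved to the upper left corner.\<close>

lemma det_flat_permute:
  assumes N: "det_flat N" and p: "p permutes UNIV" and q: "q permutes UNIV"
  shows "det_flat (\<chi> i j. N $ p i $ q j)"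
proof -
  have perm: "det (\<chi> i j. A $ p i $ q j) = of_int (sign p) * (of_int (sign q) * det A)"
    for A :: "complex^4^4"
  proof -
    have "det (\<chi> i. (\<chi> i j. A $ i $ q j) $ p i) = of_int (sign p) * det (\<chi> i j. A $ i $ q j)"
      by (rule det_permute_rows[OF p])
    then show ?thesis
      using det_permute_columns[OF q, of A] by simp
  qed
  show ?thesis
    unfolding det_flat_def
  proof
    fix M :: "complex^4^4"
    define M' where "M' = (\<chi> i j. M $ inv_into UNIV p i $ inv_into UNIV q j)"
    have M: "M = (\<chi> i j. M' $ p i $ q j)"
      by (simp add: M'_def vec_eq_iff permutes_inverses[OF p] permutes_inverses[OF q])
    have "M + (\<chi> i j. N $ p i $ q j) = (\<chi> i j. (M' + N) $ p i $ q j)"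
      "M - (\<chi> i j. N $ p i $ q j) = (\<chi> i j. (M' - N) $ p i $ q j)"
      by (simp_all add: M vec_eq_iff)
    then have "det (M + (\<chi> i j. N $ p i $ q j)) + det (M - (\<chi> i j. N $ p i $ q j))
        = of_int (sign p) * (of_int (sign q) * (det (M' + N) + det (M' - N)))"
      by (simp only: perm distrib_left)
    also have "\<dots> = 2 * det M"
      using N by (simp add: det_flat_def M perm)
    finally show "det (M + (\<chi> i j. N $ p i $ q j)) + det (M - (\<chi> i j. N $ p i $ q j)) = 2 * det M" .
  qed
qed

lemma permutation_12:
  assumes "i \<noteq> j"
  obtains p :: "4 \<Rightarrow> 4" where "p permutes UNIV" "p 1 = i" "p 2 = j"
proof -
  \<comment> \<open>The preimage of j under the exchange of 1 and i; sending 2 to k first therefore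
    sends it to j in the end.\<close>
  define k where "k = Transposition.transpose 1 i j"
  have k: "k \<noteq> 1"
    using assms by (auto simp: k_def Transposition.transpose_def split: if_splits)
  show thesis
  proof (rule that)
    show "Transposition.transpose 1 i \<circ> Transposition.transpose 2 k permutes UNIV"
      by (intro permutes_compose permutes_swap_id) auto
    show "(Transposition.transpose 1 i \<circ> Transposition.transpose 2 k) 1 = i"
      using k by (simp add: Transposition.transpose_def)
    show "(Transposition.transpose 1 i \<circ> Transposition.transpose 2 k) 2 = j"
      by (simp add: k_def)
  qed
qed

lemma det_flat_iff: "det_flat N \<longleftrightarrow> minors_vanish N"
proof
  assume N: "det_flat N"
  show "minors_vanish N"
    unfolding minors_vanish_def
  proof (intro allI)
    fix i j k l
    show "N $ i $ k * N $ j $ l = N $ i $ l * N $ j $ k"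
    proof (cases "i = j \<or> k = l")
      case False
      then obtain p q where p: "p permutes UNIV" "p 1 = i" "p 2 = j"
        and q: "q permutes UNIV" "q 1 = k" "q 2 = l"
        by (metis permutation_12)
      show ?thesis
        using det_flat_minor[OF det_flat_permute[OF N p(1) q(1)]] p q by simp
    qed (auto simp: mult.commute)
  qed
next
  assume "minors_vanish N"
  then obtain u v where "N = outer u v"
    by (rule minors_vanishE)
  then show "det_flat N"
    by (simp add: det_flat_outer)
qed

lemma parallelE:
  assumes "parallel u v" "u \<noteq> 0"
  obtains c where "v = c *s u"
proof -
  obtain i where i: "u $ i \<noteq> 0"
    using assms(2) by (auto simp: vec_eq_iff)
  have "v = (v $ i / u $ i) *s u"
    using assms(1) i by (simp add: vec_eq_iff parallel_def nonzero_eq_divide_eq mult.commute)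
  then show thesis by (rule that)
qed

text \<open>A 2 x 2 minor of the sum is a minor of the pair (a, c) times a minor of the pair (b,
  d).\<close>

lemma minors_vanish_add_outer:
  assumes "minors_vanish (outer a b + outer c d)"
  shows "parallel a c \<or> parallel b d"
proof (rule ccontr)
  assume "\<not> (parallel a c \<or> parallel b d)"
  then obtain i k j l where nz: "a $ i * c $ k - a $ k * c $ i \<noteq> 0" "b $ j * d $ l - b $ l * d $ j \<noteq> 0"
    by (auto simp: parallel_def)
  have "(outer a b + outer c d) $ i $ j * (outer a b + outer c d) $ k $ l
      = (outer a b + outer c d) $ i $ l * (outer a b + outer c d) $ k $ j"
    using assms unfolding minors_vanish_def by blast
  then have "(a $ i * c $ k - a $ k * c $ i) * (b $ j * d $ l - b $ l * d $ j) = 0"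
    by (simp add: algebra_simps)
  with nz show False
    by simp
qed

text \<open>An abelian group is not the union of two proper subgroups.\<close>

lemma union_of_subspaces:
  fixes P Q :: "'a::ab_group_add \<Rightarrow> bool"
  assumes P: "\<And>v w. P v \<Longrightarrow> P w \<Longrightarrow> P (v - w)" and Q: "\<And>v w. Q v \<Longrightarrow> Q w \<Longrightarrow> Q (v - w)"
    and "\<And>v. P v \<or> Q v"
  shows "(\<forall>v. P v) \<or> (\<forall>v. Q v)"
proof (rule ccontr)
  assume "\<not> ((\<forall>v. P v) \<or> (\<forall>v. Q v))"
  then obtain v w where v: "\<not> P v" and w: "\<not> Q w"
    by blast
  then have "Q v" "P w"
    using assms(3) by blast+
  have "\<not> P (v + w)"
    using P[of "v + w" w] \<open>P w\<close> v by auto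
  moreover have "\<not> Q (v + w)"
    using Q[of "v + w" v] \<open>Q v\<close> w by auto
  ultimately show False
    using assms(3) by blast
qed

lemma outer_simps: "outer (a + a') b = outer a b + outer a' b" "outer a (b + b') = outer a b + outer a b'"
  "outer (a - a') b = outer a b - outer a' b" "outer a (b - b') = outer a b - outer a b'"
  "outer (c *s a) b = mscale c (outer a b)" "outer a (c *s b) = mscale c (outer a b)"
  by (simp_all add: vec_eq_iff algebra_simps)

text \<open>One nonzero value \<open>outer a b\<close> is compared with all others: each shares the
  factor a or the factor b with it. The two alternatives define subgroups, so one of them holds
  throughout.\<close>

lemma minors_vanish_space:
  fixes f :: "complex^4 \<Rightarrow> complex^4^4"
  assumes add: "\<And>v w. f (v + w) = f v + f w" and f: "\<And>v. minors_vanish (f v)"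
  shows "(\<exists>a. \<forall>v. \<exists>w. f v = outer a w) \<or> (\<exists>b. \<forall>v. \<exists>w. f v = outer w b)"
proof (cases "\<exists>v. f v \<noteq> 0")
  case False
  then have "f v = outer 0 0" for v
    by (simp add: vec_eq_iff)
  then show ?thesis
    by blast
next
  case True
  then obtain v0 a b where v0: "f v0 = outer a b" "f v0 \<noteq> 0"
    using f by (metis minors_vanishE)
  then have nz: "a \<noteq> 0" "b \<noteq> 0"
    by (auto simp: vec_eq_iff)
  have diff: "f (v - w) = f v - f w" for v w
    using add[of "v - w" w] by simp
  have "(\<forall>v. \<exists>w. f v = outer a w) \<or> (\<forall>v. \<exists>w. f v = outer w b)"
  proof (rule union_of_subspaces)
    fix v
    obtain c d where v: "f v = outer c d"
      using f by (metis minors_vanishE)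
    have "parallel a c \<or> parallel b d"
      using f[of "v0 + v"] by (intro minors_vanish_add_outer) (simp add: add v v0)
    then show "(\<exists>w. f v = outer a w) \<or> (\<exists>w. f v = outer w b)"
      using nz v by (metis parallelE outer_simps(5,6))
  qed (metis diff outer_simps(3,4))+
  then show ?thesis
    by blast
qed

section \<open>Hermitian geometry of C^4\<close>

definition cinner :: "complex^4 \<Rightarrow> complex^4 \<Rightarrow> complex" where
  "cinner u v = (\<Sum>i\<in>UNIV. cnj (u $ i) * v $ i)"

lemma frob_outer: "frob (outer a b) (outer c d) = cinner a c * cinner b d"
  by (simp add: frob_def cinner_def sum_product algebra_simps)

lemma cinner_scale: "cinner (c *s u) v = cnj c * cinner u v" "cinner u (c *s v) = c * cinner u v"
  by (simp_all add: cinner_def sum_distrib_left algebra_simps)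

lemma cinner_self: "cinner u u = of_real ((norm u)\<^sup>2)"
proof -
  have "cinner u u = of_real (\<Sum>i\<in>UNIV. (norm (u $ i))\<^sup>2)"
    unfolding of_real_sum complex_norm_square cinner_def by (simp add: mult.commute)
  then show ?thesis
    by (simp add: norm_vec_def L2_set_def sum_nonneg)
qed

lemma cinner_axis: "cinner (axis i 1) v = v $ i" "cinner v (axis i 1) = cnj (v $ i)"
  by (simp_all add: cinner_def axis_def if_distrib[of cnj] if_distrib[of "\<lambda>x. x * _"]
      if_distrib[of "\<lambda>x. _ * x"] cong: if_cong)

lemma cinner_axis_axis: "cinner (axis i 1) (axis j 1) = (if i = j then 1 else 0)"
  unfolding cinner_axis by (simp add: axis_def)

lemma cinner_zero: "cinner 0 v = 0" "cinner v 0 = 0"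
  by (simp_all add: cinner_def)

lemma cinner_matrix: "cinner (A *v u) (A *v v) = cinner u ((adjoint_matrix A ** A) *v v)"
proof -
  have "cinner (A *v u) w = cinner u (adjoint_matrix A *v w)" for w
    unfolding cinner_def matrix_vector_mult_def adjoint_matrix_def transpose_def
    by (simp add: sum_distrib_left sum_distrib_right, subst sum.swap) (simp add: mult_ac)
  then show ?thesis
    by (simp add: matrix_vector_mul_assoc)
qed

lemma unitaryI:
  assumes "\<And>u v. cinner (A *v u) (A *v v) = cinner u v"
  shows "unitary A"
proof -
  have "(adjoint_matrix A ** A) *v v = v" for v
    using assms[of "axis _ 1" v] unfolding cinner_matrix cinner_axis by (simp add: vec_eq_iff)
  then show ?thesis
    by (simp add: matrix_eq)
qed


lemma surj_unitary: "unitary A \<Longrightarrow> A *v (adjoint_matrix A *v v) = v"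
  by (simp add: matrix_vector_mul_assoc unitary_right)

lemma matrix_eq_outer_sum: "M = (\<Sum>i\<in>UNIV. outer (axis i 1) (M $ i))" for M :: "complex^4^4"
  by (simp add: vec_eq_iff axis_def if_distrib[of "\<lambda>x. x * _"] cong: if_cong)

lemma parallel_matrix:
  assumes "parallel u v"
  shows "parallel (B *v u) (B *v v)"
proof -
  have "(B *v u) $ i * (B *v v) $ j = (B *v u) $ j * (B *v v) $ i" for i j
  proof -
    have "(B *v u) $ i * (B *v v) $ j = (\<Sum>p\<in>UNIV. \<Sum>q\<in>UNIV. B $ i $ p * B $ j $ q * (u $ p * v $ q))"
      by (simp add: matrix_vector_mult_def sum_product mult_ac)
    also have "\<dots> = (\<Sum>p\<in>UNIV. \<Sum>q\<in>UNIV. B $ i $ p * B $ j $ q * (u $ q * v $ p))"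
      using assms by (simp add: parallel_def)
    also have "\<dots> = (B *v u) $ j * (B *v v) $ i"
      unfolding matrix_vector_mult_def vec_lambda_beta sum_product
      by (subst sum.swap) (simp add: mult_ac)
    finally show ?thesis .
  qed
  then show ?thesis
    by (simp add: parallel_def)
qed

text \<open>Axis vectors show that R is diagonal, and sums of two axis vectors that its diagonal
  entries agree.\<close>

lemma parallel_everywhere:
  assumes "\<And>v. parallel v (R *v v)"
  obtains c where "R = mat c"
proof -
  have axis: "(R *v axis p 1) $ i = R $ i $ p" for p i
    by (simp add: matrix_vector_mult_def axis_def if_distrib cong: if_cong)
  have off: "R $ i $ p = 0" if "i \<noteq> p" for i p
  proof -
    have "(axis p 1 :: complex^4) $ p * R $ i $ p = (axis p 1 :: complex^4) $ i * R $ p $ p"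
      using assms[of "axis p 1"] unfolding parallel_def axis by blast
    then show ?thesis
      using that by (simp add: axis_def)
  qed
  have diag: "R $ p $ p = R $ 1 $ 1" if "p \<noteq> 1" for p
  proof -
    have "(axis p 1 + axis 1 1 :: complex^4) $ 1 * (R *v (axis p 1 + axis 1 1)) $ p
        = (axis p 1 + axis 1 1 :: complex^4) $ p * (R *v (axis p 1 + axis 1 1)) $ 1"
      using assms[of "axis p 1 + axis 1 1"] unfolding parallel_def by blast
    then show ?thesis
      using that off[of p 1] off[of 1 p]
      unfolding matrix_vector_right_distrib vector_add_component axis by (simp add: axis_def)
  qed
  then have "R $ p $ p = R $ 1 $ 1" for p
    by (cases "p = 1") auto
  then have "R = mat (R $ 1 $ 1)"
    using off by (simp add: vec_eq_iff mat_def)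
  then show thesis by (rule that)
qed

section \<open>The argument of Frobenius and Dieudonne\<close>

locale det_isometry =
  fixes L :: "complex^4^4 \<Rightarrow> complex^4^4"
  assumes add: "L (M + N) = L M + L N" and scale: "L (mscale c M) = mscale c (L M)"
    and surj: "\<exists>M. L M = N"
    and det: "det (L M) = det M" and frob: "frob (L M) (L N) = frob M N"
begin

lemma diff: "L (M - N) = L M - L N"
  using add[of "M - N" N] by simp

lemma zero: "L 0 = 0"
  using diff[of 0 0] by simp

lemma sum: "L (\<Sum>i\<in>A. f i) = (\<Sum>i\<in>A. L (f i))"
  by (induction A rule: infinite_finite_induct) (simp_all add: zero add)

text \<open>Being surjective, L reaches every matrix M against which \<open>det_flat\<close> has to
  be tested.\<close>

lemma minors_vanish_L: "minors_vanish (L (outer u v))"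
  unfolding det_flat_iff[symmetric] det_flat_def
proof
  fix M
  obtain M' where M: "M = L M'"
    using surj by metis
  have "det (M' + outer u v) + det (M' - outer u v) = 2 * det M'"
    using det_flat_outer by (simp add: det_flat_def)
  then show "det (M + L (outer u v)) + det (M - L (outer u v)) = 2 * det M"
    by (simp add: M det flip: add diff)
qed

text \<open>The matrices supported in row i have rank at most one, so by
  \<open>minors_vanish_space\<close> their images share a left or a right factor. With this factor
  normalized to length one, the other factor depends isometrically on v.\<close>

lemma row_cases:
  obtains (left) a U where "cinner a a = 1" "unitary U" "\<And>v. L (outer (axis i 1) v) = outer a (U *v v)"
  | (right) b U where "cinner b b = 1" "unitary U" "\<And>v. L (outer (axis i 1) v) = outer (U *v v) b"
proof -
  define f where "f v = L (outer (axis i 1) v)" for v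
  have f_sum: "f v = (\<Sum>p\<in>UNIV. mscale (v $ p) (f (axis p 1)))" for v
  proof -
    have "outer (axis i 1) v = (\<Sum>p\<in>UNIV. mscale (v $ p) (outer (axis i 1) (axis p 1)))"
      by (simp add: vec_eq_iff axis_def if_distrib[of "\<lambda>x. _ * x"] cong: if_cong)
    then show ?thesis
      by (simp add: f_def sum scale)
  qed
  have f_inner: "frob (f v) (f w) = cinner v w" for v w
    by (simp add: f_def frob frob_outer cinner_axis_axis)
  have normalize: "\<exists>a' s. cinner a' a' = 1 \<and> a = s *s a'" if "a \<noteq> 0" for a :: "complex^4"
  proof -
    have "cinner ((1 / of_real (norm a)) *s a) ((1 / of_real (norm a)) *s a) = 1"
      unfolding cinner_scale unfolding cinner_self using that by (simp add: power2_eq_square)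
    moreover have "a = of_real (norm a) *s ((1 / of_real (norm a)) *s a)"
      using that by (simp add: vec_eq_iff)
    ultimately show ?thesis
      by blast
  qed
  have nonzero: "f (axis 1 1) \<noteq> 0"
    using f_inner[of "axis 1 1" "axis 1 1"] by (auto simp: cinner_axis_axis frob_def)
  have "(\<exists>a. \<forall>v. \<exists>w. f v = outer a w) \<or> (\<exists>b. \<forall>v. \<exists>w. f v = outer w b)"
    by (rule minors_vanish_space) (simp_all add: f_def outer_simps add minors_vanish_L)
  then show thesis
  proof
    assume "\<exists>a. \<forall>v. \<exists>w. f v = outer a w"
    then obtain a w where w: "\<And>v. f v = outer a (w v)"
      by metis
    with nonzero have "a \<noteq> 0"
      by (auto simp: vec_eq_iff)
    then obtain a' s where a': "cinner a' a' = 1" "a = s *s a'"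
      using normalize by blast
    define U where "U = (\<chi> j p. s * w (axis p 1) $ j)"
    have fU: "f v = outer a' (U *v v)" for v
      by (subst f_sum) (simp add: w a'(2) vec_eq_iff U_def matrix_vector_mult_def sum_distrib_left mult_ac)
    have "unitary U"
      using f_inner by (intro unitaryI) (simp add: fU frob_outer a')
    with a'(1) fU show thesis
      by (intro left[of a' U]) (simp_all add: f_def)
  next
    assume "\<exists>b. \<forall>v. \<exists>w. f v = outer w b"
    then obtain b w where w: "\<And>v. f v = outer (w v) b"
      by metis
    with nonzero have "b \<noteq> 0"
      by (auto simp: vec_eq_iff)
    then obtain b' s where b': "cinner b' b' = 1" "b = s *s b'"
      using normalize by blast
    define U where "U = (\<chi> j p. s * w (axis p 1) $ j)"
    have fU: "f v = outer (U *v v) b'" for v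
      by (subst f_sum) (simp add: w b'(2) vec_eq_iff U_def matrix_vector_mult_def sum_distrib_left sum_distrib_right mult_ac)
    have "unitary U"
      using f_inner by (intro unitaryI) (simp add: fU frob_outer b')
    with b'(1) fU show thesis
      by (intro right[of b' U]) (simp_all add: f_def)
  qed
qed

lemma inner_rows: "frob (L (outer (axis i 1) v)) (L (outer (axis j 1) w)) = (if i = j then cinner v w else 0)"
  by (simp add: frob frob_outer cinner_axis_axis)

text \<open>Different rows have orthogonal images. If row i were of the other type, the preimages
  under W and U could be chosen so that both images are \<open>outer a b\<close>, which is not
  orthogonal to itself.\<close>

lemma rows_left:
  assumes "cinner a a = 1" "unitary U" "\<And>v. L (outer (axis 1 1) v) = outer a (U *v v)"
  shows "\<exists>a U. cinner a a = 1 \<and> unitary U \<and> (\<forall>v. L (outer (axis i 1) v) = outer a (U *v v))"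
proof (cases "i = 1")
  case True
  with assms show ?thesis
    by blast
next
  case False
  show ?thesis
  proof (cases i rule: row_cases)
    case (right b W)
    have "cinner a (W *v w) * cinner (U *v v) b = 0" for v w
      using inner_rows[of 1 v i w] False by (simp add: assms(3) right(3) frob_outer)
    from this[of "adjoint_matrix W *v a" "adjoint_matrix U *v b"]
    have False
      by (simp add: surj_unitary assms right)
    then show ?thesis ..
  qed blast
qed

text \<open>Orthogonality of the row images makes the vectors a i orthonormal. Applying L to
  \<open>outer (axis 1 1 + axis i 1) v\<close> gives a matrix of rank one, so U i v is parallel to U
  1 v for all v; hence U i is a multiple of U 1.\<close>

lemma left_form:
  assumes "cinner a0 a0 = 1" "unitary U0" "\<And>v. L (outer (axis 1 1) v) = outer a0 (U0 *v v)"
  shows "\<exists>P Q. unitary P \<and> unitary Q \<and> (\<forall>M. L M = P ** M ** transpose Q)"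
proof -
  obtain a U where a: "\<And>i. cinner (a i) (a i) = 1" and U: "\<And>i. unitary (U i)"
    and L: "\<And>i v. L (outer (axis i 1) v) = outer (a i) (U i *v v)"
    using rows_left[OF assms] by metis
  have orth: "cinner (a i) (a j) = 0" if "i \<noteq> j" for i j
  proof -
    have "cinner (a i) (a j) * cinner (U i *v v) (U j *v w) = 0" for v w
      using inner_rows[of i v j w] that by (simp add: L frob_outer)
    from this[of "adjoint_matrix (U i) *v a i" "adjoint_matrix (U j) *v a i"]
    show ?thesis
      by (simp add: surj_unitary U a)
  qed
  have "\<exists>c. \<forall>v. U i *v v = c *s (U 1 *v v)" for i
  proof (cases "i = 1")
    case True
    then show ?thesis
      by (intro exI[of _ 1]) simp
  next
    case False
    have par: "parallel (U 1 *v v) (U i *v v)" for v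
    proof -
      have "minors_vanish (outer (a 1) (U 1 *v v) + outer (a i) (U i *v v))"
        using minors_vanish_L[of "axis 1 1 + axis i 1" v] by (simp add: outer_simps add L)
      moreover have "\<not> parallel (a 1) (a i)"
      proof
        assume par: "parallel (a 1) (a i)"
        have "a 1 \<noteq> 0"
          using a[of 1] by (auto simp: cinner_zero)
        with par obtain c where "a i = c *s a 1"
          by (rule parallelE)
        then show False
          using orth[of 1 i] a[of 1] a[of i] False by (simp add: cinner_scale cinner_zero)
      qed
      ultimately show ?thesis
        using minors_vanish_add_outer by blast
    qed
    define R where "R = adjoint_matrix (U 1) ** U i"
    have "parallel v (R *v v)" for v
      using parallel_matrix[OF par, of "adjoint_matrix (U 1)" v]
      by (simp add: R_def matrix_vector_mul_assoc U)
    then obtain c where c: "R = mat c"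
      using parallel_everywhere by blast
    have "U i = U 1 ** R"
      by (simp add: R_def matrix_mul_assoc unitary_right U)
    then have "U i *v v = c *s (U 1 *v v)" for v
      unfolding c by (simp add: vec_eq_iff matrix_vector_mult_def mult_mat_nth sum_distrib_left mult_ac)
    then show ?thesis
      by blast
  qed
  then obtain c where c: "\<And>i v. U i *v v = c i *s (U 1 *v v)"
    by metis
  have Lc: "L (outer (axis i 1) v) = outer (a i) (c i *s (U 1 *v v))" for i v
    unfolding L by (subst c) (rule refl)
  \<comment> \<open>The columns of P are the vectors a i, with the factors c i absorbed.\<close>
  define P where "P = (\<chi> k i. c i * a i $ k)"
  have LM: "L M = P ** M ** transpose (U 1)" for M
  proof -
    have "L M = (\<Sum>i\<in>UNIV. outer (a i) (c i *s (U 1 *v M $ i)))"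
      using arg_cong[OF matrix_eq_outer_sum[of M], of L] by (simp only: sum Lc)
    then show ?thesis
      by (simp add: vec_eq_iff matrix_matrix_mult_def matrix_vector_mult_def transpose_def P_def
          sum_4 algebra_simps)
  qed
  have "unitary P"
  proof (rule unitaryI)
    fix u v
    have *: "P ** outer x w ** transpose (U 1) = outer (P *v x) (U 1 *v w)" for x w
      by (simp add: vec_eq_iff matrix_matrix_mult_def matrix_vector_mult_def transpose_def sum_4 algebra_simps)
    \<comment> \<open>On the matrices \<open>outer x e\<close>, with the unit vector e taken to an
      axis by U 1, the Frobenius product reduces to the inner product of the vectors P x.\<close>
    define e where "e = adjoint_matrix (U 1) *v axis 1 1"
    have e: "U 1 *v e = axis 1 1"
      by (simp add: e_def surj_unitary U)
    have ee: "cinner e e = 1"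
      using cinner_matrix[of "U 1" e e] U[of 1] by (simp add: e cinner_axis_axis)
    have "cinner (P *v u) (P *v v) = frob (L (outer u e)) (L (outer v e))"
      by (simp add: LM * e frob_outer cinner_axis_axis)
    then show "cinner (P *v u) (P *v v) = cinner u v"
      by (simp add: frob frob_outer ee)
  qed
  with LM U show ?thesis
    by blast
qed

end

lemma det_transpose_isometry: "det_isometry L \<Longrightarrow> det_isometry (\<lambda>M. transpose (L M))"
proof -
  assume "det_isometry L"
  then interpret det_isometry L .
  have "frob (transpose M) (transpose N) = frob M N" for M N :: "complex^4^4"
    unfolding frob_def transpose_def by (subst sum.swap) simp
  moreover have "\<exists>M. transpose (L M) = N" for N
    using surj[of "transpose N"] by (metis transpose_transpose)
  ultimately show "det_isometry (\<lambda>M. transpose (L M))"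
    by unfold_locales (simp_all add: add scale transpose_add transpose_mscale det_transpose det frob)
qed

text \<open>The type of the first row decides. The second type becomes the first after composition
  with transposition, and the determinant condition results from M = 1.\<close>

proposition det_isometry_cases:
  assumes "det_isometry L"
  obtains P Q where "admissible P Q" "(\<forall>M. L M = P ** M ** transpose Q) \<or> (\<forall>M. L M = P ** transpose M ** transpose Q)"
proof -
  interpret det_isometry L
    by (rule assms)
  interpret T: det_isometry "\<lambda>M. transpose (L M)"
    by (rule det_transpose_isometry[OF assms])
  have "\<exists>P Q. unitary P \<and> unitary Q \<and>
      ((\<forall>M. L M = P ** M ** transpose Q) \<or> (\<forall>M. L M = P ** transpose M ** transpose Q))"
  proof (cases rule: row_cases[of 1])
    case (left a U)
    then show ?thesis
      using left_form by meson
  next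
    case (right b U)
    have "transpose (outer x y) = outer y x" for x y
      by (simp add: vec_eq_iff transpose_def mult.commute)
    then obtain P Q where PQ: "unitary P" "unitary Q" "\<And>M. transpose (L M) = P ** M ** transpose Q"
      using T.left_form[of b U] right by metis
    have "L M = Q ** transpose M ** transpose P" for M
      using arg_cong[OF PQ(3)[of M], of transpose] by (simp add: matrix_transpose_mul matrix_mul_assoc)
    with PQ show ?thesis
      by blast
  qed
  then obtain P Q where PQ: "unitary P" "unitary Q"
    "(\<forall>M. L M = P ** M ** transpose Q) \<or> (\<forall>M. L M = P ** transpose M ** transpose Q)"
    by blast
  then have "L (mat 1) = P ** transpose Q"
    by (auto simp: transpose_mat)
  then have "det P * det Q = 1"
    using det[of "mat 1"] by (simp add: det_mul det_transpose)
  with PQ show thesis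
    by (intro that[of P Q]) (auto simp: admissible_def)
qed

section \<open>Classification of the block isometries\<close>

fun signb :: "blocks \<Rightarrow> blocks" where
  "signb (X, M, Y) = (X, - M, Y)"

lemma transpose_zero: "transpose 0 = (0 :: complex^'n^'n)"
  by (simp add: vec_eq_iff transpose_def)

text \<open>The axioms are relative to \<open>bskew\<close> since the type \<open>blocks\<close>
  also contains diagonal blocks that are not skew-symmetric.\<close>

locale block_isometry =
  fixes f :: "blocks \<Rightarrow> blocks"
  assumes skew: "bskew x \<Longrightarrow> bskew (f x)"
    and add: "bskew x \<Longrightarrow> bskew y \<Longrightarrow> f (x + y) = f x + f y"
    and scale: "bskew x \<Longrightarrow> f (bscale c x) = bscale c (f x)"
    and sign: "bskew x \<Longrightarrow> f (signb x) = signb (f x)"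
    and pf8: "bskew x \<Longrightarrow> pf8 (f x) = pf8 x"
    and herm: "bskew x \<Longrightarrow> bskew y \<Longrightarrow> bherm (f x) (f y) = bherm x y"
    and surj: "bskew y \<Longrightarrow> \<exists>x. bskew x \<and> f x = y"
begin

definition middle :: "complex^4^4 \<Rightarrow> complex^4^4" where
  "middle M = fst (snd (f (0, M, 0)))"

lemma bskew_zero: "bskew (0, M, 0)"
  by (simp add: vec_eq_iff transpose_def)

lemma neg_eq_self: "A = - A \<Longrightarrow> A = 0" for A :: "complex^4^4"
  by (simp add: vec_eq_iff)

lemma f_odd: "f (0, M, 0) = (0, middle M, 0)"
proof -
  have "(0, - M, 0) = bscale (- 1) (0, M, 0)"
    by (simp add: vec_eq_iff)
  then have "signb (f (0, M, 0)) = bscale (- 1) (f (0, M, 0))"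
    using sign[OF bskew_zero, of M] scale[OF bskew_zero, of "- 1" M] by simp
  then show ?thesis
    unfolding middle_def by (cases "f (0, M, 0)") (simp add: neg_eq_self flip: uminus_eq_mscale)
qed

lemma f_even:
  assumes "bskew (X, 0, Y)"
  shows "fst (snd (f (X, 0, Y))) = 0"
proof -
  have "signb (f (X, 0, Y)) = f (X, 0, Y)"
    using sign[OF assms] by simp
  then show ?thesis
    using neg_eq_self by (cases "f (X, 0, Y)") (metis fst_conv snd_conv signb.simps prod.inject)
qed

lemma det_isometry_middle: "det_isometry middle"
proof
  fix M N :: "complex^4^4" and c
  have "(0, M + N, 0) = (0, M, 0) + ((0, N, 0) :: blocks)"
    by simp
  then have "f (0, M + N, 0) = f (0, M, 0) + f (0, N, 0)"
    using add[OF bskew_zero bskew_zero] by metis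
  then show "middle (M + N) = middle M + middle N"
    by (simp add: f_odd)
  have "f (0, mscale c M, 0) = bscale c (f (0, M, 0))"
    using scale[OF bskew_zero, of c M] by simp
  then show "middle (mscale c M) = mscale c (middle M)"
    by (simp add: f_odd)
  have z: "pf4 0 = 0" "star4 0 = 0"
    by (simp_all add: pf4_def star4_def skew4_def mat_eq_iff4 forall_4)
  have pf: "pf8 (0, M, 0) = det M" for M
    by (simp add: z trace_def)
  show "det (middle M) = det M"
    using pf8[OF bskew_zero, of M] by (simp only: f_odd pf)
  have fr: "frob (0 :: complex^4^4) 0 = 0"
    by (simp add: frob_def)
  show "frob (middle M) (middle N) = frob M N"
    using herm[OF bskew_zero bskew_zero, of M N] by (simp add: f_odd fr)
  obtain x where x: "bskew x" "f x = (0, N, 0)"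
    using surj[OF bskew_zero, of N] by blast
  obtain X M' Y where xe: "x = (X, M', Y)"
    by (metis prod.exhaust)
  then have sk: "bskew (X, 0, Y)"
    using x by simp
  have "x = (0, M', 0) + (X, 0, Y)"
    by (simp add: xe)
  then have "f x = f (0, M', 0) + f (X, 0, Y)"
    by (simp only: add[OF bskew_zero sk])
  then have "middle M' = N"
    using f_even[OF sk] x(2) by (cases "f (X, 0, Y)") (simp add: f_odd)
  then show "\<exists>M. middle M = N"
    by blast
qed

end

section \<open>Block isometries that fix the middle block\<close>

lemma star4_star4: "skew X \<Longrightarrow> star4 (star4 X) = X"
  by (erule skew_cases) (simp add: star4_def skew4_def mat_eq_iff4 forall_4)

lemma skew_star4: "skew (star4 X)"
  by (simp add: star4_def skew_skew4)

lemma star4_linear: "star4 (X + Y) = star4 X + star4 Y" "star4 (mscale c X) = mscale c (star4 X)"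
  by (simp_all add: star4_def skew4_def mat_eq_iff4 forall_4)

text \<open>The two arguments cannot be interchanged, since a linear functional on the span of \<open>U2\<close> and \<open>U3\<close>
  has a nonzero kernel.\<close>

lemma product_rigidity:
  fixes A B :: "complex^4^4 \<Rightarrow> complex^4^4 \<Rightarrow> complex^4^4" and a :: "complex^4^4 \<Rightarrow> complex^4^4"
  assumes A: "\<And>Z Z' W W'. A (Z + Z') (W + W') = A Z W + A Z' W'"
      "\<And>c Z W. A (mscale c Z) (mscale c W) = mscale c (A Z W)"
    and B: "\<And>Z Z' W W'. B (Z + Z') (W + W') = B Z W + B Z' W'"
    and a: "\<And>Z Z'. a (Z + Z') = a Z + a Z'" "\<And>c Z. a (mscale c Z) = mscale c (a Z)"
    and Z12: "a U2 $ 1 $ 2 = 1" "a U2 $ 1 $ 3 = 0" "a U3 $ 1 $ 2 = 0" "a U3 $ 1 $ 3 = 1"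
    and prod: "\<And>Z W i j k l. A Z W $ i $ j * B Z W $ k $ l = a Z $ i $ j * a W $ k $ l"
  obtains d where "d \<noteq> 0" "\<And>Z W. A Z W = mscale (1 / d) (a Z)" "\<And>Z W. B Z W = mscale d (a W)"
proof -
  have diff: "A (Z - Z') (W - W') = A Z W - A Z' W'" "B (Z - Z') (W - W') = B Z W - B Z' W'"
    for Z Z' W W'
    using A(1)[of "Z - Z'" Z' "W - W'" W'] B[of "Z - Z'" Z' "W - W'" W'] by simp_all
  have a0: "a 0 = 0"
    using a(1)[of 0 0] by simp
  \<comment> \<open>A and B are additive in the pair (Z, W), so each is a part depending on Z plus a
    part depending on W.\<close>
  have split: "A Z W = A Z 0 + A 0 W" "B Z W = B Z 0 + B 0 W" for Z W
    using A(1)[of Z 0 0 W] B[of Z 0 0 W] by simp_all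
  \<comment> \<open>For W = 0 the product of the two entries vanishes for every Z, so one of the two
    factors vanishes identically.\<close>
  have 1: "(\<forall>Z. A Z 0 $ i $ j = 0) \<or> (\<forall>Z. B Z 0 $ k $ l = 0)" for i j k l
  proof (rule union_of_subspaces)
    show "A Z 0 $ i $ j = 0 \<or> B Z 0 $ k $ l = 0" for Z
      using prod[of Z 0 i j k l] by (simp add: a0)
  qed (use diff[of _ _ 0 0] in simp_all)
  have 2: "(\<forall>Z. A 0 Z $ i $ j = 0) \<or> (\<forall>Z. B 0 Z $ k $ l = 0)" for i j k l
  proof (rule union_of_subspaces)
    show "A 0 Z $ i $ j = 0 \<or> B 0 Z $ k $ l = 0" for Z
      using prod[of 0 Z i j k l] by (simp add: a0)
  qed (use diff[of 0 0] in simp_all)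
  have BZ: "B Z 0 = 0" for Z
  proof (rule ccontr)
    assume "B Z 0 \<noteq> 0"
    then have AZ: "A Z W = A 0 W" for Z W
      using 1 split(1)[of Z W] by (metis (no_types, lifting) add_0 vec_eq_iff zero_index)
    \<comment> \<open>If B depended on Z, then A would depend on W only. The combination W below is
      killed by the entry (1, 2) of A, and the product rule then forces \<open>a W\<close> to vanish
      although a is injective on the span of \<open>U2\<close> and \<open>U3\<close>.\<close>
    define u v where "u = A 0 U2 $ 1 $ 2" and "v = A 0 U3 $ 1 $ 2"
    define W where "W = mscale v U2 + mscale (- u) U3"
    have "A 0 W = mscale v (A 0 U2) + mscale (- u) (A 0 U3)"
      using A(1)[of 0 0 "mscale v U2" "mscale (- u) U3"] A(2)[of v 0 U2] A(2)[of "- u" 0 U3]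
      by (simp add: W_def)
    then have "A U2 W $ 1 $ 2 = 0"
      by (simp add: AZ[of U2] u_def v_def)
    then have "a W $ k $ l = 0" for k l
      using prod[of U2 W 1 2 k l] by (simp add: Z12)
    from this[of 1 2] this[of 1 3] have "v = 0" "u = 0"
      by (simp_all add: W_def a Z12)
    then show False
      using prod[of U2 U2 1 2 1 2] by (simp add: AZ[of U2] u_def Z12)
  qed
  have "\<exists>k l. \<not> (\<forall>W. B 0 W $ k $ l = 0)"
    using prod[of U2 U2 1 2 1 2] split(2)[of U2 U2] BZ[of U2] by (metis (no_types) Z12(1) add_0 mult_1 mult_zero_right zero_neq_one)
  then obtain k l where kl: "\<not> (\<forall>W. B 0 W $ k $ l = 0)"
    by blast
  have AW: "A 0 W = 0" for W
    using 2[of _ _ k l] kl by (auto simp: vec_eq_iff)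
  define d where "d = B 0 U2 $ 1 $ 2"
  have BW: "B Z W = B 0 W" and AZ: "A Z W = A Z 0" for Z W
    using split[of Z W] by (simp_all add: BZ AW)
  have Ad: "A Z 0 $ i $ j * d = a Z $ i $ j" for Z i j
    using prod[of Z U2 i j 1 2] by (simp add: d_def Z12 BW[of Z U2] AZ[of Z U2])
  then have d: "d \<noteq> 0"
    using Z12(1) by (metis mult_zero_right zero_neq_one)
  have Aa: "A Z W = mscale (1 / d) (a Z)" for Z W
    using Ad d by (simp add: vec_eq_iff AZ[of Z W] nonzero_eq_divide_eq)
  have Ba: "B Z W = mscale d (a W)" for Z W
  proof -
    have "A U2 W $ 1 $ 2 = 1 / d"
      by (simp add: Aa Z12)
    then have "1 / d * B U2 W $ k $ l = a W $ k $ l" for k l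
      using prod[of U2 W 1 2 k l] by (simp only: Z12 mult_1)
    then have "B U2 W $ k $ l = d * a W $ k $ l" for k l
      using d by (simp add: field_simps flip: \<open>\<And>k l. 1 / d * B U2 W $ k $ l = a W $ k $ l\<close>)
    then show ?thesis
      by (simp add: vec_eq_iff BW[of Z W] BW[of U2 W])
  qed
  show thesis
    by (rule that[OF d Aa Ba])
qed

lemma trace_outer_axis:
  "trace (U ** outer (axis i 1) (axis l 1) ** V ** transpose (outer (axis j 1) (axis k 1)))
    = U $ j $ i * V $ l $ k"
proof -
  have 1: "(A ** outer (axis i 1) b) $ p $ q = A $ p $ i * b $ q" for A :: "complex^4^4" and i b p q
    by (simp add: matrix_matrix_mult_def axis_def if_distrib[of "\<lambda>x. x * _"]
        if_distrib[of "\<lambda>x. _ * x"] cong: if_cong)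
  have 2: "transpose (outer a b) = outer b a" for a b
    by (simp add: vec_eq_iff transpose_def mult.commute)
  have 3: "(U ** outer (axis i 1) (axis l 1) ** V) $ p $ q = U $ p $ i * V $ l $ q" for p q
    unfolding matrix_matrix_mult_def[of _ V] vec_lambda_beta 1
    by (simp add: axis_def if_distrib[of "\<lambda>x. x * _"]
        if_distrib[of "\<lambda>x. _ * x"] cong: if_cong)
  show ?thesis
    unfolding 2 trace_def 1 3 by (simp add: axis_def if_distrib[of "\<lambda>x. _ * x"] cong: if_cong)
qed

lemma skew_nth: "skew X \<Longrightarrow> X $ j $ i = - X $ i $ j" for X :: "complex^'n^'n"
  by (drule arg_cong[of _ _ "\<lambda>Y. Y $ i $ j"]) (simp add: transpose_def)

text \<open>The quadratic form in M is evaluated at a sum of two matrix units. The two diagonal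
  contributions contain diagonal entries of a skew-symmetric matrix and vanish, and the two mixed
  ones coincide.\<close>

lemma star_product_recover:
  fixes S T S' T' :: "complex^4^4"
  assumes "skew S" "skew T" "skew S'" "skew T'"
    and "\<And>M. trace (S ** M ** T ** transpose M) = trace (S' ** M ** T' ** transpose M)"
  shows "S $ i $ j * T $ k $ l = S' $ i $ j * T' $ k $ l"
proof -
  define M :: "complex^4^4" where "M = outer (axis i 1) (axis l 1) + outer (axis j 1) (axis k 1)"
  have "trace (U ** M ** V ** transpose M) = 2 * (U $ i $ j * V $ k $ l)"
    if U: "skew U" and V: "skew V" for U V :: "complex^4^4"
  proof -
    have "U $ p $ p = 0" for p
      using skew_nth[OF U, of p p] by simp
    then have "trace (U ** M ** V ** transpose M) = U $ j $ i * V $ l $ k + U $ i $ j * V $ k $ l"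
      by (simp add: M_def transpose_add matrix_add_ldistrib matrix_add_rdistrib trace_add trace_outer_axis)
    then show ?thesis
      using skew_nth[OF U, of j i] skew_nth[OF V, of l k] by simp
  qed
  then show ?thesis
    using assms by (metis mult_left_cancel zero_neq_numeral)
qed

context block_isometry
begin

text \<open>The part of \<open>pf8\<close> quadratic in M determines every product of an entry of
  \<open>star4 X\<close> with an entry of \<open>star4 Y\<close>; \<open>product_rigidity\<close>
  then leaves only one scalar d.\<close>

lemma rescaling:
  assumes id: "\<And>M. middle M = M"
  obtains d where "d \<noteq> 0" "\<And>X M Y. bskew (X, M, Y) \<Longrightarrow> f (X, M, Y) = (mscale (1 / d) X, M, mscale d Y)"
proof -
  define p q where "p X Y = fst (f (X, 0, Y))" and "q X Y = snd (snd (f (X, 0, Y)))" for X Y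
  have f0: "f (X, 0, Y) = (p X Y, 0, q X Y)" if "skew X" "skew Y" for X Y
    using f_even[of X Y] that by (simp add: p_def q_def prod_eq_iff)
  have fM: "f (X, M, Y) = (p X Y, M, q X Y)" if XY: "skew X" "skew Y" for X M Y
  proof -
    have "f ((0, M, 0) + (X, 0, Y)) = f (0, M, 0) + f (X, 0, Y)"
      using XY by (intro add bskew_zero) simp
    then show ?thesis
      by (simp add: f_odd id f0 XY)
  qed
  have pq: "skew (p X Y)" "skew (q X Y)" if "skew X" "skew Y" for X Y
    using skew[of "(X, 0, Y)"] that by (simp_all add: f0)
  have tr: "trace (star4 X ** M ** star4 Y ** transpose M)
      = trace (star4 (p X Y) ** M ** star4 (q X Y) ** transpose M)" if "skew X" "skew Y" for X Y M
  proof -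
    have "pf8 (p X Y, M, q X Y) = pf8 (X, M, Y)" for M
      using pf8[of "(X, M, Y)"] that by (simp only: fM bskew.simps)
    \<comment> \<open>Subtracting the case M = 0 and the common summand \<open>det M\<close>
      isolates the quadratic part.\<close>
    from this[of M] this[of 0] show ?thesis
      by (simp add: trace_def)
  qed
  \<comment> \<open>The rigidity lemma speaks of all matrices. As \<open>star4 Z\<close> is always
    skew-symmetric, composing with it extends the maps p and q; a is the identity on skew-symmetric
    matrices.\<close>
  define A B where "A Z W = star4 (p (star4 Z) (star4 W))" and "B Z W = star4 (q (star4 Z) (star4 W))" for Z W
  define a where "a Z = star4 (star4 Z)" for Z
  have prod: "A Z W $ i $ j * B Z W $ k $ l = a Z $ i $ j * a W $ k $ l" for Z W i j k l
    unfolding A_def B_def a_def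
    by (rule star_product_recover[symmetric]) (simp_all only: skew_star4 tr)
  have padd: "p (X + X') (Y + Y') = p X Y + p X' Y'" "q (X + X') (Y + Y') = q X Y + q X' Y'"
    if "skew X" "skew Y" "skew X'" "skew Y'" for X X' Y Y'
    using add[of "(X, 0, Y)" "(X', 0, Y')"] f0[of X Y] f0[of X' Y'] f0[of "X + X'" "Y + Y'"] that
    by (simp_all add: transpose_add)
  have pscale: "p (mscale c X) (mscale c Y) = mscale c (p X Y)" if "skew X" "skew Y" for c X Y
    using scale[of "(X, 0, Y)" c] f0[of X Y] f0[of "mscale c X" "mscale c Y"] that
    by (simp add: transpose_mscale uminus_eq_mscale mscale_mscale mult.commute)
  obtain d where d: "d \<noteq> 0" "\<And>Z W. A Z W = mscale (1 / d) (a Z)" "\<And>Z W. B Z W = mscale d (a W)"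
  proof (rule product_rigidity[of A B a "skew4 1 0 0 0 0 0" "skew4 0 1 0 0 0 0"])
    show "A (Z + Z') (W + W') = A Z W + A Z' W'" "B (Z + Z') (W + W') = B Z W + B Z' W'"
      "A (mscale c Z) (mscale c W) = mscale c (A Z W)" for Z Z' W W' c
      by (simp_all add: A_def B_def star4_linear padd pscale skew_star4)
    show "a (Z + Z') = a Z + a Z'" "a (mscale c Z) = mscale c (a Z)" for Z Z' c
      by (simp_all add: a_def star4_linear)
  qed (use prod in \<open>simp_all add: a_def star4_def skew4_def\<close>)
  have "p X Y = mscale (1 / d) X" "q X Y = mscale d Y" if "skew X" "skew Y" for X Y
  proof -
    have "star4 (A (star4 X) (star4 Y)) = star4 (mscale (1 / d) (a (star4 X)))"
      "star4 (B (star4 X) (star4 Y)) = star4 (mscale d (a (star4 Y)))"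
      by (simp_all only: d)
    then show "p X Y = mscale (1 / d) X" "q X Y = mscale d Y"
      by (simp_all add: A_def B_def a_def star4_linear star4_star4 skew_star4 pq that)
  qed
  with d(1) fM show thesis
    by (intro that[of d]) simp_all
qed

text \<open>A square root e of 1/d yields the congruence by diag(e, 1/e), which multiplies X by 1/d
  and Y by d and fixes M. The Hermitian form, tested at \<open>J4\<close>, shows that d has modulus
  one.\<close>

lemma rescaling_act:
  assumes id: "\<And>M. middle M = M"
  obtains A B where "admissible A B" "\<And>x. bskew x \<Longrightarrow> f x = actb A B x"
proof -
  obtain d where d: "d \<noteq> 0"
    and fd: "\<And>X M Y. bskew (X, M, Y) \<Longrightarrow> f (X, M, Y) = (mscale (1 / d) X, M, mscale d Y)"
    using rescaling[OF id] by blast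
  have sk: "bskew (J4, 0, 0)"
    by (simp add: skew_J4 transpose_zero)
  have "frob J4 J4 = 4"
    by (simp add: frob_def J4_def skew4_def sum_4)
  moreover have "frob (0 :: complex^4^4) 0 = 0"
    by (simp add: frob_def)
  ultimately have unit: "cnj (1 / d) * (1 / d) = 1"
    using herm[OF sk sk] d by (simp add: fd[OF sk] frob_simps) (simp add: field_simps)
  define e where "e = csqrt (1 / d)"
  have e: "e * e = 1 / d"
    by (simp add: e_def flip: power2_eq_square)
  have "of_real ((norm (1 / d))\<^sup>2) = (1 :: complex)"
    using unit by (simp only: complex_norm_square mult.commute)
  then have "norm (1 / d) = 1"
    by (simp only: of_real_eq_1_iff power2_eq_1_iff) (smt (verit) norm_ge_zero)
  then have "norm e * norm e = 1"
    by (simp flip: norm_mult add: e)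
  then have "norm e = 1"
    by (metis abs_norm_cancel abs_1 real_sqrt_abs2 real_sqrt_one)
  then have ee: "cnj e * e = 1"
    by (metis complex_norm_square mult.commute of_real_1 one_power2)
  have e0: "e \<noteq> 0"
    using ee by auto
  have adj: "adjoint_matrix (mat c) = (mat (cnj c) :: complex^4^4)" for c
    by (auto simp: adjoint_matrix_def transpose_def mat_def vec_eq_iff)
  have det: "det (mat c :: complex^4^4) = c ^ 4" for c
    by (simp add: det_4 mat_def power4_eq_xxxx)
  have adm: "admissible (mat e) (mat (1 / e))"
    using ee e0 by (simp add: admissible_def adj mat_mult_mat det field_simps)
  have m: "mat c ** A = mscale c A" "A ** mat c = mscale c A" for A :: "complex^4^4" and c
    by (simp_all add: vec_eq_iff mat_mult_nth mult_mat_nth mult.commute)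
  have "actb (mat e) (mat (1 / e)) (X, M, Y) = (mscale (1 / d) X, M, mscale d Y)" for X M Y
  proof -
    have "1 / e * (1 / e) = d"
      by (simp add: e)
    moreover have "e * (1 / e) = 1"
      using e0 by simp
    ultimately show ?thesis
      by (simp only: actb.simps m transpose_mat mscale_mscale e mscale_one mult.commute[of "1 / e" e])
  qed
  with fd have "f x = actb (mat e) (mat (1 / e)) x" if "bskew x" for x
    using that by (cases x) metis
  with adm show thesis
    by (rule that)
qed

end

lemma signb_actb: "signb (actb A B x) = actb A B (signb x)"
  by (cases x) (simp add: matrix_minus_mult)

lemma signb_swapb: "signb (swapb x) = swapb (signb x)"
  by (cases x) (simp add: transpose_minus)

lemma block_isometry_comp:
  assumes f: "block_isometry f"
    and gskew: "\<And>x. bskew x \<Longrightarrow> bskew (g x)"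
    and g: "congruence_by g D" "\<And>x. signb (g x) = g (signb x)" "\<And>x. bskew x \<Longrightarrow> pf8 (g x) = pf8 x"
      "\<And>x y. bherm (g x) (g y) = bherm x y" "\<And>y. bskew y \<Longrightarrow> \<exists>x. bskew x \<and> g x = y"
  shows "block_isometry (\<lambda>x. g (f x))"
proof -
  interpret block_isometry f
    by (rule f)
  show ?thesis
  proof
    fix y assume "bskew y"
    then obtain z where z: "bskew z" "g z = y"
      using g(5) by blast
    then show "\<exists>x. bskew x \<and> g (f x) = y"
      using surj[OF z(1)] by blast
  next
    fix x assume x: "bskew x"
    show "g (f (signb x)) = signb (g (f x))"
      by (simp only: sign[OF x] g(2))
  next
    fix x c assume x: "bskew x"
    show "g (f (bscale c x)) = bscale c (g (f x))"
      by (simp only: scale[OF x] congruence_by_bscale[OF g(1)])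
  qed (simp_all only: gskew skew add congruence_by_add[OF g(1)] g(3) pf8 g(4) herm)
qed

lemma block_isometry_actb:
  assumes f: "block_isometry f" and AB: "admissible A B"
  shows "block_isometry (\<lambda>x. actb A B (f x))"
proof (rule block_isometry_comp[OF f bskew_actb congruence_by_actb signb_actb])
  have AB': "unitary A" "unitary B" "det A * det B = 1"
    using AB by (simp_all only: admissible_def)
  show "pf8 (actb A B x) = pf8 x" if "bskew x" for x
    by (rule pf8_actb[OF that AB'(3)])
  show "bherm (actb A B x) (actb A B y) = bherm x y" for x y
    by (rule bherm_actb[OF AB'(1,2)])
  show "\<exists>x. bskew x \<and> actb A B x = y" if "bskew y" for y
    using that AB' by (intro exI[of _ "actb (adjoint_matrix A) (adjoint_matrix B) y"])
      (simp only: bskew_actb actb_actb unitary_right actb_one)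
qed

lemma block_isometry_swapb:
  assumes "block_isometry f"
  shows "block_isometry (\<lambda>x. swapb (f x))"
proof (rule block_isometry_comp[OF assms bskew_swapb congruence_by_swapb signb_swapb pf8_swapb bherm_swapb])
  show "\<exists>x. bskew x \<and> swapb x = y" if "bskew y" for y
    using that by (intro exI[of _ "swapb y"]) (simp only: bskew_swapb swapb_swapb)
qed

text \<open>Undoing the action on the middle block reduces both alternatives to
  \<open>rescaling_act\<close>.\<close>

proposition block_isometry_cases:
  assumes f: "block_isometry f"
  obtains A B where "admissible A B"
    "(\<forall>x. bskew x \<longrightarrow> f x = actb A B x) \<or> (\<forall>x. bskew x \<longrightarrow> f x = actb A B (swapb x))"
proof -
  interpret block_isometry f
    by (rule f)
  obtain P Q where PQ: "admissible P Q"
    and cases: "(\<forall>M. middle M = P ** M ** transpose Q) \<or> (\<forall>M. middle M = P ** transpose M ** transpose Q)"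
    by (rule det_isometry_cases[OF det_isometry_middle])
  have inv: "actb P Q (actb (adjoint_matrix P) (adjoint_matrix Q) x) = x"
     "actb (adjoint_matrix P) (adjoint_matrix Q) (actb P Q x) = x" if "admissible P Q" for P Q x
    using that by (simp_all add: admissible_def actb_actb unitary_right actb_one)
  from cases show thesis
  proof
    assume M: "\<forall>M. middle M = P ** M ** transpose Q"
    define g where "g x = actb (adjoint_matrix P) (adjoint_matrix Q) (f x)" for x
    interpret g: block_isometry g
      unfolding g_def by (rule block_isometry_actb[OF f admissible_adjoint[OF PQ]])
    have "g (0, M, 0) = (0, M, 0)" for M
    proof -
      have "f (0, M, 0) = actb P Q (0, M, 0)"
        by (simp add: f_odd M)
      then show ?thesis
        by (simp only: g_def inv[OF PQ])
    qed
    then have "g.middle M = M" for M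
      by (simp add: g.middle_def)
    then obtain A B where AB: "admissible A B" "\<And>x. bskew x \<Longrightarrow> g x = actb A B x"
      using g.rescaling_act by blast
    then have "f x = actb (P ** A) (Q ** B) x" if "bskew x" for x
      using that inv(1)[OF PQ, of "f x"] by (simp add: g_def actb_actb)
    with AB show thesis
      using that[OF admissible_mult[OF PQ AB(1)]] by blast
  next
    assume M: "\<forall>M. middle M = P ** transpose M ** transpose Q"
    \<comment> \<open>The sign compensates the one in \<open>swapb\<close>.\<close>
    define P' where "P' = - P"
    have "adjoint_matrix (- P) ** - P = adjoint_matrix P ** P"
      by (simp add: vec_eq_iff adjoint_matrix_def transpose_def matrix_matrix_mult_def)
    then have PQ': "admissible P' Q"
      using PQ by (simp add: P'_def admissible_def det_minus4)
    define g where "g x = swapb (actb (adjoint_matrix P') (adjoint_matrix Q) (f x))" for x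
    interpret g: block_isometry g
      unfolding g_def
      by (rule block_isometry_swapb[OF block_isometry_actb[OF f admissible_adjoint[OF PQ']]])
    have "g (0, M, 0) = (0, M, 0)" for M
    proof -
      have "f (0, M, 0) = actb P' Q (swapb (0, M, 0))"
        by (simp add: f_odd M P'_def matrix_minus_mult)
      then show ?thesis
        by (simp only: g_def inv[OF PQ'] swapb_swapb)
    qed
    then have "g.middle M = M" for M
      by (simp add: g.middle_def)
    then obtain A B where AB: "admissible A B" "\<And>x. bskew x \<Longrightarrow> g x = actb A B x"
      using g.rescaling_act by blast
    have "f x = actb (P' ** B) (Q ** A) (swapb x)" if "bskew x" for x
    proof -
      have "f x = actb P' Q (swapb (g x))"
        by (simp only: g_def swapb_swapb inv[OF PQ'])
      then show ?thesis
        by (simp only: AB(2)[OF that] swapb_actb actb_actb)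
    qed
    with AB show thesis
      using that[OF admissible_mult[OF PQ' admissible_swap[OF AB(1)]]] by blast
  qed
qed

section \<open>The fixed subgroup\<close>

lemma jskew_minus: "jskew (- U) (- \<xi>) = bscale (- 1) (jskew U \<xi>)"
  using jskew_scaleC[of "- 1" U \<xi>] by (simp only: uminus_eq_scaleC[of U] mult_minus1)

lemma jgamma_minus: "jgamma (- U) = - jgamma U"
  by (simp only: uminus_eq_scaleC[of U] uminus_eq_scaleC[of "jgamma U"] jgamma_scaleC)

lemma chi_lambda_gamma:
  "chi1 ((lambda7 \<circ> gamma7) P) = bscale (- \<i>) (chi1 P)" "chi2 ((lambda7 \<circ> gamma7) P) = bscale \<i> (chi2 P)"
proof -
  obtain X Y \<xi> \<eta> where P: "P = (X, Y, \<xi>, \<eta>)"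
    by (rule freud_cases)
  show "chi1 ((lambda7 \<circ> gamma7) P) = bscale (- \<i>) (chi1 P)" "chi2 ((lambda7 \<circ> gamma7) P) = bscale \<i> (chi2 P)"
    unfolding P comp_apply gamma7.simps lambda7.simps chi1.simps chi2.simps jgamma_minus jgamma_jgamma
      jskew_minus bscale_add bscale_bscale
    by (simp_all add: add.commute)
qed

lemma jskew_jsigma: "jskew (jsigma U) \<xi> = signb (jskew U \<xi>)"
  by (cases U rule: jordan_coordinates) (simp add: vec_eq_iff forall_4, simp add: algebra_simps)

lemma jgamma_jsigma: "jgamma (jsigma U) = jsigma (jgamma U)"
  by (cases U rule: jordan_coordinates) (simp add: jgamma_eq)

lemma signb_linear: "signb (x + y) = signb x + signb y" "signb (bscale c x) = bscale c (signb x)"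
    "signb (signb x) = x"
  by (cases x; cases y; simp add: vec_eq_iff)+

lemma chi_sigma: "chi1 (sigma7 P) = signb (chi1 P)" "chi2 (sigma7 P) = signb (chi2 P)"
proof -
  obtain X Y \<xi> \<eta> where P: "P = (X, Y, \<xi>, \<eta>)"
    by (rule freud_cases)
  show "chi1 (sigma7 P) = signb (chi1 P)" "chi2 (sigma7 P) = signb (chi2 P)"
    unfolding P sigma7.simps chi1.simps chi2.simps jskew_jsigma jgamma_jsigma signb_linear by (rule refl)+
qed

lemma sigma7_sigma7: "sigma7 (sigma7 P) = P"
  by (rule freud_eqI) (simp_all only: chi_sigma signb_linear)

lemma bij_sigma7: "bij sigma7"
  by (rule o_bij[of sigma7]) (rule ext, simp only: comp_apply id_apply sigma7_sigma7)+

lemma bij_lambda_gamma: "bij (lambda7 \<circ> gamma7)"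
proof -
  let ?L = "lambda7 \<circ> gamma7"
  have "?L (?L (?L (?L P))) = P" for P
    by (rule freud_eqI; simp only: chi_lambda_gamma bscale_bscale) simp_all
  then show ?thesis
    by (intro o_bij[of "\<lambda>P. ?L (?L (?L P))"]) (rule ext, simp only: comp_apply id_apply)+
qed

lemma conjugate_eq_iff:
  assumes "bij \<delta>"
  shows "\<delta> \<circ> \<alpha> \<circ> inv_into UNIV \<delta> = \<alpha> \<longleftrightarrow> (\<forall>P. \<delta> (\<alpha> P) = \<alpha> (\<delta> P))"
  using assms by (auto simp only: fun_eq_iff comp_apply bij_is_inj inv_f_f bij_is_surj surj_f_inv_f)
    (metis bij_inv_eq_iff)

definition fixed_group :: "(freud \<Rightarrow> freud) set" where
  "fixed_group = E7_fix (lambda7 \<circ> gamma7) \<inter> E7_fix (lambda7 \<circ> gamma7 \<circ> sigma7)"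

text \<open>For a map that commutes with \<lambda>\<gamma>, this injective factor can be cancelled
  from the condition for \<lambda>\<gamma>\<sigma>.\<close>

lemma fixed_group_iff:
  "\<alpha> \<in> fixed_group \<longleftrightarrow> \<alpha> \<in> E7 \<and>
    (\<forall>P. (lambda7 \<circ> gamma7) (\<alpha> P) = \<alpha> ((lambda7 \<circ> gamma7) P)) \<and> (\<forall>P. sigma7 (\<alpha> P) = \<alpha> (sigma7 P))"
  (is "_ \<longleftrightarrow> _ \<and> ?lg \<and> ?s")
proof -
  let ?L = "lambda7 \<circ> gamma7"
  have bij: "bij (?L \<circ> sigma7)"
    by (rule bij_comp[OF bij_sigma7 bij_lambda_gamma])
  have "(\<forall>P. (?L \<circ> sigma7) (\<alpha> P) = \<alpha> ((?L \<circ> sigma7) P)) \<longleftrightarrow> ?s" if lg: ?lg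
  proof -
    have "(?L \<circ> sigma7) (\<alpha> P) = \<alpha> ((?L \<circ> sigma7) P) \<longleftrightarrow> ?L (sigma7 (\<alpha> P)) = ?L (\<alpha> (sigma7 P))" for P
      unfolding comp_apply[of ?L sigma7] by (simp only: lg)
    also have "\<dots> P \<longleftrightarrow> sigma7 (\<alpha> P) = \<alpha> (sigma7 P)" for P
      by (rule inj_eq[OF bij_is_inj[OF bij_lambda_gamma]])
    finally show ?thesis
      by (simp only:)
  qed
  then show ?thesis
    unfolding fixed_group_def E7_fix_def Int_iff mem_Collect_eq
      conjugate_eq_iff[OF bij_lambda_gamma] conjugate_eq_iff[OF bij]
    by blast
qed

lemma uact_fixed:
  assumes "admissible A B"
  shows "uact A B \<in> fixed_group"
  unfolding fixed_group_iff
proof (intro conjI allI)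
  show "uact A B \<in> E7"
    by (rule uact_in_E7[OF assms])
  show "(lambda7 \<circ> gamma7) (uact A B P) = uact A B ((lambda7 \<circ> gamma7) P)" for P
    by (rule freud_eqI)
      (simp_all only: chi_lambda_gamma chi_uact[OF assms] congruence_by_bscale[OF congruence_by_actb])
  show "sigma7 (uact A B P) = uact A B (sigma7 P)" for P
    by (rule freud_eqI) (simp_all only: chi_sigma chi_uact[OF assms] signb_actb)
qed

lemma uswap_fixed: "uswap \<in> fixed_group"
  unfolding fixed_group_iff
proof (intro conjI allI)
  show "uswap \<in> E7"
    by (rule uswap_in_E7)
  show "(lambda7 \<circ> gamma7) (uswap P) = uswap ((lambda7 \<circ> gamma7) P)" for P
    by (rule freud_eqI)
      (simp_all only: chi_lambda_gamma chi_uswap congruence_by_bscale[OF congruence_by_swapb])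
  show "sigma7 (uswap P) = uswap (sigma7 P)" for P
    by (rule freud_eqI) (simp_all only: chi_sigma chi_uswap signb_swapb)
qed

lemma E7_comp:
  assumes "\<alpha> \<in> E7" "\<beta> \<in> E7"
  shows "\<alpha> \<circ> \<beta> \<in> E7"
proof (rule E7I)
  show "clinear (\<alpha> \<circ> \<beta>)"
    by (rule clinearI) (simp_all only: comp_apply clinear_add[OF E7_clinear] clinear_scaleC[OF E7_clinear] assms)
  show "bij (\<alpha> \<circ> \<beta>)"
    using assms by (simp only: bij_comp E7_bij)
qed (simp_all only: comp_apply E7_fsymp[OF assms(1)] E7_fsymp[OF assms(2)] E7_fnorm[OF assms(1)]
  E7_fnorm[OF assms(2)] E7_fherm[OF assms(1)] E7_fherm[OF assms(2)])

lemma fixed_group_comp: "\<alpha> \<in> fixed_group \<Longrightarrow> \<beta> \<in> fixed_group \<Longrightarrow> \<alpha> \<circ> \<beta> \<in> fixed_group"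
  by (simp only: fixed_group_iff E7_comp comp_apply simp_thms)

lemma bskew_0: "bskew 0"
  by (simp add: zero_prod_def transpose_zero)

lemma emb_zero: "emb 0 = 0"
  by (simp add: zero_prod_def transpose_zero) (simp add: vec_eq_iff blk_def split: sum.splits)

lemma bscale_zero: "bscale c 0 = 0"
  by (simp add: zero_prod_def)

lemma eigen_blocks: "bscale \<i> x = bscale (- \<i>) x \<longleftrightarrow> x = 0"
  by (cases x) (auto simp: zero_prod_def vec_eq_iff)

section \<open>The map induced on one eigenspace\<close>

context
  fixes \<alpha>
  assumes \<alpha>: "\<alpha> \<in> fixed_group"
begin

private lemma in_E7: "\<alpha> \<in> E7"
  and lg: "(lambda7 \<circ> gamma7) (\<alpha> P) = \<alpha> ((lambda7 \<circ> gamma7) P)" and sg: "sigma7 (\<alpha> P) = \<alpha> (sigma7 P)"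
  using \<alpha> unfolding fixed_group_iff by blast+

private lemma lin: "clinear \<alpha>"
  by (rule E7_clinear[OF in_E7])

private lemma inj: "\<alpha> P = \<alpha> Q \<longleftrightarrow> P = Q"
  by (rule inj_eq[OF bij_is_inj[OF E7_bij[OF in_E7]]])

text \<open>The zeros of \<open>chi2\<close> form the eigenspace of \<lambda>\<gamma> for -i, which
  every map commuting with \<lambda>\<gamma> preserves.\<close>

lemma fixed_chi2_zero: "chi2 (\<alpha> P) = 0 \<longleftrightarrow> chi2 P = 0"
proof -
  have *: "chi2 Q = 0 \<longleftrightarrow> (lambda7 \<circ> gamma7) Q = (- \<i>) *\<^sub>C Q" for Q
  proof
    assume "chi2 Q = 0"
    then show "(lambda7 \<circ> gamma7) Q = (- \<i>) *\<^sub>C Q"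
      by (intro freud_eqI) (simp_all only: chi_lambda_gamma chi_scaleC bscale_zero)
  next
    assume "(lambda7 \<circ> gamma7) Q = (- \<i>) *\<^sub>C Q"
    then have "chi2 ((lambda7 \<circ> gamma7) Q) = chi2 ((- \<i>) *\<^sub>C Q)"
      by (rule arg_cong)
    then show "chi2 Q = 0"
      unfolding chi_lambda_gamma chi_scaleC eigen_blocks .
  qed
  show ?thesis
    unfolding * lg clinear_scaleC[OF lin, symmetric] inj ..
qed

lemma fixed_chi1_zero: "chi1 (\<alpha> P) = 0 \<longleftrightarrow> chi1 P = 0"
proof -
  have *: "chi1 Q = 0 \<longleftrightarrow> (lambda7 \<circ> gamma7) Q = \<i> *\<^sub>C Q" for Q
  proof
    assume "chi1 Q = 0"
    then show "(lambda7 \<circ> gamma7) Q = \<i> *\<^sub>C Q"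
      by (intro freud_eqI) (simp_all only: chi_lambda_gamma chi_scaleC bscale_zero)
  next
    assume "(lambda7 \<circ> gamma7) Q = \<i> *\<^sub>C Q"
    then have "chi1 ((lambda7 \<circ> gamma7) Q) = chi1 (\<i> *\<^sub>C Q)"
      by (rule arg_cong)
    then show "chi1 Q = 0"
      unfolding chi_lambda_gamma chi_scaleC using eigen_blocks by metis
  qed
  show ?thesis
    unfolding * lg clinear_scaleC[OF lin, symmetric] inj ..
qed

definition upper :: "blocks \<Rightarrow> blocks" where
  "upper x = chi1 (\<alpha> (chi_inv x 0))"

lemma fixed_upper: "bskew x \<Longrightarrow> \<alpha> (chi_inv x 0) = chi_inv (upper x) 0"
  by (rule freud_eqI)
    (simp_all only: upper_def chi_chi_inv bskew_chi bskew_0 fixed_chi2_zero)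

lemma block_isometry_upper: "block_isometry upper"
proof
  fix x y c
  assume x: "bskew x"
  have sk: "bskew (upper z)" for z
    by (simp only: upper_def bskew_chi)
  show "bskew (upper x)"
    by (rule sk)
  have "chi_inv (bscale c x) 0 = c *\<^sub>C chi_inv x 0"
    using x by (intro freud_eqI) (simp_all only: chi_chi_inv bskew_bscale bskew_0 chi_scaleC bscale_zero)
  then show "upper (bscale c x) = bscale c (upper x)"
    by (simp only: upper_def clinear_scaleC[OF lin] chi_scaleC)
  have "bskew (signb x)"
    using x by (cases x) simp
  moreover have "signb 0 = 0"
    by (simp add: zero_prod_def)
  ultimately have "chi_inv (signb x) 0 = sigma7 (chi_inv x 0)"
    using x by (intro freud_eqI) (simp_all only: chi_chi_inv bskew_0 chi_sigma)
  then show "upper (signb x) = signb (upper x)"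
    by (simp only: upper_def chi_sigma flip: sg)
  \<comment> \<open>On this eigenspace the alternating traces in \<open>fnorm_chi\<close> vanish and
    only one Pfaffian is left.\<close>
  have norm: "8 * fnorm (chi_inv z 0) = 2 * pf8 z" if "bskew z" for z
  proof -
    have "pf8 0 = 0"
      by (simp add: zero_prod_def pf4_def star4_def skew4_def det_4 trace_def matrix_matrix_mult_def)
    then show ?thesis
      using that by (simp add: emb_zero fnorm_chi chi_chi_inv bskew_0 w4_def trace_def matrix_matrix_mult_def)
  qed
  have "8 * fnorm (\<alpha> (chi_inv x 0)) = 8 * fnorm (chi_inv x 0)"
    by (simp only: E7_fnorm[OF in_E7])
  then show "pf8 (upper x) = pf8 x"
    unfolding fixed_upper[OF x] norm[OF x] norm[OF sk] by simp
  assume y: "bskew y"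
  have "chi_inv (x + y) 0 = chi_inv x 0 + chi_inv y 0"
    using x y by (intro freud_eqI) (simp_all only: chi_chi_inv bskew_add bskew_0 chi_add add_0_right)
  then show "upper (x + y) = upper x + upper y"
    by (simp only: upper_def clinear_add[OF lin] chi_add)
  have "bherm 0 0 = 0"
    by (simp add: zero_prod_def frob_def)
  then have herm: "4 * fherm (chi_inv z 0) (chi_inv w 0) = bherm z w" if "bskew z" "bskew w" for z w
    using that by (simp only: chi_chi_inv bskew_0 add_0_right flip: fherm_chi)
  have "4 * fherm (\<alpha> (chi_inv x 0)) (\<alpha> (chi_inv y 0)) = 4 * fherm (chi_inv x 0) (chi_inv y 0)"
    by (simp only: E7_fherm[OF in_E7])
  then show "bherm (upper x) (upper y) = bherm x y"
    unfolding fixed_upper[OF x] fixed_upper[OF y] herm[OF x y] herm[OF sk sk] .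
next
  fix y assume y: "bskew y"
  obtain P where P: "\<alpha> P = chi_inv y 0"
    using E7_bij[OF in_E7] by (metis bij_is_surj surjE)
  have "chi2 (\<alpha> P) = 0"
    unfolding P by (rule chi_chi_inv(2)[OF y bskew_0])
  then have "chi2 P = 0"
    by (rule fixed_chi2_zero[THEN iffD1])
  then have "chi_inv (chi1 P) 0 = P"
    using chi_inv_chi[of P] by (rule subst)
  then have "upper (chi1 P) = y"
    unfolding upper_def by (simp only: P chi_chi_inv(1)[OF y bskew_0])
  then show "\<exists>x. bskew x \<and> upper x = y"
    using bskew_chi by blast
qed

end

lemma fsymp_isotropic: "chi1 P = 0 \<Longrightarrow> chi1 Q = 0 \<Longrightarrow> fsymp P Q = 0"
proof -
  assume *: "chi1 P = 0" "chi1 Q = 0"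
  have "0 ** A = 0" "A ** 0 = 0" "trace (0 :: complex^(4+4)^(4+4)) = 0" for A :: "complex^(4+4)^(4+4)"
    by (simp_all add: vec_eq_iff matrix_matrix_mult_def trace_def)
  then have "- 4 * \<i> * fsymp P Q = 0"
    unfolding fsymp_chi[symmetric] * emb_zero by simp
  then show ?thesis
    by simp
qed

text \<open>On the eigenspace \<open>chi1 P = 0\<close> the difference of \<alpha> and \<beta> is
  symplectically orthogonal to that eigenspace by isotropy, and to the other one because both maps
  are symplectic and agree there. So it vanishes.\<close>

lemma fixed_group_eqI:
  assumes \<alpha>: "\<alpha> \<in> fixed_group" and \<beta>: "\<beta> \<in> fixed_group"
    and upper: "\<And>x. bskew x \<Longrightarrow> upper \<alpha> x = upper \<beta> x"
  shows "\<alpha> = \<beta>"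
proof
  have E7: "\<alpha> \<in> E7" "\<beta> \<in> E7"
    using assms unfolding fixed_group_iff by blast+
  have eq1: "\<alpha> (chi_inv x 0) = \<beta> (chi_inv x 0)" if "bskew x" for x
    using that by (simp only: fixed_upper[OF \<alpha>] fixed_upper[OF \<beta>] upper)
  have eq2: "\<alpha> Q = \<beta> Q" if Q: "chi1 Q = 0" for Q
  proof (rule fsymp_nondegenerate)
    fix S
    define R where "R = \<alpha> Q - \<beta> Q"
    have "chi1 (\<alpha> Q) = chi1 R + chi1 (\<beta> Q)"
      by (simp only: R_def diff_add_cancel flip: chi_add)
    then have R: "chi1 R = 0"
      unfolding fixed_chi1_zero[OF \<alpha>, THEN iffD2, OF Q] fixed_chi1_zero[OF \<beta>, THEN iffD2, OF Q]
      by (simp only: add_0_right)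
    define S' where "S' = inv_into UNIV \<alpha> S"
    have S: "S = \<alpha> S'"
      by (simp only: S'_def surj_f_inv_f[OF bij_is_surj[OF E7_bij[OF E7(1)]]])
    define x y where "x = chi_inv (chi1 S') 0" and "y = chi_inv 0 (chi2 S')"
    have xy: "S' = x + y"
      by (rule freud_eqI)
        (simp_all only: x_def y_def chi_add chi_chi_inv bskew_chi bskew_0 add_0_right add_0_left)
    have "\<alpha> x = \<beta> x"
      unfolding x_def by (rule eq1[OF bskew_chi(1)])
    then have "fsymp (\<alpha> x) (\<alpha> Q) = fsymp (\<alpha> x) (\<beta> Q)"
      using E7_fsymp[OF E7(1), of x Q] E7_fsymp[OF E7(2), of x Q] by (simp only:)
    then have 1: "fsymp (\<alpha> Q) (\<alpha> x) = fsymp (\<beta> Q) (\<alpha> x)"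
      by (simp only: fsymp_swap[of _ "\<alpha> x"])
    have "chi1 (\<alpha> y) = 0"
      by (simp only: fixed_chi1_zero[OF \<alpha>] y_def chi_chi_inv bskew_chi bskew_0)
    then have "fsymp R (\<alpha> y) = 0"
      using R by (intro fsymp_isotropic)
    then have 2: "fsymp (\<alpha> Q) (\<alpha> y) = fsymp (\<beta> Q) (\<alpha> y)"
      by (simp only: R_def fsymp_diff right_minus_eq)
    show "fsymp (\<alpha> Q) S = fsymp (\<beta> Q) S"
      by (simp only: S xy clinear_add[OF E7_clinear[OF E7(1)]] fsymp_add_right 1 2)
  qed
  fix P
  define x y where "x = chi_inv (chi1 P) 0" and "y = chi_inv 0 (chi2 P)"
  have xy: "P = x + y"
    by (rule freud_eqI)
      (simp_all only: x_def y_def chi_add chi_chi_inv bskew_chi bskew_0 add_0_right add_0_left)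
  have "\<alpha> x = \<beta> x"
    unfolding x_def by (rule eq1[OF bskew_chi(1)])
  moreover have "\<alpha> y = \<beta> y"
    by (rule eq2) (simp only: y_def chi_chi_inv bskew_chi bskew_0)
  ultimately show "\<alpha> P = \<beta> P"
    by (simp only: xy clinear_add[OF E7_clinear[OF E7(1)]] clinear_add[OF E7_clinear[OF E7(2)]])
qed

theorem fixed_group_cases:
  assumes \<alpha>: "\<alpha> \<in> fixed_group"
  obtains A B where "admissible A B" "\<alpha> = uact A B \<or> \<alpha> = uact A B \<circ> uswap"
proof -
  obtain A B where AB: "admissible A B" and cases:
    "(\<forall>x. bskew x \<longrightarrow> upper \<alpha> x = actb A B x) \<or> (\<forall>x. bskew x \<longrightarrow> upper \<alpha> x = actb A B (swapb x))"
    by (rule block_isometry_cases[OF block_isometry_upper[OF \<alpha>]])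
  from cases show thesis
  proof
    assume *: "\<forall>x. bskew x \<longrightarrow> upper \<alpha> x = actb A B x"
    have "\<alpha> = uact A B"
    proof (rule fixed_group_eqI[OF \<alpha> uact_fixed[OF AB]])
      show "upper \<alpha> x = upper (uact A B) x" if "bskew x" for x
        using * that by (simp only: upper_def[OF uact_fixed[OF AB]] chi_uact[OF AB] chi_chi_inv bskew_0)
    qed
    with AB show thesis
      using that by blast
  next
    assume *: "\<forall>x. bskew x \<longrightarrow> upper \<alpha> x = actb A B (swapb x)"
    have fixed: "uact A B \<circ> uswap \<in> fixed_group"
      by (rule fixed_group_comp[OF uact_fixed[OF AB] uswap_fixed])
    have "\<alpha> = uact A B \<circ> uswap"
    proof (rule fixed_group_eqI[OF \<alpha> fixed])
      show "upper \<alpha> x = upper (uact A B \<circ> uswap) x" if "bskew x" for x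
        using * that by (simp only: upper_def[OF fixed] comp_apply chi_uact[OF AB] chi_uswap chi_chi_inv bskew_0)
    qed
    with AB show thesis
      using that by blast
  qed
qed

section \<open>The parametrization\<close>

text \<open>The two scalars are inverse to each other, so the determinants of the two matrices are
  a^4 and its inverse when A and B have determinant one.\<close>

fun psi :: "u1su4su4 \<Rightarrow> freud \<Rightarrow> freud" where
  "psi (a, A, B) = uact (mscale a A) (mscale (cnj a) B)"

abbreviation mult_params :: "u1su4su4 \<Rightarrow> u1su4su4 \<Rightarrow> u1su4su4" (infixl \<open>\<odot>\<close> 70) where
  "x \<odot> y \<equiv> x \<otimes>\<^bsub>U1_SU4_SU4\<^esub> y"

lemma carrier_iff: "(a, A, B) \<in> carrier U1_SU4_SU4 \<longleftrightarrow>
    cnj a * a = 1 \<and> (unitary A \<and> det A = 1) \<and> unitary B \<and> det B = 1"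
  by (simp add: U1_SU4_SU4_def U1_def SU_def)

lemma mult_eq: "(a, A, B) \<odot> (a', A', B') = (a * a', A ** A', B ** B')"
  by (simp add: U1_SU4_SU4_def U1_def SU_def)

lemma inverse_unit: "cnj a * a = 1 \<Longrightarrow> inverse a = cnj a"
  by (metis inverse_unique mult.commute)

lemma det_mscale: "det (mscale c A) = c ^ 4 * det (A :: complex^4^4)"
  by (simp add: det_4 power4_eq_xxxx algebra_simps)

lemma unitary_mscale: "cnj c * c = 1 \<Longrightarrow> unitary A \<Longrightarrow> unitary (mscale c A)"
proof -
  assume c: "cnj c * c = 1" and A: "unitary A"
  have "adjoint_matrix (mscale c A) = mscale (cnj c) (adjoint_matrix A)"
    by (simp add: vec_eq_iff adjoint_matrix_def transpose_def)
  moreover have "c * cnj c = 1"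
    using c by (simp add: mult.commute)
  ultimately show ?thesis
    by (simp add: mscale_mult mscale_mscale A c)
qed

lemma admissible_psi:
  assumes "(a, A, B) \<in> carrier U1_SU4_SU4"
  shows "admissible (mscale a A) (mscale (cnj a) B)"
proof -
  have a: "cnj a * a = 1" "cnj (cnj a) * cnj a = 1"
    using assms by (simp_all add: carrier_iff mult.commute)
  then have "a ^ 4 * cnj a ^ 4 = 1"
    by (metis mult.commute power_mult_distrib power_one)
  then show ?thesis
    using assms a by (simp add: admissible_def carrier_iff unitary_mscale det_mscale)
qed

lemma psi_fixed: "x \<in> carrier U1_SU4_SU4 \<Longrightarrow> psi x \<in> fixed_group"
  by (cases x) (simp only: psi.simps uact_fixed admissible_psi)

lemma psi_mult:
  assumes "x \<in> carrier U1_SU4_SU4" "y \<in> carrier U1_SU4_SU4"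
  shows "psi (x \<odot> y) = psi x \<circ> psi y"
proof -
  obtain a A B where x: "x = (a, A, B)" by (metis prod.exhaust)
  obtain b C D where y: "y = (b, C, D)" by (metis prod.exhaust)
  show ?thesis
    using assms unfolding x y mult_eq psi.simps
    by (intro ext) (simp only: comp_apply uact_uact admissible_psi mscale_mult mscale_mscale complex_cnj_mult
        mult.commute[of b a] mult.commute[of "cnj b" "cnj a"])
qed

lemma eps_carrier: "x \<in> carrier U1_SU4_SU4 \<Longrightarrow> eps x \<in> carrier U1_SU4_SU4"
  by (cases x) (simp add: carrier_iff inverse_unit mult.commute)

lemma eps_mult: "eps (x \<odot> y) = eps x \<odot> eps y"
  by (cases x; cases y) (simp add: mult_eq)

lemma eps_eps: "eps (eps x) = x"
  by (cases x) simp

lemma psi_eps: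
  assumes "x \<in> carrier U1_SU4_SU4"
  shows "uswap \<circ> psi x = psi (eps x) \<circ> uswap"
proof -
  obtain a A B where x: "x = (a, A, B)" by (metis prod.exhaust)
  have "inverse a = cnj a"
    using assms by (simp add: x carrier_iff inverse_unit)
  then show ?thesis
    using admissible_psi[of a A B] assms unfolding x eps.simps psi.simps
    by (intro ext) (simp only: comp_apply uswap_uact complex_cnj_cnj)
qed

lemma uact_inject_actb:
  assumes "uact A B = g" "admissible A B" "\<And>P. chi1 (g P) = f (chi1 P)" "bskew x"
  shows "actb A B x = f x"
  using assms(3)[of "chi_inv x 0"] unfolding assms(1)[symmetric] chi_uact[OF assms(2)]
  by (simp only: chi_chi_inv assms(4) bskew_0)

lemma matrix_unit_mult:
  "(P ** outer (axis i 1) (axis j 1)) $ p $ q = (if q = j then P $ p $ i else 0)"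
  "(outer (axis i 1) (axis j 1) ** P) $ p $ q = (if p = i then P $ j $ q else 0)"
  by (simp_all add: matrix_matrix_mult_def axis_def if_distrib[of "\<lambda>x. x * _"]
        if_distrib[of "\<lambda>x. _ * x"] cong: if_cong)

text \<open>Fixing all M makes P commute with every matrix, so P is a scalar s, and makes the
  transpose of Q its inverse; fixing the skew-symmetric block \<open>J4\<close> gives s^2 =
  1.\<close>

lemma uact_eq_id:
  assumes "uact P Q = id" "admissible P Q"
  obtains s where "s \<in> {1, - 1}" "P = mat s" "Q = mat s"
proof -
  have act: "actb P Q x = x" if "bskew x" for x
    using uact_inject_actb[OF assms(1,2), of "\<lambda>x. x" x] that by simp
  have U: "unitary P" "unitary Q"
    using assms(2) by (simp_all add: admissible_def)
  have M: "P ** M ** transpose Q = M" for M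
  proof -
    have "actb P Q (0, M, 0) = (0, M, 0)"
      by (rule act) (simp add: transpose_zero)
    then show ?thesis by simp
  qed
  from M[of "mat 1"] have PQ: "P ** transpose Q = mat 1"
    by simp
  then have QP: "transpose Q ** P = mat 1"
    using matrix_left_right_inverse by blast
  have comm: "P ** M = M ** P" for M
  proof -
    have "P ** M = P ** M ** (transpose Q ** P)"
      by (simp add: QP)
    also have "\<dots> = M ** P"
      by (simp add: matrix_mul_assoc M)
    finally show ?thesis .
  qed
  have off: "P $ p $ i = (if p = i then P $ 1 $ 1 else 0)" for p i
    using arg_cong[OF comm[of "outer (axis i 1) (axis 1 1)"], of "\<lambda>A. A $ p $ 1"]
    by (simp add: matrix_unit_mult)
  define s where "s = P $ 1 $ 1"
  have P: "P = mat s"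
    unfolding s_def vec_eq_iff mat_def using off by simp
  have "actb P Q (J4, 0, 0) = (J4, 0, 0)"
    by (rule act) (simp add: skew_J4 transpose_zero)
  then have "P ** J4 ** transpose P = J4"
    by simp
  moreover have "P ** J4 ** transpose P = mscale (s * s) J4"
    by (simp add: P transpose_mat vec_eq_iff mat_mult_nth mult_mat_nth mult_ac)
  ultimately have "mscale (s * s) J4 $ 1 $ 2 = J4 $ 1 $ 2"
    by simp
  then have ss: "s * s = 1"
    by (simp add: J4_def skew4_def)
  have "transpose Q = mat s ** (P ** transpose Q)"
    by (simp add: P matrix_mul_assoc mat_mult_mat ss)
  then have "transpose (transpose Q) = transpose (mat s)"
    by (simp add: PQ)
  then have "Q = mat s"
    by (simp add: transpose_mat)
  moreover have "s \<in> {1, - 1}"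
    using ss by (simp add: square_eq_1_iff)
  ultimately show thesis
    using P by (intro that)
qed

lemma uact_neg_one: "uact (mat (- 1)) (mat (- 1)) = id"
proof -
  have m: "mat (- 1) = (- mat 1 :: complex^4^4)"
    by (simp add: uminus_mat)
  have adm: "admissible (mat (- 1)) (mat (- 1))"
    using mat_in_SU4[of "- 1"] by (simp add: admissible_def SU_def)
  have "dual4 (mat (- 1)) = mat (- 1)"
  proof -
    have "dual4 (- A) = - dual4 A" for A
    proof -
      have "map_matrix cnj (- A) = - map_matrix cnj A"
        by (simp add: vec_eq_iff)
      then show ?thesis
        by (simp add: dual4_def matrix_minus_mult)
    qed
    then show ?thesis
      by (simp add: m dual4_one)
  qed
  moreover have "actb (mat (- 1)) (mat (- 1)) x = x" for x
    by (cases x) (simp add: m transpose_minus transpose_mat matrix_minus_mult)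
  ultimately have "uact (mat (- 1)) (mat (- 1)) P = P" for P
    by (intro freud_eqI) (simp_all only: chi_uact[OF adm])
  then show ?thesis
    by (intro ext) (simp only: id_apply)
qed

text \<open>Equality would give P M = M^T P for all M, and matrix units then force P = 0. This keeps
  the two components of the fixed group disjoint.\<close>

lemma uact_ne_uswap:
  assumes "admissible P Q"
  shows "uact P Q \<noteq> uswap"
proof
  assume eq: "uact P Q = uswap"
  have M: "P ** M ** transpose Q = - transpose M" for M
  proof -
    have "actb P Q (0, M, 0) = swapb (0, M, 0)"
      by (rule uact_inject_actb[OF eq assms chi_uswap(1)]) (simp add: transpose_zero)
    then show ?thesis by simp
  qed
  have "P ** (- transpose Q) = mat 1"
    using M[of "mat 1"] by (simp add: matrix_minus_mult transpose_mat)
  then have QP: "- transpose Q ** P = mat 1"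
    using matrix_left_right_inverse by blast
  have comm: "P ** M = transpose M ** P" for M
  proof -
    have "P ** M = P ** M ** (- transpose Q ** P)"
      by (simp only: QP matrix_mul_rid)
    also have "\<dots> = - (P ** M ** transpose Q) ** P"
      by (simp only: matrix_mul_assoc matrix_minus_mult)
    finally show ?thesis
      by (simp only: M minus_minus)
  qed
  have tr: "transpose (outer (axis i 1) (axis j 1)) = outer (axis j 1) (axis i 1)" for i j
    by (simp add: vec_eq_iff transpose_def mult.commute)
  have "P $ p $ i = 0" if "p \<noteq> j" for p i j
    using arg_cong[OF comm[of "outer (axis i 1) (axis j 1)"], of "\<lambda>A. A $ p $ j"] that
    by (simp add: matrix_unit_mult tr)
  moreover have "\<exists>j. p \<noteq> j" for p :: 4
    by (rule exI[of _ "if p = 1 then 2 else 1"]) auto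
  ultimately have "P = 0"
    by (metis vec_eq_iff zero_index)
  then have "unitary (0 :: complex^4^4)"
    using assms by (simp add: admissible_def)
  then have "(mat 1 :: complex^4^4) $ 1 $ 1 = 0"
    by (simp add: vec_eq_iff matrix_matrix_mult_def)
  then show False
    by (simp add: mat_def)
qed

text \<open>By \<open>uact_eq_id\<close> an element of the kernel is (a, s/a, s a) with s = 1 or s =
  -1, and \<open>det B = 1\<close> gives a^4 = 1: eight elements.\<close>

lemma psi_eq_id_iff:
  assumes "x \<in> carrier U1_SU4_SU4"
  shows "psi x = id \<longleftrightarrow> x \<in> Z2_Z4"
proof -
  obtain a A B where x: "x = (a, A, B)" by (metis prod.exhaust)
  have a: "cnj a * a = 1" "a \<noteq> 0" and A: "det A = 1" and B: "det B = 1"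
    using assms by (auto simp: x carrier_iff)
  have inv: "cnj a = 1 / a"
    using inverse_unit[OF a(1)] by (simp add: inverse_eq_divide)
  have m: "mscale c (mat d) = (mat (c * d) :: complex^4^4)" for c d
    by (simp add: vec_eq_iff mat_def)
  show ?thesis
  proof
    assume "psi x = id"
    then have "uact (mscale a A) (mscale (cnj a) B) = id"
      by (simp only: x psi.simps)
    then obtain s where s: "s \<in> {1, - 1}" "mscale a A = mat s" "mscale (cnj a) B = mat s"
      using admissible_psi[OF assms[unfolded x]] by (rule uact_eq_id)
    have "mscale (1 / a) (mscale a A) = mat (s / a)" "mscale a (mscale (cnj a) B) = mat (s * a)"
      by (simp_all add: s m mult.commute)
    then have AB: "A = mat (s / a)" "B = mat (s * a)"
      using a by (simp_all add: mscale_mscale mult.commute)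
    have "det (mat (s * a) :: complex^4^4) = (s * a) ^ 4"
      by (simp add: det_4 mat_def power4_eq_xxxx)
    then have "a ^ 4 = 1"
      using B s(1) by (auto simp: AB power_mult_distrib)
    then have "(a * a - 1) * (a * a + 1) = 0"
      by (simp add: power4_eq_xxxx algebra_simps)
    moreover have "a * a + 1 = (a - \<i>) * (a + \<i>)" "a * a - 1 = (a - 1) * (a + 1)"
      by (simp_all add: algebra_simps)
    ultimately have "a \<in> {1, - 1, \<i>, - \<i>}"
      by (auto simp: eq_neg_iff_add_eq_0)
    with s(1) show "x \<in> Z2_Z4"
      by (intro Z2_Z4I) (simp_all add: x AB)
  next
    assume "x \<in> Z2_Z4"
    then obtain b s where s: "x = (b, mat (s / b), mat (s * b))" "s \<in> {1, - 1}"
      by (rule Z2_Z4E)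
    then have ab: "b = a" "A = mat (s / a)" "B = mat (s * a)"
      by (simp_all add: x)
    have "psi x = uact (mat s) (mat s)"
      using a by (simp add: x ab inv m)
    moreover have "uact (mat 1) (mat 1) = id"
      by (rule ext) (simp only: uact_one id_apply)
    ultimately show "psi x = id"
      using s(2) uact_neg_one by auto
  qed
qed

section \<open>The isomorphism from the semidirect product\<close>

interpretation G: group U1_SU4_SU4
  by (rule group_U1_SU4_SU4)

lemmas subgroup_Z2_Z4 = normal_imp_subgroup[OF normal_Z2_Z4]

abbreviation coset :: "u1su4su4 \<Rightarrow> u1su4su4 set" where
  "coset x \<equiv> Z2_Z4 #>\<^bsub>U1_SU4_SU4\<^esub> x"

lemma Z2_Z4_carrier: "x \<in> Z2_Z4 \<Longrightarrow> x \<in> carrier U1_SU4_SU4"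
  using subgroup.subset[OF subgroup_Z2_Z4] by blast

lemma psi_coset:
  assumes "x \<in> carrier U1_SU4_SU4"
  shows "psi ` coset x = {psi x}"
proof -
  have "psi (h \<odot> x) = psi x" if "h \<in> Z2_Z4" for h
    using psi_mult[OF Z2_Z4_carrier[OF that] assms] psi_eq_id_iff[OF Z2_Z4_carrier[OF that]] that
    by (simp only: id_comp simp_thms)
  then have "psi ` coset x \<subseteq> {psi x}"
    unfolding r_coset_def by blast
  moreover have "x \<in> coset x"
    using assms by (rule G.rcos_self[OF _ subgroup_Z2_Z4])
  ultimately show ?thesis
    by blast
qed

lemma comp_surj_cancel: "f = g" if eq: "f \<circ> k = g \<circ> k" and k: "surj k"
proof
  fix x
  obtain y where "x = k y"
    using k by (auto simp: surj_def)
  then show "f x = g x"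
    using fun_cong[OF eq, of y] by simp
qed

lemma comp_inj_cancel: "f = g" if eq: "k \<circ> f = k \<circ> g" and k: "inj k"
proof
  fix x
  show "f x = g x"
    using fun_cong[OF eq, of x] k by (simp add: inj_eq)
qed

lemma psi_inject:
  assumes "x \<in> carrier U1_SU4_SU4" "y \<in> carrier U1_SU4_SU4" "psi x = psi y"
  shows "coset x = coset y"
proof -
  define h where "h = x \<odot> inv\<^bsub>U1_SU4_SU4\<^esub> y"
  have h: "h \<in> carrier U1_SU4_SU4" "x = h \<odot> y"
    using assms by (simp_all add: h_def G.m_assoc)
  have "psi h \<circ> psi y = id \<circ> psi y"
    using psi_mult[OF h(1) assms(2)] assms(3) unfolding h(2)[symmetric] by (simp only: id_comp)
  moreover have "surj (psi y)"
    using psi_fixed[OF assms(2)] by (simp only: fixed_group_iff E7_bij bij_is_surj)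
  ultimately have "psi h = id"
    by (rule comp_surj_cancel)
  then have "h \<in> Z2_Z4"
    by (simp only: psi_eq_id_iff h)
  then have "x \<in> coset y"
    unfolding h(2) r_coset_def by blast
  then show ?thesis
    by (metis G.repr_independence subgroup_Z2_Z4 assms(2))
qed

lemma psi_surj:
  assumes "admissible A B"
  obtains x where "x \<in> carrier U1_SU4_SU4" "psi x = uact A B"
proof -
  have A: "unitary A" and B: "unitary B" and det: "det A * det B = 1"
    using assms by (simp_all add: admissible_def)
  \<comment> \<open>A fourth root of \<open>det A\<close>, so that both A and B get determinant one
    after rescaling.\<close>
  define a where "a = csqrt (csqrt (det A))"
  have a4: "a ^ 4 = det A"
  proof -
    have "a ^ 4 = (a\<^sup>2)\<^sup>2"
      by simp
    then show ?thesis
      unfolding a_def power2_csqrt .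
  qed
  have "cnj (det A) * det A = 1"
    using arg_cong[OF A, of det] by (simp add: det_mul det_adjoint_matrix)
  then have "of_real ((norm (det A))\<^sup>2) = (1 :: complex)"
    by (simp only: complex_norm_square mult.commute)
  then have "(norm a ^ 4)\<^sup>2 = 1"
    by (simp only: a4[symmetric] norm_power of_real_eq_1_iff)
  then have "norm a ^ 8 = 1"
    by simp
  then have "norm a = 1"
    by (metis norm_ge_zero power_eq_1_iff zero_neq_numeral real_norm_def abs_norm_cancel)
  then have unit: "cnj a * a = 1"
    by (metis complex_norm_square mult.commute of_real_1 one_power2)
  have unit': "cnj (cnj a) * cnj a = 1" "a * cnj a = 1"
    using unit by (simp_all add: mult.commute)
  have p4: "cnj a ^ 4 * a ^ 4 = 1"
    by (metis unit power_mult_distrib power_one)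
  define x where "x = (a, mscale (cnj a) A, mscale a B)"
  have "x \<in> carrier U1_SU4_SU4"
    unfolding x_def carrier_iff det_mscale
    using unit unit' A B p4 det by (simp add: unitary_mscale flip: a4)
  moreover have "psi x = uact A B"
    by (simp add: x_def mscale_mscale unit unit')
  ultimately show thesis
    by (rule that)
qed

lemma eps_Z2_Z4: "x \<in> Z2_Z4 \<Longrightarrow> eps x \<in> Z2_Z4"
proof -
  assume "x \<in> Z2_Z4"
  then obtain a s where x: "x = (a, mat (s / a), mat (s * a))" "a \<in> {1, - 1, \<i>, - \<i>}" "s \<in> {1, - 1}"
    by (rule Z2_Z4E)
  have "inverse a \<in> {1, - 1, \<i>, - \<i>}"
    using x(2) by auto
  then show ?thesis
    using x(3) by (rule Z2_Z4I) (simp add: x(1) divide_inverse)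
qed

lemma eps_coset:
  assumes "y \<in> carrier U1_SU4_SU4"
  shows "eps ` coset y = coset (eps y)"
proof -
  have *: "eps ` coset y \<subseteq> coset (eps y)" for y
  proof -
    have "eps (h \<odot> y) \<in> coset (eps y)" if "h \<in> Z2_Z4" for h
      unfolding eps_mult r_coset_def using eps_Z2_Z4[OF that] by blast
    then show ?thesis
      unfolding r_coset_def[of _ _ y] by blast
  qed
  moreover have "coset (eps y) \<subseteq> eps ` coset y"
    using image_mono[OF *[of "eps y"], of eps] by (simp only: eps_eps image_image image_ident)
  ultimately show ?thesis
    by blast
qed

definition swap_by :: "(u1su4su4 \<Rightarrow> u1su4su4) \<Rightarrow> freud \<Rightarrow> freud" where
  "swap_by e = (if e = id then id else uswap)"

text \<open>\<open>psi\<close> is constant on a coset, so \<open>the_elem\<close> extracts its value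
  without choosing a representative.\<close>

definition Psi :: "u1su4su4 set \<times> (u1su4su4 \<Rightarrow> u1su4su4) \<Rightarrow> freud \<Rightarrow> freud" where
  "Psi z = the_elem (psi ` fst z) \<circ> swap_by (snd z)"

lemma eps_ne_id: "eps \<noteq> id"
proof
  assume "eps = id"
  then have "eps (\<i>, 0, 0) = (\<i>, 0, 0)"
    by simp
  then show False
    by simp
qed

lemma swap_by_simps: "swap_by id = id" "swap_by eps = uswap"
  by (simp_all add: swap_by_def eps_ne_id)

lemma Psi_coset:
  "x \<in> carrier U1_SU4_SU4 \<Longrightarrow> Psi (coset x, e) = psi x \<circ> swap_by e"
  by (simp only: Psi_def fst_conv snd_conv psi_coset the_elem_eq)

lemma carrier_quotient: "carrier quotient_semidirect = coset ` carrier U1_SU4_SU4 \<times> {id, eps}"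
  by (auto simp: quotient_semidirect_def semidirect_product_def transformation_group_def FactGroup_def
      RCOSETS_def)

lemma quotientE:
  assumes "z \<in> carrier quotient_semidirect"
  obtains x e where "x \<in> carrier U1_SU4_SU4" "e \<in> {id, eps}" "z = (coset x, e)"
  using assms unfolding carrier_quotient by blast

lemma quotient_mult:
  assumes "x \<in> carrier U1_SU4_SU4" "y \<in> carrier U1_SU4_SU4" "e \<in> {id, eps}"
  shows "(coset x, e) \<otimes>\<^bsub>quotient_semidirect\<^esub> (coset y, e') = (coset (x \<odot> e y), e \<circ> e')"
proof -
  have ey: "e y \<in> carrier U1_SU4_SU4" "e ` coset y = coset (e y)"
    using assms(3) eps_carrier[OF assms(2)] eps_coset[OF assms(2)] assms(2)
    by (elim insertE emptyE; simp only: id_apply image_id)+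
  then show ?thesis
    using normal.rcos_sum[OF normal_Z2_Z4 assms(1) ey(1)]
    by (simp add: quotient_semidirect_def semidirect_product_def transformation_group_def FactGroup_def)
qed

lemma Psi_mult:
  assumes z: "z \<in> carrier quotient_semidirect" and w: "w \<in> carrier quotient_semidirect"
  shows "z \<otimes>\<^bsub>quotient_semidirect\<^esub> w \<in> carrier quotient_semidirect"
    "Psi (z \<otimes>\<^bsub>quotient_semidirect\<^esub> w) = Psi z \<circ> Psi w"
proof -
  obtain x e where x: "x \<in> carrier U1_SU4_SU4" "e \<in> {id, eps}" "z = (coset x, e)"
    using z by (rule quotientE)
  obtain y e' where y: "y \<in> carrier U1_SU4_SU4" "e' \<in> {id, eps}" "w = (coset y, e')"
    using w by (rule quotientE)
  have ey: "e y \<in> carrier U1_SU4_SU4"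
    using x(2) y(1) eps_carrier[OF y(1)] by (elim insertE emptyE; simp only: id_apply)
  have xey: "x \<odot> e y \<in> carrier U1_SU4_SU4"
    using x(1) ey by (rule G.m_closed)
  have ee: "eps \<circ> eps = id"
    by (rule ext) (simp only: comp_apply eps_eps id_apply)
  have "e \<circ> e' \<in> {id, eps}"
    using x(2) y(2) ee by auto
  then show "z \<otimes>\<^bsub>quotient_semidirect\<^esub> w \<in> carrier quotient_semidirect"
    unfolding x(3) y(3) quotient_mult[OF x(1) y(1) x(2)] carrier_quotient using xey by blast
  have 1: "swap_by e \<circ> psi y = psi (e y) \<circ> swap_by e"
    using x(2) psi_eps[OF y(1)] by (auto simp: swap_by_simps)
  have 2: "swap_by (e \<circ> e') = swap_by e \<circ> swap_by e'"
  proof -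
    have "uswap \<circ> uswap = id"
      by (rule ext) (simp only: comp_apply uswap_uswap id_apply)
    then show ?thesis
      using x(2) y(2) ee by (auto simp: swap_by_simps)
  qed
  have "psi x \<circ> swap_by e \<circ> (psi y \<circ> swap_by e') = psi x \<circ> (swap_by e \<circ> psi y) \<circ> swap_by e'"
    by (simp only: comp_assoc)
  also have "\<dots> = psi x \<circ> psi (e y) \<circ> swap_by (e \<circ> e')"
    by (simp only: 1 2 comp_assoc)
  finally show "Psi (z \<otimes>\<^bsub>quotient_semidirect\<^esub> w) = Psi z \<circ> Psi w"
    unfolding x(3) y(3) quotient_mult[OF x(1) y(1) x(2)] Psi_coset[OF xey] Psi_coset[OF x(1)] Psi_coset[OF y(1)]
      psi_mult[OF x(1) ey] by (rule sym)
qed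

lemma Psi_bij: "bij_betw Psi (carrier quotient_semidirect) fixed_group"
  unfolding bij_betw_def
proof
  show "inj_on Psi (carrier quotient_semidirect)"
  proof (rule inj_onI)
    fix z w
    assume z: "z \<in> carrier quotient_semidirect" and w: "w \<in> carrier quotient_semidirect" and eq: "Psi z = Psi w"
    obtain x e where x: "x \<in> carrier U1_SU4_SU4" "e \<in> {id, eps}" "z = (coset x, e)"
      using z by (rule quotientE)
    obtain y e' where y: "y \<in> carrier U1_SU4_SU4" "e' \<in> {id, eps}" "w = (coset y, e')"
      using w by (rule quotientE)
    have eq: "psi x \<circ> swap_by e = psi y \<circ> swap_by e'"
      using eq unfolding x(3) y(3) Psi_coset[OF x(1)] Psi_coset[OF y(1)] .
    \<comment> \<open>After cancelling \<open>psi y\<close>, a coincidence of elements with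
      different second components would make \<open>uswap\<close> a block-diagonal
      congruence.\<close>
    have ne: "psi x \<noteq> psi y \<circ> uswap" if xy: "x \<in> carrier U1_SU4_SU4" "y \<in> carrier U1_SU4_SU4" for x y
    proof
      assume *: "psi x = psi y \<circ> uswap"
      define h where "h = inv\<^bsub>U1_SU4_SU4\<^esub> y \<odot> x"
      have h: "h \<in> carrier U1_SU4_SU4" "x = y \<odot> h"
        using xy by (simp_all add: h_def flip: G.m_assoc)
      have "psi y \<circ> psi h = psi y \<circ> uswap"
        using psi_mult[OF xy(2) h(1)] * unfolding h(2)[symmetric] by (simp only:)
      moreover have "inj (psi y)"
        using psi_fixed[OF xy(2)] by (simp only: fixed_group_iff E7_bij bij_is_inj)
      ultimately have "psi h = uswap"
        by (rule comp_inj_cancel)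
      then show False
        using h(1) uact_ne_uswap[OF admissible_psi]
        by (cases h) (simp only: psi.simps)
    qed
    have cancel: "f = g" if "f \<circ> uswap = g \<circ> uswap" for f g :: "freud \<Rightarrow> freud"
      by (rule comp_surj_cancel[OF that bij_is_surj[OF bij_uswap]])
    consider "e = id" "e' = id" | "e = eps" "e' = eps" | "e = id" "e' = eps" | "e = eps" "e' = id"
      using x(2) y(2) by blast
    then have "e = e' \<and> psi x = psi y"
    proof cases
      case 1
      with eq show ?thesis
        by (simp only: swap_by_simps comp_id simp_thms)
    next
      case 2
      with eq have "psi x \<circ> uswap = psi y \<circ> uswap"
        by (simp only: swap_by_simps)
      then have "psi x = psi y"
        by (rule cancel)
      with 2 show ?thesis
        by (simp only: simp_thms)
    next
      case 3
      with eq have "psi x = psi y \<circ> uswap"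
        by (simp only: swap_by_simps comp_id)
      with ne[OF x(1) y(1)] show ?thesis
        by (rule notE)
    next
      case 4
      with eq have "psi y = psi x \<circ> uswap"
        by (simp only: swap_by_simps comp_id)
      with ne[OF y(1) x(1)] show ?thesis
        by (rule notE)
    qed
    then show "z = w"
      using psi_inject[OF x(1) y(1)] by (simp only: x(3) y(3))
  qed
  show "Psi ` carrier quotient_semidirect = fixed_group"
  proof (intro equalityI subsetI)
    fix \<alpha> assume "\<alpha> \<in> Psi ` carrier quotient_semidirect"
    then obtain z where z: "z \<in> carrier quotient_semidirect" "\<alpha> = Psi z"
      by blast
    from z(1) obtain x e where x: "x \<in> carrier U1_SU4_SU4" "e \<in> {id, eps}" "z = (coset x, e)"
      by (rule quotientE)
    have "psi x \<in> fixed_group" "psi x \<circ> uswap \<in> fixed_group"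
      using fixed_group_comp uswap_fixed psi_fixed[OF x(1)] by blast+
    then show "\<alpha> \<in> fixed_group"
      using x(2) unfolding z(2) x(3) Psi_coset[OF x(1)] by (auto simp: swap_by_simps)
  next
    fix \<alpha> assume "\<alpha> \<in> fixed_group"
    then obtain A B where AB: "admissible A B" "\<alpha> = uact A B \<or> \<alpha> = uact A B \<circ> uswap"
      by (rule fixed_group_cases)
    obtain x where x: "x \<in> carrier U1_SU4_SU4" "psi x = uact A B"
      using AB(1) by (rule psi_surj)
    have "\<alpha> = Psi (coset x, id) \<or> \<alpha> = Psi (coset x, eps)"
      using AB(2) by (simp only: Psi_coset[OF x(1)] x(2) swap_by_simps comp_id)
    then show "\<alpha> \<in> Psi ` carrier quotient_semidirect"
      unfolding carrier_quotient using x(1) by blast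
  qed
qed

section \<open>Continuity and compactness\<close>

lemma continuous_on_matrix_mult:
  fixes f g :: "'a::topological_space \<Rightarrow> complex^'n^'n"
  assumes "continuous_on S f" "continuous_on S g"
  shows "continuous_on S (\<lambda>x. f x ** g x)"
  unfolding matrix_matrix_mult_def by (intro continuous_intros assms)

lemma continuous_on_transpose:
  fixes f :: "'a::topological_space \<Rightarrow> complex^'n^'n"
  shows "continuous_on S f \<Longrightarrow> continuous_on S (\<lambda>x. transpose (f x))"
  unfolding transpose_def by (intro continuous_intros)

lemma continuous_on_mscale:
  fixes f :: "'a::topological_space \<Rightarrow> complex^'n^'n"
  shows "continuous_on S c \<Longrightarrow> continuous_on S f \<Longrightarrow> continuous_on S (\<lambda>x. mscale (c x) (f x))"
  unfolding mscale_def by (intro continuous_intros)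

lemma continuous_on_map_cnj:
  fixes f :: "'a::topological_space \<Rightarrow> complex^'n^'n"
  shows "continuous_on S f \<Longrightarrow> continuous_on S (\<lambda>x. map_matrix cnj (f x))"
  unfolding map_matrix_def by (intro continuous_intros)

lemma continuous_on_dual4: "continuous_on S f \<Longrightarrow> continuous_on S (\<lambda>x. dual4 (f x))"
  unfolding dual4_def by (intro continuous_on_matrix_mult continuous_on_map_cnj continuous_intros)

lemma continuous_on_actb:
  assumes "continuous_on S f" "continuous_on S g"
  shows "continuous_on S (\<lambda>x. actb (f x) (g x) b)"
  by (cases b) (simp only: actb.simps, intro continuous_on_Pair continuous_on_matrix_mult continuous_on_transpose
      continuous_on_const assms)

lemma continuous_on_bscale: "continuous_on S f \<Longrightarrow> continuous_on S (\<lambda>x. bscale c (f x))"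
proof -
  assume f: "continuous_on S f"
  have "bscale c x = (mscale c (fst x), mscale c (fst (snd x)), mscale c (snd (snd x)))" for x
    by (cases x) simp
  then show ?thesis
    by (simp only:) (intro continuous_on_Pair continuous_on_mscale continuous_on_fst continuous_on_snd
        continuous_on_const f)
qed

lemma continuous_on_bxi: "continuous_on S f \<Longrightarrow> continuous_on S (\<lambda>x. bxi (f x))"
proof -
  assume "continuous_on S f"
  moreover have "bxi x = - (fst x $1$2 + fst x $3$4 + snd (snd x) $1$2 + snd (snd x) $3$4) / 2" for x
    by (cases x) simp
  ultimately show ?thesis
    by (simp only:) (intro continuous_intros; simp)
qed

lemma continuous_on_junskew:
  assumes f: "continuous_on S f"
  shows "continuous_on S (\<lambda>x. junskew (f x))" "continuous_on S (\<lambda>x. jgamma (junskew (f x)))"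
proof -
  define X M Y where "X x = fst (f x)" and "M x = fst (snd (f x))" and "Y x = snd (snd (f x))" for x
  have eq: "f x = (X x, M x, Y x)" for x
    by (simp add: X_def M_def Y_def)
  have "continuous_on S X" "continuous_on S M" "continuous_on S Y"
    unfolding X_def M_def Y_def by (intro continuous_on_fst continuous_on_snd f)+
  then have entry: "continuous_on S (\<lambda>x. X x $ i $ j)" "continuous_on S (\<lambda>x. M x $ i $ j)"
    "continuous_on S (\<lambda>x. Y x $ i $ j)" for i j
    by (auto intro!: continuous_on_component)
  show "continuous_on S (\<lambda>x. junskew (f x))" "continuous_on S (\<lambda>x. jgamma (junskew (f x)))"
    unfolding eq junskew.simps Let_def unquat.simps quat_cnj.simps bxi.simps jgamma_eq cay_gamma.simps
      uminus_prod_def fst_conv snd_conv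
    by (intro continuous_on_Pair continuous_on_add continuous_on_diff continuous_on_minus continuous_on_mult
        continuous_on_divide continuous_on_const entry; simp)+
qed

lemma continuous_on_chi_inv:
  assumes f: "continuous_on S f" and g: "continuous_on S g"
  shows "continuous_on S (\<lambda>x. chi_inv (f x) (g x))"
  unfolding chi_inv_def Let_def
  by (intro continuous_on_Pair continuous_on_junskew continuous_on_bxi continuous_on_bscale
      continuous_on_add f g)

lemma continuous_on_uact:
  assumes f: "continuous_on S f" and g: "continuous_on S g"
  shows "continuous_on S (\<lambda>x. uact (f x) (g x) P)"
  unfolding uact_def block_op_def
  by (intro continuous_on_chi_inv continuous_on_actb continuous_on_dual4 f g)

text \<open>For pointwise convergence the argument P may be fixed; each coordinate of the value is
  then polynomial in the matrix entries, the scalar and their conjugates.\<close>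

lemma continuous_on_psi: "continuous_on S psi"
proof (rule continuous_on_coordinatewise_then_product)
  fix P
  have eq: "psi x P = uact (mscale (fst x) (fst (snd x))) (mscale (cnj (fst x)) (snd (snd x))) P" for x
    by (cases x) (simp only: psi.simps fst_conv snd_conv)
  show "continuous_on S (\<lambda>x. psi x P)"
    unfolding eq by (intro continuous_on_uact continuous_on_mscale continuous_intros)
qed

section \<open>Compactness of the parameter group and the homeomorphism\<close>

lemma compact_carrier_U1: "compact (carrier U1)"
proof -
  have "carrier U1 = sphere 0 1"
  proof -
    have unit: "cnj a * a = 1 \<longleftrightarrow> norm a = 1" for a
    proof -
      have "cnj a * a = of_real ((norm a)\<^sup>2)"
        by (simp only: complex_norm_square mult.commute)
      then show ?thesis
        by (simp only: of_real_eq_1_iff power2_eq_1_iff) (smt (verit) norm_ge_zero)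
    qed
    have U1: "carrier U1 = {a. cnj a * a = 1}"
      by (simp add: U1_def)
    show ?thesis
      unfolding U1 by (rule Set.set_eqI) (simp only: mem_Collect_eq mem_sphere_0 unit)
  qed
  then show ?thesis
    by simp
qed

lemma norm_vec_le_sum: "norm x \<le> (\<Sum>i\<in>UNIV. norm (x $ i))" for x :: "'a::real_normed_vector^'n"
  by (simp add: norm_vec_def L2_set_le_sum)

text \<open>The columns of a unitary matrix have length one, so its entries have modulus at most
  one; the bound 16 counts them.\<close>

lemma compact_carrier_SU: "compact (carrier (SU :: (complex^4^4) monoid))"
  unfolding compact_eq_bounded_closed
proof
  have "norm A \<le> 16" if "A \<in> carrier (SU :: (complex^4^4) monoid)" for A
  proof -
    have "norm (A $ i $ j) \<le> 1" for i j
    proof -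
      have "(adjoint_matrix A ** A) $ j $ j = 1"
        using that by (simp add: SU_def mat_def)
      then have "(\<Sum>k\<in>UNIV. cnj (A $ k $ j) * A $ k $ j) = 1"
        by (simp add: adjoint_matrix_def matrix_matrix_mult_def transpose_def)
      then have "of_real (\<Sum>k\<in>UNIV. (norm (A $ k $ j))\<^sup>2) = (1 :: complex)"
        unfolding of_real_sum complex_norm_square by (simp add: mult.commute)
      then have "(\<Sum>k\<in>UNIV. (norm (A $ k $ j))\<^sup>2) = 1"
        by (simp only: of_real_eq_1_iff)
      moreover have "(norm (A $ i $ j))\<^sup>2 \<le> (\<Sum>k\<in>UNIV. (norm (A $ k $ j))\<^sup>2)"
        by (rule member_le_sum) auto
      ultimately show ?thesis
        by (simp add: abs_square_le_1)
    qed
    then have "norm (A $ i) \<le> 4" for i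
      using norm_vec_le_sum[of "A $ i"] sum_mono[of UNIV "\<lambda>j. norm (A $ i $ j)" "\<lambda>j. 1"] by simp
    then show ?thesis
      using norm_vec_le_sum[of A] sum_mono[of UNIV "\<lambda>i. norm (A $ i)" "\<lambda>i. 4"] by simp
  qed
  then show "bounded (carrier (SU :: (complex^4^4) monoid))"
    unfolding bounded_iff by blast
  have "closed {A :: complex^4^4. adjoint_matrix A ** A = mat 1}"
    unfolding adjoint_matrix_def
    by (intro closed_Collect_eq continuous_on_matrix_mult continuous_on_map_cnj continuous_on_transpose
        continuous_intros)
  moreover have "closed {A :: complex^4^4. det A = 1}"
    unfolding det_4 by (intro closed_Collect_eq continuous_intros)
  ultimately show "closed (carrier (SU :: (complex^4^4) monoid))"
    unfolding SU_def by (simp add: Collect_conj_eq closed_Int)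
qed

lemma compact_carrier: "compact (carrier U1_SU4_SU4)"
  unfolding U1_SU4_SU4_def carrier_DirProd
  by (intro compact_Times compact_carrier_U1 compact_carrier_SU)

abbreviation coset_topology :: "u1su4su4 set topology" where
  "coset_topology \<equiv> quotient_topology (top_of_set (carrier U1_SU4_SU4)) coset"

lemma quotient_map_coset: "quotient_map (top_of_set (carrier U1_SU4_SU4)) coset_topology coset"
  by (rule quotient_map_quotient_topology)

lemma topspace_coset: "topspace coset_topology = coset ` carrier U1_SU4_SU4"
  using quotient_map_coset by (simp add: quotient_map_def)

lemma compact_coset: "compact_space coset_topology"
proof -
  have "compactin (top_of_set (carrier U1_SU4_SU4)) (carrier U1_SU4_SU4)"
    using compact_carrier by (simp add: compactin_subtopology)
  from image_compactin[OF this quotient_imp_continuous_map[OF quotient_map_coset]]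
  show ?thesis
    by (simp add: compact_space_def topspace_coset)
qed

lemma topspace_quotient: "topspace quotient_semidirect_topology = carrier quotient_semidirect"
  by (simp add: quotient_semidirect_topology_def topspace_coset carrier_quotient)

lemma continuous_Psi_fixed_factor:
  assumes "e \<in> {id, eps}"
  shows "continuous_map coset_topology (top_of_set fixed_group) (\<lambda>K. Psi (K, e))"
proof -
  have img: "Psi (coset x, e) \<in> fixed_group" if "x \<in> carrier U1_SU4_SU4" for x
    using Psi_bij that assms unfolding carrier_quotient bij_betw_def by blast
  have "continuous_on (carrier U1_SU4_SU4) (\<lambda>x. psi x \<circ> swap_by e)"
  proof (rule continuous_on_coordinatewise_then_product)
    show "continuous_on (carrier U1_SU4_SU4) (\<lambda>x. (psi x \<circ> swap_by e) P)" for P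
      unfolding comp_apply using continuous_on_psi by (rule continuous_on_product_then_coordinatewise)
  qed
  then have "continuous_on (carrier U1_SU4_SU4) ((\<lambda>K. Psi (K, e)) \<circ> coset)"
    by (rule continuous_on_cong[THEN iffD1, rotated 2]) (simp_all only: comp_apply[of _ coset] Psi_coset)
  then have "continuous_map (top_of_set (carrier U1_SU4_SU4)) (top_of_set fixed_group) ((\<lambda>K. Psi (K, e)) \<circ> coset)"
    using img by (auto simp: continuous_map_in_subtopology)
  then show ?thesis
    by (simp only: continuous_compose_quotient_map_eq[OF quotient_map_coset])
qed

text \<open>The second factor is discrete with two points, so a preimage is the union of two slices,
  each open by continuity with e fixed.\<close>

lemma continuous_Psi: "continuous_map quotient_semidirect_topology (top_of_set fixed_group) Psi"
  unfolding continuous_map_def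
proof (intro conjI allI impI)
  show "Psi \<in> topspace quotient_semidirect_topology \<rightarrow> topspace (top_of_set fixed_group)"
    unfolding topspace_quotient using Psi_bij by (auto simp: bij_betw_def)
  fix U assume U: "openin (top_of_set fixed_group) U"
  define V where "V e = {K \<in> topspace coset_topology. Psi (K, e) \<in> U}" for e
  have "openin coset_topology (V e)" if "e \<in> {id, eps}" for e
    unfolding V_def using continuous_Psi_fixed_factor[OF that] U by (rule openin_continuous_map_preimage)
  then have "openin quotient_semidirect_topology (V e \<times> {e})" if "e \<in> {id, eps}" for e
    using that unfolding quotient_semidirect_topology_def openin_prod_Times_iff by auto
  then have "openin quotient_semidirect_topology (\<Union>e\<in>{id, eps}. V e \<times> {e})"
    by (intro openin_Union) auto
  moreover have "{z \<in> topspace quotient_semidirect_topology. Psi z \<in> U} = (\<Union>e\<in>{id, eps}. V e \<times> {e})"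
    unfolding topspace_quotient carrier_quotient V_def topspace_coset by auto
  ultimately show "openin quotient_semidirect_topology {z \<in> topspace quotient_semidirect_topology. Psi z \<in> U}"
    by (simp only:)
qed

lemma homeomorphic_Psi: "homeomorphic_map quotient_semidirect_topology (top_of_set fixed_group) Psi"
proof (rule continuous_imp_homeomorphic_map)
  show "continuous_map quotient_semidirect_topology (top_of_set fixed_group) Psi"
    by (rule continuous_Psi)
  show "compact_space quotient_semidirect_topology"
    unfolding quotient_semidirect_topology_def
    by (simp add: compact_space_prod_topology compact_coset compact_space_discrete_topology)
  have "Hausdorff_space (euclidean :: (freud \<Rightarrow> freud) topology)"
    unfolding euclidean_product_topology[symmetric]
    by (simp add: Hausdorff_space_product_topology)
  then show "Hausdorff_space (top_of_set fixed_group)"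
    by (rule Hausdorff_space_subtopology)
  show "Psi ` topspace quotient_semidirect_topology = topspace (top_of_set fixed_group)"
    "inj_on Psi (topspace quotient_semidirect_topology)"
    using Psi_bij by (simp_all add: topspace_quotient bij_betw_def)
qed

theorem theorem4p14p4:
  "\<exists>h \<in> iso (transformation_group
                (E7_fix (lambda7 \<circ> gamma7) \<inter> E7_fix (lambda7 \<circ> gamma7 \<circ> sigma7)))
             quotient_semidirect.
     homeomorphic_map
       (top_of_set (E7_fix (lambda7 \<circ> gamma7) \<inter> E7_fix (lambda7 \<circ> gamma7 \<circ> sigma7)))
       quotient_semidirect_topology h"
proof -
  obtain h where h: "homeomorphic_maps quotient_semidirect_topology (top_of_set fixed_group) Psi h"
    using homeomorphic_Psi unfolding homeomorphic_map_maps by blast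
  have hP: "h (Psi z) = z" if "z \<in> carrier quotient_semidirect" for z
    using h that unfolding homeomorphic_maps_def topspace_quotient by blast
  have Ph: "Psi (h \<alpha>) = \<alpha>" "h \<alpha> \<in> carrier quotient_semidirect" if "\<alpha> \<in> fixed_group" for \<alpha>
    using h that unfolding homeomorphic_maps_def continuous_map_def topspace_quotient by auto
  \<comment> \<open>Multiplicativity passes from \<open>Psi\<close> to its inverse.\<close>
  have "h (\<alpha> \<circ> \<beta>) = h \<alpha> \<otimes>\<^bsub>quotient_semidirect\<^esub> h \<beta>" if "\<alpha> \<in> fixed_group" "\<beta> \<in> fixed_group" for \<alpha> \<beta>
    using hP[OF Psi_mult(1)[OF Ph(2) Ph(2), OF that]] Psi_mult(2)[OF Ph(2) Ph(2), OF that]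
    by (simp only: Ph that)
  then have "h \<in> hom (transformation_group fixed_group) quotient_semidirect"
    unfolding hom_def transformation_group_def using Ph(2) by auto
  moreover have "bij_betw h fixed_group (carrier quotient_semidirect)"
    using hP Ph Psi_bij by (intro bij_betw_byWitness[where f' = Psi]) (auto simp: bij_betw_def)
  ultimately have "h \<in> iso (transformation_group fixed_group) quotient_semidirect"
    by (simp add: iso_def transformation_group_def)
  moreover have "homeomorphic_map (top_of_set fixed_group) quotient_semidirect_topology h"
    using h unfolding homeomorphic_maps_map by blast
  ultimately show ?thesis
    unfolding fixed_group_def by blast
qed

end
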